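(* Let $X$ be a countable set, $r,d\ge1$, $0\le q\le d/2$, $a_0,\dots,a_d\in M_r(\mathbb C)$, and $(\sigma_i)_{i\in[d]}$ permutations of $X$ with $\sigma_{i^*}=\sigma_i^{-1}$. Let $A=a_0\otimes1+\sum_{i=1}^d a_i\otimes S_i$ on $\mathbb C^r\otimes\ell^2(X)$, and let $A_\star=a_0\otimes 1+\sum_{i=1}^d a_i\otimes\lambda(g_i)$ on $\mathbb C^r\otimes\ell^2(X_\star)$. For $\mu\in\mathbb C\setminus\hat\sigma(A_\star)$ let $B_\mu$ and $(B_\star)_\mu$ be the associated non-backtracking operators defined in the context. Then: (i) For any $\mu\notin\mathrm{full}(\hat\sigma(A_\star))$, we have $\rho((B_\star)_\mu)<1$. (ii) For any $\varepsilon>0$ there exists $\delta>0$ such that if for all $\mu\in\mathbb C\setminus\hat\sigma(A_\star)$ $$\rho(B_\mu)<\rho((B_\star)_\mu)+\delta,$$ then $\mathrm{full}(\sigma(A))$ is contained in the $\varepsilon$-neighbourhood of $\mathrm{full}(\hat\sigma(A_\star))$. Moreover, if $U\subset\ell^2(X)$ is a vector subspace of finite codimension with $S_iU=U$ for all $i\in[d]$, $H=\mathbb C^r\otimes U$ and $K=\mathbb C^r\otimes U\otimes\mathbb C^d$, then the same holds with $A$ replaced by $A_{|H}$ and $B_\mu$ replaced by $(B_\mu)_{|K}$.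
   Context: $\sigma(T)$ is the spectrum and $\rho(T)$ the spectral radius of $T$. $[d]=\{1,\dots,d\}$ carries the involution: $i^*=i+q$ for $1\le i\le q$; $i^*=i-q$ for $q+1\le i\le2q$; $i^*=i$ for $2q+1\le i\le d$. $S_i$ is the unitary $(S_ig)(x)=g(\sigma_i(x))$ on $\ell^2(X)$. $X_\star$ is the free product of $q$ copies of $\mathbb Z$ and $d-2q$ copies of $\mathbb Z_2$, with generators $g_1,\dots,g_d$: for $1\le i\le q$, $g_i$ generates the $i$-th copy of $\mathbb Z$ and $g_{i+q}=g_i^{-1}$; for $2q<i\le d$, $g_i$ generates the $(i-2q)$-th copy of $\mathbb Z_2$. $o$ is its unit, $\lambda$ its left regular representation on $\ell^2(X_\star)$ ($\lambda(g)\delta_h=\delta_{gh}$). For an operator $M$ on $\mathbb C^r\otimes\ell^2(X_\star)$, $M_{xy}=(1\otimes\langle\delta_x,\cdot\,\delta_y\rangle)(M)\in M_r(\mathbb C)$ denotes its block entries. $A_\star^{(o)}$ is the operator on $\mathbb C^r\otimes\ell^2(X_\star)$ obtained from $A_\star$ by replacing with $0$ all block entries $(A_\star)_{g_j o}=a_j$ and $(A_\star)_{o g_j}=a_{j^*}$, $j\in[d]$ (isolating the unit $o$ but keeping $(A_\star)_{oo}=a_0$). Set $\hat\sigma(A_\star)=\sigma(A_\star)\cup\sigma(A_\star^{(o)})$. For $\mu\notin\hat\sigma(A_\star)$ let $G(\mu)=(\mu-A_\star)^{-1}$; then $G_{oo}(\mu)$ is invertible in $M_r(\mathbb C)$, and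 one sets $\hat a_i(\mu)=G_{oo}(\mu)^{-1}G_{g_io}(\mu)$, $i\in[d]$. The non-backtracking operator of $b_0\otimes 1+\sum_i b_i\otimes S_i$ is the operator $\sum_{(i,j)\in[d]^2:\,j\ne i^*}b_j\otimes S_i\otimes E_{ij}$ on $\mathbb C^r\otimes\ell^2(X)\otimes\mathbb C^d$, where $E_{ij}$ is the $d\times d$ matrix unit. $B_\mu$ is the non-backtracking operator of $\sum_{i}\hat a_i(\mu)\otimes S_i$, i.e. $B_\mu=\sum_{j\ne i^*}\hat a_j(\mu)\otimes S_i\otimes E_{ij}$, and $(B_\star)_\mu=\sum_{j\ne i^*}\hat a_j(\mu)\otimes\lambda(g_i)\otimes E_{ij}$ on $\mathbb C^r\otimes\ell^2(X_\star)\otimes\mathbb C^d$. For bounded $D\subset\mathbb C$, $\mathrm{full}(D)=\mathbb C\setminus W$ where $W$ is the unique unbounded connected component of $\mathbb C\setminus D$. *)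

theory Defs
  imports
    "HOL-Analysis.Analysis"
    "HOL-Algebra.Elementary_Groups"
    "HOL-Combinatorics.Permutations"
begin

text \<open>
  Elements of the free product of the groups \<open>G i\<close>, \<open>i \<in> I\<close>, are the reduced words: lists of
  syllables \<open>(i, x)\<close> with \<open>x\<close> a non-unit element of \<open>G i\<close>, neighbouring syllables lying in
  different factors.
\<close>

definition fp_cons :: "('i \<Rightarrow> ('g, 'm) monoid_scheme) \<Rightarrow> 'i \<Rightarrow> 'g \<Rightarrow> ('i \<times> 'g) list \<Rightarrow> ('i \<times> 'g) list"
  where "fp_cons G i x w = (if x = \<one>\<^bsub>G i\<^esub> then w else (i, x) # w)"

fun fp_lmult :: "('i \<Rightarrow> ('g, 'm) monoid_scheme) \<Rightarrow> 'i \<times> 'g \<Rightarrow> ('i \<times> 'g) list \<Rightarrow> ('i \<times> 'g) list"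
  where
    "fp_lmult G (i, x) [] = fp_cons G i x []"
  | "fp_lmult G (i, x) ((j, y) # w) =
      (if i = j then fp_cons G i (x \<otimes>\<^bsub>G i\<^esub> y) w else fp_cons G i x ((j, y) # w))"

definition free_product :: "('i \<Rightarrow> ('g, 'm) monoid_scheme) \<Rightarrow> 'i set \<Rightarrow> ('i \<times> 'g) list monoid"
  where "free_product G I =
    \<lparr>carrier = {w. (\<forall>(i, x) \<in> set w. i \<in> I \<and> x \<in> carrier (G i) \<and> x \<noteq> \<one>\<^bsub>G i\<^esub>) \<and> distinct_adj (map fst w)},
     monoid.mult = (\<lambda>v w. foldr (fp_lmult G) v w),
     one = []\<rparr>"

lemma one_free_product [simp]: "\<one>\<^bsub>free_product G I\<^esub> = []"
  and mult_free_product: "v \<otimes>\<^bsub>free_product G I\<^esub> w = foldr (fp_lmult G) v w"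
  by (simp_all add: free_product_def)

lemma Nil_in_free_product [simp]: "[] \<in> carrier (free_product G I)"
  by (simp add: free_product_def)

lemma Cons_in_free_product:
  "(i, x) # w \<in> carrier (free_product G I) \<longleftrightarrow>
    i \<in> I \<and> x \<in> carrier (G i) \<and> x \<noteq> \<one>\<^bsub>G i\<^esub> \<and> w \<in> carrier (free_product G I) \<and>
    (w = [] \<or> fst (hd w) \<noteq> i)"
  by (cases w) (auto simp: free_product_def)

context
  fixes G :: "'i \<Rightarrow> ('g, 'm) monoid_scheme" and I :: "'i set"
  assumes grp: "\<And>i. i \<in> I \<Longrightarrow> group (G i)"
begin

lemma fp_lmult_closed:
  assumes "i \<in> I" "x \<in> carrier (G i)" "w \<in> carrier (free_product G I)"
  shows "fp_lmult G (i, x) w \<in> carrier (free_product G I)"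
proof (cases w)
  case Nil
  then show ?thesis using assms by (simp add: fp_cons_def Cons_in_free_product)
next
  case (Cons s v)
  obtain j y where s: "s = (j, y)" by fastforce
  show ?thesis using assms Cons s
    by (auto simp: fp_cons_def Cons_in_free_product monoid.m_closed monoid.l_one
      group.is_monoid[OF grp])
qed

lemma fp_lmult_one:
  assumes "i \<in> I" "w \<in> carrier (free_product G I)"
  shows "fp_lmult G (i, \<one>\<^bsub>G i\<^esub>) w = w"
proof (cases w)
  case Nil
  then show ?thesis by (simp add: fp_cons_def)
next
  case (Cons s v)
  obtain j y where s: "s = (j, y)" by fastforce
  show ?thesis using assms Cons s
    by (auto simp: fp_cons_def Cons_in_free_product monoid.m_closed monoid.l_one
      group.is_monoid[OF grp])
qed

lemma fp_lmult_lmult: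
  assumes "i \<in> I" "x \<in> carrier (G i)" "y \<in> carrier (G i)" "w \<in> carrier (free_product G I)"
  shows "fp_lmult G (i, x) (fp_lmult G (i, y) w) = fp_lmult G (i, x \<otimes>\<^bsub>G i\<^esub> y) w"
proof -
  interpret group "G i" using grp assms(1) .
  have fresh: "fp_lmult G (i, x) (fp_cons G i z v) = fp_cons G i (x \<otimes>\<^bsub>G i\<^esub> z) v"
    if "v = [] \<or> fst (hd v) \<noteq> i" "z \<in> carrier (G i)" for z v
    using that assms(2) by (cases v) (auto simp: fp_cons_def)
  show ?thesis
  proof (cases w)
    case Nil
    then show ?thesis using fresh[of "[]" y] assms by simp
  next
    case (Cons s v)
    obtain j u where s: "s = (j, u)" by fastforce
    show ?thesis
    proof (cases "i = j")
      case True
      then show ?thesis using fresh[of v "y \<otimes>\<^bsub>G i\<^esub> u"] assms Cons s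
        by (auto simp: Cons_in_free_product monoid.m_assoc monoid.m_closed group.is_monoid[OF grp])
    next
      case False
      then show ?thesis using fresh[of w y] assms Cons s by simp
    qed
  qed
qed

lemma fp_mult_closed:
  assumes "v \<in> carrier (free_product G I)" "w \<in> carrier (free_product G I)"
  shows "foldr (fp_lmult G) v w \<in> carrier (free_product G I)"
  using assms(1)
proof (induction v)
  case Nil
  then show ?case using assms(2) by simp
next
  case (Cons s v)
  then show ?case by (cases s) (auto simp: Cons_in_free_product intro!: fp_lmult_closed)
qed

lemma fp_mult_lmult:
  assumes "i \<in> I" "x \<in> carrier (G i)"
    "v \<in> carrier (free_product G I)" "w \<in> carrier (free_product G I)"
  shows "foldr (fp_lmult G) (fp_lmult G (i, x) v) w = fp_lmult G (i, x) (foldr (fp_lmult G) v w)"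
proof -
  have cons: "foldr (fp_lmult G) (fp_cons G i z u) w = fp_lmult G (i, z) (foldr (fp_lmult G) u w)"
    if "u \<in> carrier (free_product G I)" for z u
    using that fp_lmult_one[OF assms(1) fp_mult_closed[OF that assms(4)]]
    by (auto simp: fp_cons_def)
  show ?thesis
  proof (cases v)
    case Nil
    then show ?thesis using cons[of "[]" x] by simp
  next
    case (Cons s u)
    obtain j y where s: "s = (j, y)" by fastforce
    show ?thesis
    proof (cases "i = j")
      case True
      have "u \<in> carrier (free_product G I)" "y \<in> carrier (G i)"
        using assms(3) Cons s True by (auto simp: Cons_in_free_product)
      then show ?thesis using cons[of u] Cons s True
          fp_lmult_lmult[OF assms(1,2) _ fp_mult_closed[OF _ assms(4)]] by simp
    next
      case False
      then show ?thesis using cons[OF assms(3)] Cons s by simp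
    qed
  qed
qed

lemma group_free_product: "group (free_product G I)"
proof (rule groupI)
  fix u v w
  assume *: "u \<in> carrier (free_product G I)" "v \<in> carrier (free_product G I)"
    "w \<in> carrier (free_product G I)"
  from *(1) have "foldr (fp_lmult G) (foldr (fp_lmult G) u v) w =
      foldr (fp_lmult G) u (foldr (fp_lmult G) v w)"
  proof (induction u)
    case (Cons s u)
    then show ?case using *(2,3)
      by (cases s) (auto simp: Cons_in_free_product fp_mult_lmult fp_mult_closed)
  qed simp
  then show "u \<otimes>\<^bsub>free_product G I\<^esub> v \<otimes>\<^bsub>free_product G I\<^esub> w =
      u \<otimes>\<^bsub>free_product G I\<^esub> (v \<otimes>\<^bsub>free_product G I\<^esub> w)"
    by (simp add: mult_free_product)
next
  fix w
  assume "w \<in> carrier (free_product G I)"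
  then have "\<exists>v \<in> carrier (free_product G I). foldr (fp_lmult G) v w = []"
  proof (induction w)
    case Nil
    then show ?case by (intro bexI[of _ "[]"]) auto
  next
    case (Cons s w)
    obtain i x where s: "s = (i, x)" by fastforce
    have ix: "i \<in> I" "x \<in> carrier (G i)" "x \<noteq> \<one>\<^bsub>G i\<^esub>" "w \<in> carrier (free_product G I)"
      using Cons.prems s by (auto simp: Cons_in_free_product)
    then obtain v where v: "v \<in> carrier (free_product G I)" "foldr (fp_lmult G) v w = []"
      using Cons.IH by blast
    interpret group "G i" using grp ix(1) .
    define t where "t = [(i, inv\<^bsub>G i\<^esub> x)]"
    have t: "t \<in> carrier (free_product G I)"
      using ix by (auto simp: t_def Cons_in_free_product)
    have tw: "foldr (fp_lmult G) t (s # w) = w"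
      using ix by (simp add: t_def s fp_cons_def)
    have assoc: "foldr (fp_lmult G) (foldr (fp_lmult G) u t) (s # w) =
        foldr (fp_lmult G) u (foldr (fp_lmult G) t (s # w))"
      if "u \<in> carrier (free_product G I)" for u
      using that
    proof (induction u)
      case (Cons a u)
      have "foldr (fp_lmult G) (fp_lmult G a (foldr (fp_lmult G) u t)) (s # w) =
          fp_lmult G a (foldr (fp_lmult G) (foldr (fp_lmult G) u t) (s # w))"
        using Cons.prems \<open>s # w \<in> carrier (free_product G I)\<close> t
        by (cases a) (auto simp only: Cons_in_free_product intro!: fp_mult_lmult fp_mult_closed)
      then show ?case using Cons by (cases a) (simp add: Cons_in_free_product)
    qed simp
    show ?case
      using assoc[OF v(1)] tw v fp_mult_closed[OF v(1) t]
      by (intro bexI[of _ "foldr (fp_lmult G) v t"]) simp_all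
  qed
  then show "\<exists>v \<in> carrier (free_product G I). v \<otimes>\<^bsub>free_product G I\<^esub> w = \<one>\<^bsub>free_product G I\<^esub>"
    by (simp add: mult_free_product)
qed (auto simp: mult_free_product fp_mult_closed)

end

text \<open>
  The index set \<open>{1..d}\<close> carries the involution \<open>conj_idx q\<close>.  Factors are labelled by one of
  their generators: labels \<open>1..q\<close> for the infinite cyclic factors, \<open>2 * q + 1..d\<close> for those of
  order two.
\<close>

definition conj_idx :: "nat \<Rightarrow> nat \<Rightarrow> nat"
  where "conj_idx q i =
    (if 1 \<le> i \<and> i \<le> q then i + q else if q + 1 \<le> i \<and> i \<le> 2 * q then i - q else i)"

definition Xstar_factor :: "nat \<Rightarrow> nat \<Rightarrow> int monoid"
  where "Xstar_factor q i = (if i \<le> q then integer_group else integer_mod_group 2)"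

definition Xstar :: "nat \<Rightarrow> nat \<Rightarrow> (nat \<times> int) list monoid"
  where "Xstar q d = free_product (Xstar_factor q) ({1..q} \<union> {2 * q + 1..d})"

definition Xgen :: "nat \<Rightarrow> nat \<Rightarrow> nat \<Rightarrow> (nat \<times> int) list"
  where "Xgen q d i =
    (if q + 1 \<le> i \<and> i \<le> 2 * q then inv\<^bsub>Xstar q d\<^esub> [(i - q, 1)] else [(i, 1)])"

lemma group_Xstar: "group (Xstar q d)"
  unfolding Xstar_def by (rule group_free_product) (auto simp: Xstar_factor_def)

lemma Xgen_eq:
  assumes "q + 1 \<le> i" "i \<le> 2 * q"
  shows "Xgen q d i = [(i - q, - 1)]"
proof -
  interpret group "Xstar q d" by (rule group_Xstar)
  have "inv\<^bsub>Xstar q d\<^esub> [(i - q, 1)] = [(i - q, - 1)]"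
    using assms
    by (intro inv_equality)
      (auto simp: Xstar_def Xstar_factor_def mult_free_product Cons_in_free_product fp_cons_def)
  then show ?thesis using assms by (simp add: Xgen_def)
qed

lemma Xgen_closed:
  assumes "2 * q \<le> d" "i \<in> {1..d}"
  shows "Xgen q d i \<in> carrier (Xstar q d)"
proof (cases "q + 1 \<le> i \<and> i \<le> 2 * q")
  case True
  then have "i - q \<in> {1..q} \<union> {2 * q + 1..d}" "i - q \<le> q"
    by auto
  then show ?thesis using True
    by (simp add: Xgen_eq) (simp add: Xstar_def Xstar_factor_def Cons_in_free_product)
next
  case False
  then have "i \<in> {1..q} \<union> {2 * q + 1..d}"
    using assms by auto
  then show ?thesis using False
    by (auto simp: Xgen_def Xstar_def Xstar_factor_def Cons_in_free_product)
qed

text \<open>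
  \<open>ell2 X\<close> at value type \<open>complex\<close> is the scalar space, and at value type \<open>complex^'r\<close> (with the
  Euclidean norm) it is its Hilbert tensor product with \<open>complex^'r\<close>.  A further
  \<open>d\<close>-dimensional tensor factor is absorbed into the index set \<open>X \<times> {1..d}\<close>.
\<close>

definition ell2 :: "'x set \<Rightarrow> ('x \<Rightarrow> 'b::real_normed_vector) set"
  where "ell2 X = {f. (\<forall>x. x \<notin> X \<longrightarrow> f x = 0) \<and> (\<lambda>x. (norm (f x))\<^sup>2) summable_on X}"

definition ell2_norm :: "('x \<Rightarrow> 'b::real_normed_vector) \<Rightarrow> real"
  where "ell2_norm f = sqrt (\<Sum>\<^sub>\<infinity>x. (norm (f x))\<^sup>2)"

definition bounded_op_on ::
    "('x \<Rightarrow> complex^'r) set \<Rightarrow> (('x \<Rightarrow> complex^'r) \<Rightarrow> ('x \<Rightarrow> complex^'r)) \<Rightarrow> bool"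
  where "bounded_op_on H T \<longleftrightarrow>
    (\<forall>f\<in>H. T f \<in> H) \<and>
    (\<forall>f\<in>H. \<forall>g\<in>H. T (\<lambda>x. f x + g x) = (\<lambda>x. T f x + T g x)) \<and>
    (\<forall>f\<in>H. \<forall>c. T (\<lambda>x. c *s f x) = (\<lambda>x. c *s T f x)) \<and>
    (\<exists>C. \<forall>f\<in>H. ell2_norm (T f) \<le> C * ell2_norm f)"

definition is_resolvent ::
    "('x \<Rightarrow> complex^'r) set \<Rightarrow> (('x \<Rightarrow> complex^'r) \<Rightarrow> ('x \<Rightarrow> complex^'r)) \<Rightarrow> complex \<Rightarrow>
     (('x \<Rightarrow> complex^'r) \<Rightarrow> ('x \<Rightarrow> complex^'r)) \<Rightarrow> bool"
  where "is_resolvent H T z R \<longleftrightarrow>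
    bounded_op_on H R \<and>
    (\<forall>f\<in>H. R (\<lambda>x. z *s f x - T f x) = f) \<and>
    (\<forall>f\<in>H. (\<lambda>x. z *s R f x - T (R f) x) = f)"

text \<open>The spectrum of the restriction of \<open>T\<close> to the (invariant) space \<open>H\<close>.\<close>

definition spectrum_on ::
    "('x \<Rightarrow> complex^'r) set \<Rightarrow> (('x \<Rightarrow> complex^'r) \<Rightarrow> ('x \<Rightarrow> complex^'r)) \<Rightarrow> complex set"
  where "spectrum_on H T = {z. \<not> (\<exists>R. is_resolvent H T z R)}"

text \<open>Inserting \<open>0\<close> only matters when the spectrum is empty, i.e. on the zero space.\<close>

definition spec_radius_on ::
    "('x \<Rightarrow> complex^'r) set \<Rightarrow> (('x \<Rightarrow> complex^'r) \<Rightarrow> ('x \<Rightarrow> complex^'r)) \<Rightarrow> real"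
  where "spec_radius_on H T = Sup (insert 0 (norm ` spectrum_on H T))"

text \<open>Values of the resolvent are determined on \<open>H\<close> only.\<close>

definition resolvent_on ::
    "('x \<Rightarrow> complex^'r) set \<Rightarrow> (('x \<Rightarrow> complex^'r) \<Rightarrow> ('x \<Rightarrow> complex^'r)) \<Rightarrow> complex \<Rightarrow>
     (('x \<Rightarrow> complex^'r) \<Rightarrow> ('x \<Rightarrow> complex^'r))"
  where "resolvent_on H T z = (SOME R. is_resolvent H T z R)"

definition tensor_op ::
    "complex^'r^'r \<Rightarrow> (('x \<Rightarrow> complex) \<Rightarrow> ('x \<Rightarrow> complex)) \<Rightarrow> ('x \<Rightarrow> complex^'r) \<Rightarrow> ('x \<Rightarrow> complex^'r)"
  where "tensor_op m V f = (\<lambda>x. m *v (\<chi> k. V (\<lambda>y. f y $ k) x))"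

text \<open>Column \<open>l\<close> of the block \<open>M\<^bsub>xy\<^esub>\<close> is the value at \<open>x\<close> of the image of \<open>e\<^sub>l \<otimes> \<delta>\<^sub>y\<close>.\<close>

definition block :: "(('x \<Rightarrow> complex^'r) \<Rightarrow> ('x \<Rightarrow> complex^'r)) \<Rightarrow> 'x \<Rightarrow> 'x \<Rightarrow> complex^'r^'r"
  where "block M x y = (\<chi> k l. M (\<lambda>z. if z = y then axis l 1 else 0) x $ k)"

text \<open>The operator whose blocks at the finitely many positions in \<open>E\<close> are replaced by \<open>0\<close>.\<close>

definition zero_blocks ::
    "('x \<times> 'x) set \<Rightarrow> (('x \<Rightarrow> complex^'r) \<Rightarrow> ('x \<Rightarrow> complex^'r)) \<Rightarrow> ('x \<Rightarrow> complex^'r) \<Rightarrow> ('x \<Rightarrow> complex^'r)"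
  where "zero_blocks E M f = (\<lambda>x. M f x - (\<Sum>y | (x, y) \<in> E. block M x y *v f y))"

text \<open>\<open>V\<close> is the family of unitaries of the scalar space attached to the indices \<open>{1..d}\<close>.\<close>

definition matrix_op ::
    "nat \<Rightarrow> (nat \<Rightarrow> complex^'r^'r) \<Rightarrow> (nat \<Rightarrow> ('x \<Rightarrow> complex) \<Rightarrow> ('x \<Rightarrow> complex)) \<Rightarrow>
     ('x \<Rightarrow> complex^'r) \<Rightarrow> ('x \<Rightarrow> complex^'r)"
  where "matrix_op d a V f =
    (\<lambda>x. tensor_op (a 0) (\<lambda>g. g) f x + (\<Sum>i\<in>{1..d}. tensor_op (a i) (V i) f x))"

definition nonbacktracking_op ::
    "nat \<Rightarrow> nat \<Rightarrow> (nat \<Rightarrow> complex^'r^'r) \<Rightarrow> (nat \<Rightarrow> ('x \<Rightarrow> complex) \<Rightarrow> ('x \<Rightarrow> complex)) \<Rightarrow>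
     ('x \<times> nat \<Rightarrow> complex^'r) \<Rightarrow> ('x \<times> nat \<Rightarrow> complex^'r)"
  where "nonbacktracking_op q d b V f =
    (\<lambda>(x, i). if i \<in> {1..d}
       then (\<Sum>j | j \<in> {1..d} \<and> j \<noteq> conj_idx q i. tensor_op (b j) (V i) (\<lambda>y. f (y, j)) x)
       else 0)"

definition perm_op :: "('x \<Rightarrow> 'x) \<Rightarrow> ('x \<Rightarrow> complex) \<Rightarrow> ('x \<Rightarrow> complex)"
  where "perm_op s g = (\<lambda>x. g (s x))"

definition left_regular :: "('g, 'm) monoid_scheme \<Rightarrow> 'g \<Rightarrow> ('g \<Rightarrow> complex) \<Rightarrow> ('g \<Rightarrow> complex)"
  where "left_regular G g f = (\<lambda>x. if x \<in> carrier G then f (inv\<^bsub>G\<^esub> g \<otimes>\<^bsub>G\<^esub> x) else 0)"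

lemma left_regular_delta:
  assumes "group G" "g \<in> carrier G" "h \<in> carrier G"
  shows "left_regular G g (\<lambda>x. if x = h then 1 else 0) = (\<lambda>x. if x = g \<otimes>\<^bsub>G\<^esub> h then 1 else 0)"
proof -
  interpret group G by fact
  show ?thesis using assms by (auto simp: left_regular_def fun_eq_iff inv_solve_left')
qed

definition lambda_gen :: "nat \<Rightarrow> nat \<Rightarrow> nat \<Rightarrow>
    ((nat \<times> int) list \<Rightarrow> complex) \<Rightarrow> ((nat \<times> int) list \<Rightarrow> complex)"
  where "lambda_gen q d i = left_regular (Xstar q d) (Xgen q d i)"

definition A_star :: "nat \<Rightarrow> nat \<Rightarrow> (nat \<Rightarrow> complex^'r^'r) \<Rightarrow>
    ((nat \<times> int) list \<Rightarrow> complex^'r) \<Rightarrow> ((nat \<times> int) list \<Rightarrow> complex^'r)"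
  where "A_star q d a = matrix_op d a (lambda_gen q d)"

definition A_star_o :: "nat \<Rightarrow> nat \<Rightarrow> (nat \<Rightarrow> complex^'r^'r) \<Rightarrow>
    ((nat \<times> int) list \<Rightarrow> complex^'r) \<Rightarrow> ((nat \<times> int) list \<Rightarrow> complex^'r)"
  where "A_star_o q d a =
    zero_blocks
      ((\<lambda>j. (Xgen q d j, \<one>\<^bsub>Xstar q d\<^esub>)) ` {1..d} \<union> (\<lambda>j. (\<one>\<^bsub>Xstar q d\<^esub>, Xgen q d j)) ` {1..d})
      (A_star q d a)"

definition hat_spectrum :: "nat \<Rightarrow> nat \<Rightarrow> (nat \<Rightarrow> complex^'r^'r) \<Rightarrow> complex set"
  where "hat_spectrum q d a =
    spectrum_on (ell2 (carrier (Xstar q d))) (A_star q d a) \<union>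
    spectrum_on (ell2 (carrier (Xstar q d))) (A_star_o q d a)"

definition a_hat :: "nat \<Rightarrow> nat \<Rightarrow> (nat \<Rightarrow> complex^'r^'r) \<Rightarrow> complex \<Rightarrow> nat \<Rightarrow> complex^'r^'r"
  where "a_hat q d a \<mu> i =
    (let G = resolvent_on (ell2 (carrier (Xstar q d))) (A_star q d a) \<mu>; e = \<one>\<^bsub>Xstar q d\<^esub>
     in matrix_inv (block G e e) ** block G (Xgen q d i) e)"

definition B_star :: "nat \<Rightarrow> nat \<Rightarrow> (nat \<Rightarrow> complex^'r^'r) \<Rightarrow> complex \<Rightarrow>
    ((nat \<times> int) list \<times> nat \<Rightarrow> complex^'r) \<Rightarrow> ((nat \<times> int) list \<times> nat \<Rightarrow> complex^'r)"
  where "B_star q d a \<mu> = nonbacktracking_op q d (a_hat q d a \<mu>) (lambda_gen q d)"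

definition A_perm :: "nat \<Rightarrow> (nat \<Rightarrow> complex^'r^'r) \<Rightarrow> (nat \<Rightarrow> 'x \<Rightarrow> 'x) \<Rightarrow>
    ('x \<Rightarrow> complex^'r) \<Rightarrow> ('x \<Rightarrow> complex^'r)"
  where "A_perm d a s = matrix_op d a (\<lambda>i. perm_op (s i))"

definition B_perm :: "nat \<Rightarrow> nat \<Rightarrow> (nat \<Rightarrow> complex^'r^'r) \<Rightarrow> (nat \<Rightarrow> 'x \<Rightarrow> 'x) \<Rightarrow> complex \<Rightarrow>
    ('x \<times> nat \<Rightarrow> complex^'r) \<Rightarrow> ('x \<times> nat \<Rightarrow> complex^'r)"
  where "B_perm q d a s \<mu> = nonbacktracking_op q d (a_hat q d a \<mu>) (\<lambda>i. perm_op (s i))"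

definition full :: "complex set \<Rightarrow> complex set"
  where "full D = - (THE W. W \<in> components (- D) \<and> \<not> bounded W)"

definition nbhd :: "real \<Rightarrow> complex set \<Rightarrow> complex set"
  where "nbhd \<epsilon> D = (\<Union>w\<in>D. ball w \<epsilon>)"

text \<open>Complex subspaces of \<open>ell2 X\<close> of finite codimension, not required to be closed.\<close>

definition finite_codim_subspace :: "'x set \<Rightarrow> ('x \<Rightarrow> complex) set \<Rightarrow> bool"
  where "finite_codim_subspace X U \<longleftrightarrow>
    U \<subseteq> ell2 X \<and>
    (\<lambda>x. 0) \<in> U \<and>
    (\<forall>f\<in>U. \<forall>g\<in>U. (\<lambda>x. f x + g x) \<in> U) \<and>
    (\<forall>f\<in>U. \<forall>c. (\<lambda>x. c * f x) \<in> U) \<and>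
    (\<exists>F. finite F \<and> F \<subseteq> ell2 X \<and>
      (\<forall>f\<in>ell2 X. \<exists>u\<in>U. \<exists>c. f = (\<lambda>x. u x + (\<Sum>v\<in>F. c v * v x))))"

definition tensor_H :: "('x \<Rightarrow> complex) set \<Rightarrow> ('x \<Rightarrow> complex^'r) set"
  where "tensor_H U = {f. \<forall>k. (\<lambda>x. f x $ k) \<in> U}"

definition tensor_K :: "nat \<Rightarrow> ('x \<Rightarrow> complex) set \<Rightarrow> ('x \<times> nat \<Rightarrow> complex^'r) set"
  where "tensor_K d U =
    {f. (\<forall>i\<in>{1..d}. \<forall>k. (\<lambda>x. f (x, i) $ k) \<in> U) \<and> (\<forall>x i. i \<notin> {1..d} \<longrightarrow> f (x, i) = 0)}"

end

theory Submission
  imports Defs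
begin

text \<open>
  Edges of the Cayley tree of \<open>X\<^sub>\<star>\<close> are pairs \<open>(x, i)\<close>, the edge from \<open>g\<^sub>i\<inverse> x\<close> to \<open>x\<close>, and
  \<open>(B\<^sub>\<star>)\<^sub>\<mu>\<close> transports functions along non-backtracking walks on them.

  \<^emph>\<open>The spectral radius of \<open>(B\<^sub>\<star>)\<^sub>\<mu>\<close>.\<close>  Let \<open>\<mu>\<close> lie outside the spectra of \<open>A\<^sub>\<star>\<close> and of its isolated
  version.  Every vertex separates the tree, so the Green function factorises: for a reduced word
  \<open>w\<close> the block at \<open>(w, o)\<close> is \<open>G\<^sub>o\<^sub>o M\<^sub>w\<close>, where \<open>M\<^sub>w\<close> is the product of the matrices
  \<open>b\<^sub>i = a_hat q d a \<mu> i\<close> along the letters of \<open>w\<close> (\<open>green_append\<close>, \<open>green_path_weight\<close>).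
  A column of a bounded operator is square summable, so \<open>\<Sum>\<^sub>w \<parallel>M\<^sub>w\<parallel>\<^sup>2 < \<infinity>\<close>.  The sums over words
  of length \<open>n\<close> are also submultiplicative in \<open>n\<close>, hence decay exponentially
  (\<open>weight_sq_exponential\<close>).  Split the edges into those that lead away from the unit and those
  that lead towards it.  A non-backtracking walk that leads away from the unit does so for ever,
  so \<open>(B\<^sub>\<star>)\<^sub>\<mu>\<close> is block triangular for this splitting; the \<open>n\<close>-th powers of the two diagonal blocks
  have norms bounded by a multiple of the square root of the \<open>n\<close>-th sum (\<open>B_out_power_bound\<close>,
  \<open>B_in_power_bound\<close>).  Neumann series for the diagonal blocks and back substitution then produce
  the resolvent outside a disc of radius less than \<open>1\<close>.

  \<^emph>\<open>From \<open>B\<^sub>\<mu>\<close> to \<open>A\<close>.\<close>  The equations of the Green function at the unit and at its neighbours express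
  \<open>a\<^sub>i\<close> and \<open>\<mu> - a\<^sub>0\<close> through the \<open>b\<^sub>i\<close> and \<open>G\<^sub>o\<^sub>o\<close> (\<open>a_g_eq\<close>, \<open>a0_g_eq\<close>).  With these identities the inverse
  of \<open>1 - B\<^sub>\<mu>\<close> gives a formula for the inverse of \<open>\<mu> - A\<close>
  (\<open>resolvent_of_nonbacktracking_resolvent\<close>).  So if \<open>\<mu>\<close> in the spectrum of \<open>A\<close> lies outside
  \<open>full (hat_spectrum q d a)\<close>, then \<open>1\<close> is in the spectrum of \<open>B\<^sub>\<mu>\<close>, and
  \<open>\<rho>(B\<^sub>\<mu>) \<ge> 1 > \<rho>((B\<^sub>\<star>)\<^sub>\<mu>)\<close>.  So \<open>\<delta> = 1 - \<rho>((B\<^sub>\<star>)\<^sub>\<mu>)\<close> violates the hypothesis on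
  the spectral radii.

  \<^emph>\<open>Subspaces.\<close>  The formula for the inverse is algebraic and works on any invariant subspace.  That
  the spectra on \<open>H\<close> and \<open>K\<close> are bounded is a different matter, since these spaces may fail to be
  closed; it follows from finite codimension (\<open>resolvent_finite_codim\<close>).
\<close>

section \<open>Matrices and their Frobenius norm\<close>

lemma norm_matrix_vector_mult_le:
  fixes m :: "complex^'n^'m"
  shows "norm (m *v x) \<le> norm m * norm x"
proof -
  have row: "norm ((m *v x) $ k) \<le> norm (m $ k) * norm x" for k
  proof -
    have "norm ((m *v x) $ k) \<le> (\<Sum>l\<in>UNIV. norm (m $ k $ l * x $ l))"
      unfolding matrix_vector_mult_def by (simp add: norm_sum)
    also have "\<dots> = (\<Sum>l\<in>UNIV. \<bar>norm (m $ k $ l)\<bar> * \<bar>norm (x $ l)\<bar>)"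
      by (simp add: norm_mult)
    also have "\<dots> \<le> norm (m $ k) * norm x"
      unfolding norm_vec_def by (rule L2_set_mult_ineq)
    finally show ?thesis .
  qed
  have "norm (m *v x) \<le> L2_set (\<lambda>k. norm (m $ k) * norm x) UNIV"
    unfolding norm_vec_def[of "m *v x"] by (intro L2_set_mono row) auto
  also have "\<dots> = norm m * norm x"
    unfolding norm_vec_def[of m] by (simp add: L2_set_left_distrib)
  finally show ?thesis .
qed

lemma norm_vector_scalar_mult [simp]:
  fixes x :: "complex^'n"
  shows "norm (c *s x) = norm c * norm x"
  unfolding norm_vec_def by (simp add: norm_mult L2_set_right_distrib)

lemma matrix_vector_mult_axis: "((m :: complex^'n^'m) *v axis l 1) $ k = m $ k $ l"
  by (simp add: matrix_vector_mult_def axis_def if_distrib[of "\<lambda>x. _ * x"] cong: if_cong)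

text \<open>The square of the Frobenius norm is the sum of the squares of the columns.\<close>

lemma norm_matrix_sq_columns:
  fixes m :: "complex^'n^'m"
  shows "(norm m)\<^sup>2 = (\<Sum>l\<in>UNIV. (norm (m *v axis l 1))\<^sup>2)"
proof -
  have "(norm m)\<^sup>2 = (\<Sum>k\<in>UNIV. \<Sum>l\<in>UNIV. (norm (m $ k $ l))\<^sup>2)"
    by (simp add: norm_vec_def L2_set_def sum_nonneg)
  also have "\<dots> = (\<Sum>l\<in>UNIV. \<Sum>k\<in>UNIV. (norm (m $ k $ l))\<^sup>2)"
    by (rule sum.swap)
  also have "\<dots> = (\<Sum>l\<in>UNIV. (norm (m *v axis l 1))\<^sup>2)"
    by (simp add: norm_vec_def[of "m *v _"] L2_set_def sum_nonneg matrix_vector_mult_axis)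
  finally show ?thesis .
qed

lemma norm_matrix_matrix_mult_le:
  fixes m :: "complex^'n^'m" and p :: "complex^'k^'n"
  shows "norm (m ** p) \<le> norm m * norm p"
proof (rule power2_le_imp_le)
  have "(norm (m ** p))\<^sup>2 = (\<Sum>l\<in>UNIV. (norm (m *v (p *v axis l 1)))\<^sup>2)"
    by (simp add: norm_matrix_sq_columns matrix_vector_mul_assoc)
  also have "\<dots> \<le> (\<Sum>l\<in>UNIV. (norm m * norm (p *v axis l 1))\<^sup>2)"
    by (intro sum_mono power_mono norm_matrix_vector_mult_le) auto
  also have "\<dots> = (norm m * norm p)\<^sup>2"
    by (simp add: power_mult_distrib norm_matrix_sq_columns[of p] sum_distrib_left)
  finally show "(norm (m ** p))\<^sup>2 \<le> (norm m * norm p)\<^sup>2" .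
qed auto

lemma bounded_linear_vector_scalar_mult:
  "bounded_linear (\<lambda>x. (c::complex) *s (x :: complex^'n))"
  by (rule bounded_linear_intro[where K = "norm c"])
    (auto simp: vec_eq_iff algebra_simps)

lemma matrix_vector_mult_sum:
  fixes m :: "complex^'n^'m"
  shows "m *v (\<Sum>i\<in>I. f i) = (\<Sum>i\<in>I. m *v f i)"
  by (rule linear_sum[OF matrix_vector_mul_linear])

lemma vector_scalar_mult_sum:
  "(c::complex) *s (\<Sum>i\<in>I. f i :: complex^'n) = (\<Sum>i\<in>I. c *s f i)"
  by (rule linear_sum[OF bounded_linear.linear, OF bounded_linear_vector_scalar_mult])

lemma matrix_vector_mult_scalar:
  fixes m :: "complex^'n^'m"
  shows "m *v (c *s x) = c *s (m *v x)"
  by (simp add: matrix_vector_mult_def vec_eq_iff sum_distrib_left mult_ac)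

lemma vector_scalar_mult_diff: "(c::complex) *s (x - y :: complex^'n) = c *s x - c *s y"
  by (simp add: vec_eq_iff algebra_simps)

lemma vector_scalar_mult_add: "(c::complex) *s (x + y :: complex^'n) = c *s x + c *s y"
  by (simp add: vec_eq_iff algebra_simps)

lemma matrix_diff_ldistrib: "(A :: complex^'n^'m) ** (B - C) = A ** B - A ** C"
  by (simp add: vec_eq_iff matrix_matrix_mult_def sum_subtractf right_diff_distrib)

lemma matrix_diff_rdistrib: "((A :: complex^'n^'m) - B) ** C = A ** C - B ** C"
  by (simp add: vec_eq_iff matrix_matrix_mult_def sum_subtractf left_diff_distrib)

lemma minus_matrix_vector_mult: "(- m) *v (v :: complex^'n) = - (m *v v)"
  by (simp add: vec_eq_iff matrix_vector_mult_def sum_negf)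

lemma injective_matrix_inverse:
  fixes m :: "complex^'n^'n"
  assumes "\<And>v. m *v v = 0 \<Longrightarrow> v = 0"
  shows "m ** matrix_inv m = mat 1" "matrix_inv m ** m = mat 1"
proof -
  have "inj ((*v) m)"
    using assms by (metis (no_types) injI matrix_vector_mult_diff_distrib right_minus_eq)
  then obtain p where p: "p ** m = mat 1"
    using matrix_left_invertible_injective[of m] by auto
  then have "m ** p = mat 1"
    using matrix_left_right_inverse by blast
  then have "invertible m"
    using p unfolding invertible_def by blast
  then show "m ** matrix_inv m = mat 1" "matrix_inv m ** m = mat 1"
    unfolding matrix_inv_def invertible_def by (metis (mono_tags, lifting) someI_ex)+
qed

section \<open>The spaces of square summable functions\<close>

lemma ell2_outside: "f \<in> ell2 X \<Longrightarrow> x \<notin> X \<Longrightarrow> f x = 0"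
  by (simp add: ell2_def)

lemma ell2_summable_UNIV: "f \<in> ell2 X \<Longrightarrow> (\<lambda>x. (norm (f x))\<^sup>2) summable_on UNIV"
  unfolding ell2_def by (auto elim!: summable_on_cong_neutral[THEN iffD1, rotated -1])

lemma ell2_norm_nonneg [simp]: "0 \<le> ell2_norm f"
  by (simp add: ell2_norm_def infsum_nonneg)

lemma L2_set_le_ell2_norm:
  assumes "f \<in> ell2 X" "finite F"
  shows "L2_set (\<lambda>x. norm (f x)) F \<le> ell2_norm f"
  unfolding ell2_norm_def L2_set_def
  by (intro real_sqrt_le_mono finite_sum_le_infsum ell2_summable_UNIV[OF assms(1)] assms(2)) auto

lemma sum_norm_sq_le_ell2_norm:
  assumes "f \<in> ell2 X" "finite F"
  shows "(\<Sum>x\<in>F. (norm (f x))\<^sup>2) \<le> (ell2_norm f)\<^sup>2"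
  using L2_set_le_ell2_norm[OF assms] unfolding L2_set_def by (meson sqrt_le_D)

lemma norm_le_ell2_norm: "f \<in> ell2 X \<Longrightarrow> norm (f x) \<le> ell2_norm f"
  using L2_set_le_ell2_norm[of f X "{x}"] by simp

text \<open>Square summability and the norm are both detected on finite sets; every membership and every
  norm estimate below goes through this criterion.\<close>

lemma ell2I:
  assumes "\<And>x. x \<notin> X \<Longrightarrow> f x = 0"
    and "\<And>F. finite F \<Longrightarrow> F \<subseteq> X \<Longrightarrow> L2_set (\<lambda>x. norm (f x)) F \<le> C"
  shows "f \<in> ell2 X" and "ell2_norm f \<le> C"
proof -
  have C: "0 \<le> C"
    using assms(2)[of "{}"] by simp
  have bnd: "(\<Sum>x\<in>F. (norm (f x))\<^sup>2) \<le> C\<^sup>2" if "finite F" "F \<subseteq> X" for F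
    using assms(2)[OF that] unfolding L2_set_def by (meson sqrt_le_D)
  have summ: "(\<lambda>x. (norm (f x))\<^sup>2) summable_on X"
    by (rule nonneg_bdd_above_summable_on) (auto intro!: bdd_aboveI[of _ "C\<^sup>2"] bnd)
  then show "f \<in> ell2 X"
    using assms(1) by (simp add: ell2_def)
  have "(\<Sum>\<^sub>\<infinity>x. (norm (f x))\<^sup>2) = (\<Sum>\<^sub>\<infinity>x\<in>X. (norm (f x))\<^sup>2)"
    by (rule infsum_cong_neutral) (auto simp: assms(1))
  also have "\<dots> \<le> C\<^sup>2"
    using bnd by (intro infsum_le_finite_sums[OF summ]) auto
  finally have "ell2_norm f \<le> sqrt (C\<^sup>2)"
    unfolding ell2_norm_def by (rule real_sqrt_le_mono)
  then show "ell2_norm f \<le> C"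
    using C by simp
qed

lemma ell2I_sq:
  assumes "\<And>x. x \<notin> X \<Longrightarrow> f x = 0" "0 \<le> C"
    and "\<And>F. finite F \<Longrightarrow> F \<subseteq> X \<Longrightarrow> (\<Sum>x\<in>F. (norm (f x))\<^sup>2) \<le> C\<^sup>2"
  shows "f \<in> ell2 X" and "ell2_norm f \<le> C"
proof -
  have "L2_set (\<lambda>x. norm (f x)) F \<le> C" if "finite F" "F \<subseteq> X" for F
    using assms(2) assms(3)[OF that] unfolding L2_set_def by (metis real_le_lsqrt)
  then show "f \<in> ell2 X" "ell2_norm f \<le> C"
    using ell2I[of X f C] assms(1) by auto
qed

lemma ell2_zero: "(\<lambda>x. 0) \<in> ell2 X"
  by (simp add: ell2_def)

lemma ell2_add:
  assumes "f \<in> ell2 X" "g \<in> ell2 X"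
  shows "(\<lambda>x. f x + g x) \<in> ell2 X" and "ell2_norm (\<lambda>x. f x + g x) \<le> ell2_norm f + ell2_norm g"
proof -
  have "L2_set (\<lambda>x. norm (f x + g x)) F \<le> ell2_norm f + ell2_norm g" if "finite F" for F
  proof -
    have "L2_set (\<lambda>x. norm (f x + g x)) F \<le> L2_set (\<lambda>x. norm (f x) + norm (g x)) F"
      by (intro L2_set_mono norm_triangle_ineq) auto
    also have "\<dots> \<le> L2_set (\<lambda>x. norm (f x)) F + L2_set (\<lambda>x. norm (g x)) F"
      by (rule L2_set_triangle_ineq)
    also have "\<dots> \<le> ell2_norm f + ell2_norm g"
      by (intro add_mono L2_set_le_ell2_norm[OF assms(1) that] L2_set_le_ell2_norm[OF assms(2) that])
    finally show ?thesis .
  qed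
  moreover have "\<And>x. x \<notin> X \<Longrightarrow> f x + g x = 0"
    using assms by (simp add: ell2_outside)
  ultimately show "(\<lambda>x. f x + g x) \<in> ell2 X" "ell2_norm (\<lambda>x. f x + g x) \<le> ell2_norm f + ell2_norm g"
    using ell2I[of X "\<lambda>x. f x + g x"] by blast+
qed

lemma ell2_dominated:
  assumes "f \<in> ell2 Y" "0 \<le> C" "\<And>x. x \<notin> X \<Longrightarrow> g x = 0"
    and "inj_on \<tau> P" "\<And>x. x \<notin> P \<Longrightarrow> g x = 0"
    and "\<And>x. x \<in> P \<Longrightarrow> norm (g x) \<le> C * norm (f (\<tau> x))"
  shows "g \<in> ell2 X" and "ell2_norm g \<le> C * ell2_norm f"
proof -
  have "(\<Sum>x\<in>F. (norm (g x))\<^sup>2) \<le> (C * ell2_norm f)\<^sup>2" if F: "finite F" for F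
  proof -
    have "(\<Sum>x\<in>F. (norm (g x))\<^sup>2) = (\<Sum>x\<in>F \<inter> P. (norm (g x))\<^sup>2)"
      using F assms(5) by (intro sum.mono_neutral_right) auto
    also have "\<dots> \<le> (\<Sum>x\<in>F \<inter> P. C\<^sup>2 * (norm (f (\<tau> x)))\<^sup>2)"
    proof (rule sum_mono)
      fix x assume "x \<in> F \<inter> P"
      then have "(norm (g x))\<^sup>2 \<le> (C * norm (f (\<tau> x)))\<^sup>2"
        using assms(6) by (intro power_mono) auto
      then show "(norm (g x))\<^sup>2 \<le> C\<^sup>2 * (norm (f (\<tau> x)))\<^sup>2"
        by (simp add: power_mult_distrib)
    qed
    also have "\<dots> = C\<^sup>2 * (\<Sum>y\<in>\<tau> ` (F \<inter> P). (norm (f y))\<^sup>2)"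
      using assms(4) by (subst sum.reindex) (auto simp: inj_on_def sum_distrib_left)
    also have "\<dots> \<le> C\<^sup>2 * (ell2_norm f)\<^sup>2"
      using F by (intro mult_left_mono sum_norm_sq_le_ell2_norm[OF assms(1)]) auto
    finally show ?thesis by (simp add: power_mult_distrib)
  qed
  then show "g \<in> ell2 X" "ell2_norm g \<le> C * ell2_norm f"
    using ell2I_sq[of X g "C * ell2_norm f"] assms(2,3) by auto
qed

lemma ell2_smult:
  assumes "f \<in> ell2 X"
  shows "(\<lambda>x. (c::complex) *s (f x :: complex^'r)) \<in> ell2 X"
    and "ell2_norm (\<lambda>x. c *s f x) \<le> norm c * ell2_norm f"
  using ell2_dominated[OF assms, of "norm c" X "\<lambda>x. c *s f x" "\<lambda>x. x" UNIV]
  by (auto simp: ell2_outside[OF assms])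

lemma ell2_matrix_mult:
  assumes "f \<in> ell2 X"
  shows "(\<lambda>x. (m :: complex^'r^'r) *v f x) \<in> ell2 X"
    and "ell2_norm (\<lambda>x. m *v f x) \<le> norm m * ell2_norm f"
  using ell2_dominated[OF assms, of "norm m" X "\<lambda>x. m *v f x" "\<lambda>x. x" UNIV]
  by (auto simp: ell2_outside[OF assms] norm_matrix_vector_mult_le)

lemma ell2_diff:
  assumes "f \<in> ell2 X" "g \<in> ell2 X"
  shows "(\<lambda>x. f x - (g x :: complex^'r)) \<in> ell2 X"
proof -
  have "(\<lambda>x. f x + (-1) *s g x) \<in> ell2 X"
    by (intro ell2_add(1) assms ell2_smult(1))
  then show ?thesis by (simp add: vec.scale_minus_left)
qed

lemma ell2_sum:
  assumes "finite I" "\<And>i. i \<in> I \<Longrightarrow> f i \<in> ell2 X"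
  shows "(\<lambda>x. \<Sum>i\<in>I. f i x) \<in> ell2 X"
    and "ell2_norm (\<lambda>x. \<Sum>i\<in>I. f i x) \<le> (\<Sum>i\<in>I. ell2_norm (f i))"
proof -
  have "(\<lambda>x. \<Sum>i\<in>I. f i x) \<in> ell2 X \<and> ell2_norm (\<lambda>x. \<Sum>i\<in>I. f i x) \<le> (\<Sum>i\<in>I. ell2_norm (f i))"
    using assms
  proof (induction I)
    case empty
    then show ?case by (simp add: ell2_zero) (simp add: ell2_norm_def)
  next
    case (insert i I)
    then show ?case
      using ell2_add[of "f i" X "\<lambda>x. \<Sum>i\<in>I. f i x"] by fastforce
  qed
  then show "(\<lambda>x. \<Sum>i\<in>I. f i x) \<in> ell2 X"
    and "ell2_norm (\<lambda>x. \<Sum>i\<in>I. f i x) \<le> (\<Sum>i\<in>I. ell2_norm (f i))" by auto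
qed

section \<open>Operators with finite rows and their resolvents\<close>

text \<open>Each value of \<open>T f\<close> depends on finitely many values of \<open>f\<close>.  Such an operator commutes with
  pointwise limits, which is what makes Neumann series available without a completeness theorem
  for the spaces of square summable functions.\<close>

definition finite_rows :: "(('x \<Rightarrow> complex^'r) \<Rightarrow> ('x \<Rightarrow> complex^'r)) \<Rightarrow> bool"
  where "finite_rows T \<longleftrightarrow>
    (\<exists>N K. (\<forall>x. finite (N x)) \<and> (\<forall>f x. T f x = (\<Sum>y\<in>N x. K x y *v f y)))"

lemma finite_rowsI:
  assumes "\<And>x. finite (N x)" "\<And>f x. T f x = (\<Sum>y\<in>N x. K x y *v f y)"
  shows "finite_rows T"
  unfolding finite_rows_def using assms by blast

lemma finite_rowsE:
  assumes "finite_rows T"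
  obtains N K where "\<And>x. finite (N x)" "\<And>f x. T f x = (\<Sum>y\<in>N x. K x y *v f y)"
  using assms unfolding finite_rows_def by blast

lemma finite_rows_additive:
  assumes "finite_rows T"
  shows "T (\<lambda>x. f x + g x) = (\<lambda>x. T f x + T g x)"
proof -
  obtain N K where T: "\<And>x. finite (N x)" "\<And>f x. T f x = (\<Sum>y\<in>N x. K x y *v f y)"
    using finite_rowsE[OF assms] by blast
  show ?thesis
    by (rule ext) (simp add: T(2) matrix_vector_right_distrib sum.distrib)
qed

lemma finite_rows_homogeneous:
  assumes "finite_rows T"
  shows "T (\<lambda>x. c *s f x) = (\<lambda>x. c *s T f x)"
proof -
  obtain N K where T: "\<And>x. finite (N x)" "\<And>f x. T f x = (\<Sum>y\<in>N x. K x y *v f y)"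
    using finite_rowsE[OF assms] by blast
  show ?thesis
    by (rule ext) (simp add: T(2) matrix_vector_mult_scalar vector_scalar_mult_sum)
qed

lemma finite_rows_diff:
  assumes "finite_rows T"
  shows "T (\<lambda>x. f x - g x) = (\<lambda>x. T f x - T g x)"
proof -
  have "T (\<lambda>x. f x + (- 1) *s g x) = (\<lambda>x. T f x + (- 1) *s T g x)"
    using finite_rows_additive[OF assms, of f "\<lambda>x. (- 1) *s g x"]
    unfolding finite_rows_homogeneous[OF assms] .
  then show ?thesis by (simp add: vec.scale_minus_left)
qed

lemma finite_rows_sum:
  assumes "finite_rows T" "finite I"
  shows "T (\<lambda>x. \<Sum>i\<in>I. f i x) = (\<lambda>x. \<Sum>i\<in>I. T (f i) x)"
  using assms(2)
proof (induction I)
  case empty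
  show ?case
    using finite_rows_homogeneous[OF assms(1), of 0 "\<lambda>x. 0"] by simp
qed (simp add: finite_rows_additive[OF assms(1)])

lemma finite_rows_sum_pointwise:
  assumes "finite_rows T" "\<And>x. summable (\<lambda>n. u n x)"
  shows "summable (\<lambda>n. T (u n) x)" and "T (\<lambda>x. \<Sum>n. u n x) x = (\<Sum>n. T (u n) x)"
proof -
  obtain N K where T: "\<And>x. finite (N x)" "\<And>f x. T f x = (\<Sum>y\<in>N x. K x y *v f y)"
    using finite_rowsE[OF assms(1)] by blast
  have 1: "summable (\<lambda>n. K x y *v u n y)" for y
    by (rule bounded_linear.summable[OF matrix_vector_mul_bounded_linear assms(2)])
  have 2: "K x y *v (\<Sum>n. u n y) = (\<Sum>n. K x y *v u n y)" for y
    by (rule bounded_linear.suminf[OF matrix_vector_mul_bounded_linear assms(2)])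
  show "summable (\<lambda>n. T (u n) x)"
    unfolding T(2) by (intro summable_sum 1)
  show "T (\<lambda>x. \<Sum>n. u n x) x = (\<Sum>n. T (u n) x)"
    unfolding T(2) 2 by (rule suminf_sum[symmetric]) (rule 1)
qed

definition bounded_rows :: "'x set \<Rightarrow> (('x \<Rightarrow> complex^'r) \<Rightarrow> ('x \<Rightarrow> complex^'r)) \<Rightarrow> bool"
  where "bounded_rows X T \<longleftrightarrow> finite_rows T \<and> bounded_op_on (ell2 X) T"

lemma bounded_rowsD:
  assumes "bounded_rows X T"
  shows "finite_rows T" "f \<in> ell2 X \<Longrightarrow> T f \<in> ell2 X"
  using assms by (auto simp: bounded_rows_def bounded_op_on_def)

lemma bounded_op_on_nonneg_bound:
  assumes "bounded_op_on H T"
  obtains C where "0 \<le> C" "\<And>f. f \<in> H \<Longrightarrow> ell2_norm (T f) \<le> C * ell2_norm f"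
proof -
  obtain C where C: "\<And>f. f \<in> H \<Longrightarrow> ell2_norm (T f) \<le> C * ell2_norm f"
    using assms unfolding bounded_op_on_def by blast
  have "ell2_norm (T f) \<le> max C 0 * ell2_norm f" if "f \<in> H" for f
    using C[OF that] mult_right_mono[of C "max C 0" "ell2_norm f"] by simp
  then show thesis using that[of "max C 0"] by auto
qed

lemma bounded_rowsI:
  assumes "finite_rows T" "\<And>f. f \<in> ell2 X \<Longrightarrow> T f \<in> ell2 X"
    and "\<And>f. f \<in> ell2 X \<Longrightarrow> ell2_norm (T f) \<le> C * ell2_norm f"
  shows "bounded_rows X T"
  unfolding bounded_rows_def bounded_op_on_def
  using assms finite_rows_additive[OF assms(1)] finite_rows_homogeneous[OF assms(1)] by blast

text \<open>Every operator considered below is a finite sum of such weighted translations.\<close>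

definition transport_op :: "'x set \<Rightarrow> complex^'r^'r \<Rightarrow> ('x \<Rightarrow> 'x) \<Rightarrow> ('x \<Rightarrow> complex^'r) \<Rightarrow> ('x \<Rightarrow> complex^'r)"
  where "transport_op P m \<tau> f = (\<lambda>x. if x \<in> P then m *v f (\<tau> x) else 0)"

lemma bounded_rows_transport:
  assumes "inj_on \<tau> P" "\<And>x. x \<in> P \<Longrightarrow> x \<notin> X \<Longrightarrow> \<tau> x \<notin> X"
  shows "bounded_rows X (transport_op P m \<tau>)"
proof (rule bounded_rowsI)
  show "finite_rows (transport_op P m \<tau>)"
    by (rule finite_rowsI[of "\<lambda>x. {\<tau> x}" _ "\<lambda>x y. if x \<in> P then m else 0"])
      (auto simp: transport_op_def)
  fix f :: "'a \<Rightarrow> complex^'b"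
  assume f: "f \<in> ell2 X"
  show "transport_op P m \<tau> f \<in> ell2 X" "ell2_norm (transport_op P m \<tau> f) \<le> norm m * ell2_norm f"
    by (rule ell2_dominated[OF f, of "norm m" X _ \<tau> P];
        use assms in \<open>auto simp: transport_op_def norm_matrix_vector_mult_le ell2_outside[OF f]\<close>)+
qed

lemma bounded_rows_add:
  assumes "bounded_rows X S" "bounded_rows X T"
  shows "bounded_rows X (\<lambda>f x. S f x + T f x)"
proof -
  obtain C where C: "\<And>f. f \<in> ell2 X \<Longrightarrow> ell2_norm (S f) \<le> C * ell2_norm f"
    using assms(1) unfolding bounded_rows_def bounded_op_on_def by blast
  obtain D where D: "\<And>f. f \<in> ell2 X \<Longrightarrow> ell2_norm (T f) \<le> D * ell2_norm f"
    using assms(2) unfolding bounded_rows_def bounded_op_on_def by blast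
  show ?thesis
  proof (rule bounded_rowsI)
    obtain N K where S: "\<And>x. finite (N x)" "\<And>f x. S f x = (\<Sum>y\<in>N x. K x y *v f y)"
      using finite_rowsE[OF bounded_rowsD(1)[OF assms(1)]] by blast
    obtain N' K' where T: "\<And>x. finite (N' x)" "\<And>f x. T f x = (\<Sum>y\<in>N' x. K' x y *v f y)"
      using finite_rowsE[OF bounded_rowsD(1)[OF assms(2)]] by blast
    have "(\<Sum>y\<in>N x. K x y *v f y) =
        (\<Sum>y\<in>N x \<union> N' x. (if y \<in> N x then K x y else 0) *v f y)" for f x
      using S(1) T(1) by (intro sum.mono_neutral_cong_left) auto
    moreover have "(\<Sum>y\<in>N' x. K' x y *v f y) =
        (\<Sum>y\<in>N x \<union> N' x. (if y \<in> N' x then K' x y else 0) *v f y)" for f x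
      using S(1) T(1) by (intro sum.mono_neutral_cong_left) auto
    ultimately show "finite_rows (\<lambda>f x. S f x + T f x)"
      using S(1) T(1)
      by (intro finite_rowsI[of "\<lambda>x. N x \<union> N' x" _ "\<lambda>x y. (if y \<in> N x then K x y else 0) +
            (if y \<in> N' x then K' x y else 0)"])
        (auto simp: S(2) T(2) matrix_vector_mult_add_rdistrib sum.distrib)
    fix f :: "'a \<Rightarrow> complex^'b"
    assume f: "f \<in> ell2 X"
    note ST = bounded_rowsD(2)[OF assms(1) f] bounded_rowsD(2)[OF assms(2) f]
    show "(\<lambda>x. S f x + T f x) \<in> ell2 X"
      by (rule ell2_add(1)[OF ST])
    show "ell2_norm (\<lambda>x. S f x + T f x) \<le> (C + D) * ell2_norm f"
      using ell2_add(2)[OF ST] C[OF f] D[OF f] by (simp add: algebra_simps)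
  qed
qed

lemma bounded_rows_sum:
  fixes T :: "'i \<Rightarrow> ('x \<Rightarrow> complex^'r) \<Rightarrow> ('x \<Rightarrow> complex^'r)"
  assumes "finite I" "\<And>i. i \<in> I \<Longrightarrow> bounded_rows X (T i)"
  shows "bounded_rows X (\<lambda>f x. \<Sum>i\<in>I. T i f x)"
  using assms
proof (induction I)
  case empty
  have "bounded_rows X (transport_op {} (0 :: complex^'r^'r) (\<lambda>x. x))"
    by (rule bounded_rows_transport) auto
  then show ?case by (simp add: transport_op_def[abs_def])
next
  case (insert i I)
  then show ?case
    using bounded_rows_add[of X "T i" "\<lambda>f x. \<Sum>i\<in>I. T i f x"] by simp
qed

lemma resolvent_kernel_trivial:
  assumes "is_resolvent H T z R" "f \<in> H" "\<And>x. z *s f x - T f x = 0"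
  shows "f = (\<lambda>x. 0)"
proof -
  have "R (\<lambda>x. z *s f x - T f x) = f"
    using assms(1,2) by (auto simp: is_resolvent_def)
  then have "R (\<lambda>x. 0 *s f x) = f"
    using assms(3) by simp
  moreover have "R (\<lambda>x. 0 *s f x) = (\<lambda>x. 0 *s R f x)"
    using assms(1,2) unfolding is_resolvent_def bounded_op_on_def by blast
  ultimately show ?thesis by simp
qed

lemma resolventI:
  fixes T :: "('x \<Rightarrow> complex^'r) \<Rightarrow> ('x \<Rightarrow> complex^'r)"
  assumes R: "bounded_op_on (ell2 X) R" and T: "finite_rows T" "\<And>f. f \<in> ell2 X \<Longrightarrow> T f \<in> ell2 X"
    and right: "\<And>f :: 'x \<Rightarrow> complex^'r. f \<in> ell2 X \<Longrightarrow> (\<lambda>x. z *s R f x - T (R f) x) = f"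
    and inj: "\<And>f :: 'x \<Rightarrow> complex^'r. f \<in> ell2 X \<Longrightarrow> (\<And>x. z *s f x - T f x = 0) \<Longrightarrow> f = (\<lambda>x. 0)"
  shows "is_resolvent (ell2 X) T z R"
  unfolding is_resolvent_def
proof (intro conjI ballI R right)
  fix f :: "'x \<Rightarrow> complex^'r"
  assume f: "f \<in> ell2 X"
  define g where "g = (\<lambda>x. z *s f x - T f x)"
  have g: "g \<in> ell2 X"
    unfolding g_def by (intro ell2_diff ell2_smult(1) f T(2))
  then have Rg: "R g \<in> ell2 X"
    using R by (simp add: bounded_op_on_def)
  have *: "z *s R g x - T (R g) x = g x" for x
    by (rule fun_cong[OF right[OF g]])
  have "(\<lambda>x. R g x - f x) = (\<lambda>x. 0)"
  proof (rule inj)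
    show "(\<lambda>x. R g x - f x) \<in> ell2 X"
      by (intro ell2_diff Rg f)
    have "z *s R g x - z *s f x - (T (R g) x - T f x) = 0" for x
      using *[of x] unfolding g_def by (simp add: algebra_simps)
    then show "z *s (R g x - f x) - T (\<lambda>x. R g x - f x) x = 0" for x
      unfolding finite_rows_diff[OF T(1)] by (simp add: vector_scalar_mult_diff)
  qed
  then show "R g = f"
    by (metis eq_iff_diff_eq_0 ext)
qed

lemma summable_telescope:
  fixes v :: "nat \<Rightarrow> 'a::real_normed_vector"
  assumes "summable v"
  shows "(\<Sum>n. v n) - (\<Sum>n. v (Suc n)) = v 0"
  using suminf_split_head[OF assms] by simp

text \<open>The Neumann series converges pointwise, since \<open>norm (f x) \<le> ell2_norm f\<close>; its
  square summability follows from Minkowski's inequality on finite sets.\<close>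

lemma neumann_resolvent:
  fixes T :: "('x \<Rightarrow> complex^'r) \<Rightarrow> ('x \<Rightarrow> complex^'r)"
  assumes T: "bounded_rows X T" and z: "z \<noteq> 0"
    and c: "\<And>n f. f \<in> ell2 X \<Longrightarrow> ell2_norm ((T ^^ n) f) \<le> c n * ell2_norm f"
    and summ: "summable (\<lambda>n. c n / norm z ^ Suc n)"
  obtains R where "is_resolvent (ell2 X) T z R"
proof -
  define t where "t f n x = (1 / z ^ Suc n) *s (T ^^ n) f x" for f n x
  define R where "R f x = (\<Sum>n. t f n x)" for f x
  note fr = bounded_rowsD(1)[OF T]
  have iter: "(T ^^ n) f \<in> ell2 X" if "f \<in> ell2 X" for f n
    using that by (induction n) (auto intro: bounded_rowsD(2)[OF T])
  have tn: "norm (t f n x) \<le> c n / norm z ^ Suc n * ell2_norm f" if f: "f \<in> ell2 X" for f n x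
  proof -
    have "norm (t f n x) = norm ((T ^^ n) f x) / norm z ^ Suc n"
      unfolding t_def by (simp add: norm_divide norm_power norm_mult)
    also have "\<dots> \<le> c n * ell2_norm f / norm z ^ Suc n"
      by (intro divide_right_mono order_trans[OF norm_le_ell2_norm[OF iter[OF f]] c[OF f]]) auto
    finally show ?thesis by simp
  qed
  have st: "summable (\<lambda>n. t f n x)" if "f \<in> ell2 X" for f x
    by (rule summable_comparison_test'[OF summable_mult2[OF summ, of "ell2_norm f"], of 0])
      (use tn[OF that] in auto)
  define C where "C = (\<Sum>n. c n / norm z ^ Suc n)"
  have R_bound: "L2_set (\<lambda>x. norm (R f x)) F \<le> C * ell2_norm f"
    if f: "f \<in> ell2 X" and F: "finite F" for f F
  proof -
    have lim: "(\<lambda>n. L2_set (\<lambda>x. norm (\<Sum>k<n. t f k x)) F) \<longlonglongrightarrow> L2_set (\<lambda>x. norm (R f x)) F"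
      unfolding L2_set_def R_def
      by (intro tendsto_intros summable_LIMSEQ st f)
    have "L2_set (\<lambda>x. norm (\<Sum>k<n. t f k x)) F \<le> (\<Sum>k<n. c k / norm z ^ Suc k) * ell2_norm f" for n
    proof -
      have tk: "L2_set (\<lambda>x. norm (t f k x)) F \<le> c k / norm z ^ Suc k * ell2_norm f" for k
      proof -
        have "norm (t f k x) = 1 / norm z ^ Suc k * norm ((T ^^ k) f x)" for x
          unfolding t_def by (simp add: norm_divide norm_power norm_mult)
        then have "L2_set (\<lambda>x. norm (t f k x)) F = L2_set (\<lambda>x. norm ((T ^^ k) f x)) F / norm z ^ Suc k"
          using L2_set_right_distrib[of "1 / norm z ^ Suc k" "\<lambda>x. norm ((T ^^ k) f x)" F] by simp
        also have "\<dots> \<le> c k * ell2_norm f / norm z ^ Suc k"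
          by (intro divide_right_mono order_trans[OF L2_set_le_ell2_norm[OF iter[OF f] F] c[OF f]]) auto
        finally show ?thesis by simp
      qed
      have "L2_set (\<lambda>x. norm (\<Sum>k<n. t f k x)) F \<le> (\<Sum>k<n. L2_set (\<lambda>x. norm (t f k x)) F)"
      proof (induction n)
        case 0
        then show ?case by (simp add: L2_set_def)
      next
        case (Suc n)
        have "L2_set (\<lambda>x. norm (\<Sum>k<Suc n. t f k x)) F
            \<le> L2_set (\<lambda>x. norm (\<Sum>k<n. t f k x) + norm (t f n x)) F"
          by (intro L2_set_mono) (auto intro: norm_triangle_ineq)
        also have "\<dots> \<le> L2_set (\<lambda>x. norm (\<Sum>k<n. t f k x)) F + L2_set (\<lambda>x. norm (t f n x)) F"
          by (rule L2_set_triangle_ineq)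
        finally show ?case using Suc by simp
      qed
      also have "\<dots> \<le> (\<Sum>k<n. c k / norm z ^ Suc k * ell2_norm f)"
        by (intro sum_mono tk)
      finally show ?thesis by (simp add: sum_distrib_right)
    qed
    moreover have "(\<lambda>n. (\<Sum>k<n. c k / norm z ^ Suc k) * ell2_norm f) \<longlonglongrightarrow> C * ell2_norm f"
      unfolding C_def by (intro tendsto_intros summable_LIMSEQ summ)
    ultimately show ?thesis
      by (intro LIMSEQ_le[OF lim]) auto
  qed
  have iter0: "(T ^^ n) f x = 0" if "f \<in> ell2 X" "x \<notin> X" for f n x
    by (rule ell2_outside[OF iter[OF that(1)] that(2)])
  have Rf: "R f \<in> ell2 X" "ell2_norm (R f) \<le> C * ell2_norm f" if "f \<in> ell2 X" for f
    using that by (auto intro!: ell2I[of X "R f" "C * ell2_norm f"] R_bound simp: R_def t_def iter0)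
  have iter_lin: "(T ^^ n) (\<lambda>x. f x + g x) = (\<lambda>x. (T ^^ n) f x + (T ^^ n) g x)"
      "(T ^^ n) (\<lambda>x. k *s f x) = (\<lambda>x. k *s (T ^^ n) f x)"  for f g k n
    by (induction n) (auto simp: finite_rows_additive[OF fr] finite_rows_homogeneous[OF fr])
  have R_add: "R (\<lambda>x. f x + g x) = (\<lambda>x. R f x + R g x)" if "f \<in> ell2 X" "g \<in> ell2 X" for f g
    unfolding R_def
    using suminf_add[OF st[OF that(1)] st[OF that(2)], symmetric]
    by (auto simp: t_def iter_lin vector_scalar_mult_add)
  have R_smult: "R (\<lambda>x. k *s f x) = (\<lambda>x. k *s R f x)" if "f \<in> ell2 X" for f k
  proof
    fix x
    have "k *s R f x = (\<Sum>n. k *s t f n x)"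
      unfolding R_def by (rule bounded_linear.suminf[OF bounded_linear_vector_scalar_mult st[OF that]])
    then show "R (\<lambda>x. k *s f x) x = k *s R f x"
      by (simp add: R_def t_def iter_lin vector_smult_assoc mult.commute)
  qed
  have T_iter: "(T ^^ n) (T f) = T ((T ^^ n) f)" for n f
    by (simp add: funpow_swap1)
  have bdd: "bounded_op_on (ell2 X) R"
    unfolding bounded_op_on_def using Rf R_add R_smult by blast
  have step: "T (t f n) x = z *s t f (Suc n) x" for f n x
    unfolding t_def finite_rows_homogeneous[OF fr] using z by (simp add: vector_smult_assoc)
  have scale: "z *s R f x = (\<Sum>n. z *s t f n x)" if "f \<in> ell2 X" for f x
    unfolding R_def by (rule bounded_linear.suminf[OF bounded_linear_vector_scalar_mult st[OF that]])
  have scale_summ: "summable (\<lambda>n. z *s t f n x)" if "f \<in> ell2 X" for f x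
    by (rule bounded_linear.summable[OF bounded_linear_vector_scalar_mult st[OF that]])
  have right: "z *s R f x - T (R f) x = f x" if f: "f \<in> ell2 X" for f x
  proof -
    have "T (R f) x = (\<Sum>n. T (t f n) x)"
      unfolding R_def by (rule finite_rows_sum_pointwise(2)[OF fr st[OF f]])
    then have "T (R f) x = (\<Sum>n. z *s t f (Suc n) x)"
      by (simp add: step)
    then have "z *s R f x - T (R f) x = z *s t f 0 x"
      unfolding scale[OF f] using summable_telescope[OF scale_summ[OF f]] by simp
    then show ?thesis using z by (simp add: t_def vector_smult_assoc)
  qed
  have commute: "T (R f) = R (T f)" if f: "f \<in> ell2 X" for f
  proof
    fix x
    have "T (R f) x = (\<Sum>n. T (t f n) x)"
      unfolding R_def by (rule finite_rows_sum_pointwise(2)[OF fr st[OF f]])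
    moreover have "T (t f n) x = t (T f) n x" for n
      unfolding t_def finite_rows_homogeneous[OF fr] T_iter ..
    ultimately show "T (R f) x = R (T f) x"
      by (simp add: R_def)
  qed
  have "is_resolvent (ell2 X) T z R"
  proof (rule resolventI[OF bdd fr bounded_rowsD(2)[OF T]])
    fix f :: "'x \<Rightarrow> complex^'r"
    assume f: "f \<in> ell2 X"
    show "(\<lambda>x. z *s R f x - T (R f) x) = f"
      using right[OF f] by blast
    assume "\<And>x. z *s f x - T f x = 0"
    then have Tf: "T f = (\<lambda>x. z *s f x)" by (auto simp: fun_eq_iff)
    show "f = (\<lambda>x. 0)"
      using right[OF f] unfolding commute[OF f] Tf R_smult[OF f] by auto
  qed
  then show thesis by (rule that)
qed

lemma bounded_rows_spectrum_bounded:
  assumes T: "bounded_rows X T"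
  obtains C where "spectrum_on (ell2 X) T \<subseteq> cball 0 C"
proof -
  obtain C where C: "0 \<le> C" "\<And>f. f \<in> ell2 X \<Longrightarrow> ell2_norm (T f) \<le> C * ell2_norm f"
    using bounded_op_on_nonneg_bound T unfolding bounded_rows_def by blast
  have iter: "(T ^^ n) f \<in> ell2 X \<and> ell2_norm ((T ^^ n) f) \<le> C ^ n * ell2_norm f"
    if "f \<in> ell2 X" for f n
  proof (induction n)
    case (Suc n)
    then have "ell2_norm ((T ^^ Suc n) f) \<le> C * ell2_norm ((T ^^ n) f)"
      using C(2) by simp
    also have "\<dots> \<le> C * (C ^ n * ell2_norm f)"
      using Suc C(1) by (intro mult_left_mono) auto
    finally show ?case using Suc bounded_rowsD(2)[OF T] by simp
  qed (use that in simp)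
  have "z \<in> cball 0 C" if z: "z \<in> spectrum_on (ell2 X) T" for z
  proof (rule ccontr)
    assume "z \<notin> cball 0 C"
    then have lt: "C < norm z" by simp
    then have "summable (\<lambda>n. (C / norm z) ^ n * (1 / norm z))"
      using C(1) by (intro summable_mult2 summable_geometric) (auto simp: divide_less_eq)
    then have "summable (\<lambda>n. C ^ n / norm z ^ Suc n)"
      by (simp add: power_divide mult.commute)
    moreover have "z \<noteq> 0" using lt C(1) by auto
    ultimately obtain R where "is_resolvent (ell2 X) T z R"
      using neumann_resolvent[OF T, of z "\<lambda>n. C ^ n"] iter by blast
    then show False using z by (auto simp: spectrum_on_def)
  qed
  then show thesis using that by blast
qed

section \<open>Invariant subspaces of finite codimension\<close>

lemma homogeneous_system_solution:
  fixes c :: "'i \<Rightarrow> 'j \<Rightarrow> complex"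
  assumes "finite J" "finite S" "card J < card S"
  obtains \<alpha> where "\<exists>n\<in>S. \<alpha> n \<noteq> 0" "\<And>v. v \<in> J \<Longrightarrow> (\<Sum>n\<in>S. \<alpha> n * c n v) = 0"
proof -
  have "\<exists>\<alpha>. (\<exists>n\<in>S. \<alpha> n \<noteq> 0) \<and> (\<forall>v\<in>J. (\<Sum>n\<in>S. \<alpha> n * c n v) = 0)"
    using assms
  proof (induction J arbitrary: S c)
    case empty
    then show ?case by (intro exI[of _ "\<lambda>n. 1"]) (auto simp: card_gt_0_iff)
  next
    case (insert v J)
    show ?case
    proof (cases "\<forall>n\<in>S. c n v = 0")
      case True
      obtain \<alpha> where "\<exists>n\<in>S. \<alpha> n \<noteq> 0" "\<forall>w\<in>J. (\<Sum>n\<in>S. \<alpha> n * c n w) = 0"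
        using insert.IH[of S c] insert.prems insert.hyps by auto
      then show ?thesis using True by (intro exI[of _ \<alpha>]) auto
    next
      case False
      then obtain m where m: "m \<in> S" "c m v \<noteq> 0" by blast
      define S' where "S' = S - {m}"
      have S': "finite S'" "m \<notin> S'" "S = insert m S'" "card J < card S'"
        using insert.prems insert.hyps m by (auto simp: S'_def)
      obtain \<alpha> where \<alpha>: "\<exists>n\<in>S'. \<alpha> n \<noteq> 0"
        "\<forall>w\<in>J. (\<Sum>n\<in>S'. \<alpha> n * (c n w - c n v / c m v * c m w)) = 0"
        using insert.IH[OF S'(1,4), of "\<lambda>n w. c n w - c n v / c m v * c m w"] by blast
      define \<beta> where "\<beta> = \<alpha>(m := - (\<Sum>n\<in>S'. \<alpha> n * c n v) / c m v)"
      have split: "(\<Sum>n\<in>S. \<beta> n * c n w) =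
          - (\<Sum>n\<in>S'. \<alpha> n * c n v) / c m v * c m w + (\<Sum>n\<in>S'. \<alpha> n * c n w)" for w
      proof -
        have "(\<Sum>n\<in>S'. \<beta> n * c n w) = (\<Sum>n\<in>S'. \<alpha> n * c n w)"
          using S'(2) by (intro sum.cong) (auto simp: \<beta>_def)
        then show ?thesis using S'(1-3) by (simp add: \<beta>_def)
      qed
      have "(\<Sum>n\<in>S. \<beta> n * c n w) = 0" if "w \<in> J" for w
      proof -
        have "0 = (\<Sum>n\<in>S'. \<alpha> n * c n w) - (\<Sum>n\<in>S'. \<alpha> n * c n v) / c m v * c m w"
          using \<alpha>(2) that by (simp add: right_diff_distrib sum_subtractf sum_distrib_right
              sum_divide_distrib mult.assoc)
        then show ?thesis unfolding split by simp
      qed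
      moreover have "(\<Sum>n\<in>S. \<beta> n * c n v) = 0"
        unfolding split using m(2) by simp
      moreover have "\<exists>n\<in>S. \<beta> n \<noteq> 0"
        using \<alpha>(1) S'(2,3) by (auto simp: \<beta>_def)
      ultimately show ?thesis by blast
    qed
  qed
  then show thesis using that by blast
qed

definition fun_subspace :: "('x \<Rightarrow> complex^'r) set \<Rightarrow> bool"
  where "fun_subspace H \<longleftrightarrow> (\<lambda>x. 0) \<in> H \<and>
    (\<forall>f\<in>H. \<forall>g\<in>H. (\<lambda>x. f x + g x) \<in> H) \<and> (\<forall>f\<in>H. \<forall>c. (\<lambda>x. c *s f x) \<in> H)"

text \<open>The complement is spanned by an indexed family rather than a set of functions, so that tensoring
  with a basis causes no trouble when some of the resulting functions coincide.\<close>

definition fun_finite_codim :: "('x \<Rightarrow> complex^'r) set \<Rightarrow> ('x \<Rightarrow> complex^'r) set \<Rightarrow> bool"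
  where "fun_finite_codim E H \<longleftrightarrow> (\<exists>N e.
    \<forall>f\<in>E. \<exists>u\<in>H. \<exists>c. f = (\<lambda>x. u x + (\<Sum>n<(N::nat). c n *s e n x)))"

lemma fun_finite_codimI:
  assumes "finite I" "\<And>f. f \<in> E \<Longrightarrow> \<exists>u\<in>H. \<exists>c. f = (\<lambda>x. u x + (\<Sum>i\<in>I. c i *s e i x))"
  shows "fun_finite_codim E H"
proof -
  obtain h where h: "bij_betw h {0..<card I} I"
    using ex_bij_betw_nat_finite[OF assms(1)] by blast
  show ?thesis
    unfolding fun_finite_codim_def
  proof (intro exI ballI)
    fix f assume "f \<in> E"
    then obtain u c where uc: "u \<in> H" "f = (\<lambda>x. u x + (\<Sum>i\<in>I. c i *s e i x))"
      using assms(2) by blast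
    then show "\<exists>u\<in>H. \<exists>c. f = (\<lambda>x. u x + (\<Sum>n<card I. c n *s e (h n) x))"
      using sum.reindex_bij_betw[OF h, of "\<lambda>i. c i *s e i _"]
      by (intro bexI[of _ u] exI[of _ "\<lambda>n. c (h n)"]) (auto simp: atLeast0LessThan)
  qed
qed

lemma fun_subspace_closed:
  assumes "fun_subspace H"
  shows "(\<lambda>x. 0) \<in> H" "f \<in> H \<Longrightarrow> g \<in> H \<Longrightarrow> (\<lambda>x. f x + g x) \<in> H"
    "f \<in> H \<Longrightarrow> (\<lambda>x. c *s f x) \<in> H" "f \<in> H \<Longrightarrow> g \<in> H \<Longrightarrow> (\<lambda>x. f x - g x) \<in> H"
    "(\<And>i. i \<in> I \<Longrightarrow> h i \<in> H) \<Longrightarrow> (\<lambda>x. \<Sum>i\<in>I. h i x) \<in> H"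
proof -
  show 0: "(\<lambda>x. 0) \<in> H" and add: "\<And>f g. f \<in> H \<Longrightarrow> g \<in> H \<Longrightarrow> (\<lambda>x. f x + g x) \<in> H"
    and scale: "\<And>f c. f \<in> H \<Longrightarrow> (\<lambda>x. c *s f x) \<in> H"
    using assms by (auto simp: fun_subspace_def)
  show "(\<lambda>x. f x - g x) \<in> H" if "f \<in> H" "g \<in> H"
    using add[OF that(1) scale[OF that(2), of "- 1"]] by (simp add: vec.scale_minus_left)
  show "(\<lambda>x. \<Sum>i\<in>I. h i x) \<in> H" if "\<And>i. i \<in> I \<Longrightarrow> h i \<in> H"
    using that by (induction I rule: infinite_finite_induct) (auto intro: 0 add)
qed

text \<open>
  The space \<open>H\<close> need not be closed, so a Neumann series cannot be summed inside it.  Instead,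
  \<open>z - T\<close> maps \<open>H\<close> into itself and is bijective on the ambient space, hence acts surjectively, so
  bijectively, on the finite-dimensional quotient.  Concretely, if \<open>w = R h\<close> were outside \<open>H\<close>,
  the vectors \<open>R\<^sup>n w\<close> would be linearly independent modulo \<open>H\<close>.
\<close>

lemma resolvent_finite_codim:
  fixes T :: "('x \<Rightarrow> complex^'r) \<Rightarrow> ('x \<Rightarrow> complex^'r)"
  assumes R: "is_resolvent E T z R" and T: "finite_rows T"
    and H: "fun_subspace H" "H \<subseteq> E" "\<And>f. f \<in> H \<Longrightarrow> T f \<in> H" "fun_finite_codim E H"
  shows "is_resolvent H T z R"
proof -
  define S where "S f = (\<lambda>x. z *s f x - T f x)" for f
  note HS = fun_subspace_closed[OF H(1)]
  have SH: "S f \<in> H" if "f \<in> H" for f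
    unfolding S_def by (intro HS that H(3))
  have S_lin: "S (\<lambda>x. f x + g x) = (\<lambda>x. S f x + S g x)" "S (\<lambda>x. c *s f x) = (\<lambda>x. c *s S f x)" for f g c
    unfolding S_def finite_rows_additive[OF T] finite_rows_homogeneous[OF T]
    by (auto simp: vec_eq_iff algebra_simps)
  have S0: "S (\<lambda>x. 0) = (\<lambda>x. 0)"
    using S_lin(2)[of 0 "\<lambda>x. 0"] by simp
  have RE: "R f \<in> E" and SR: "S (R f) = f" if "f \<in> E" for f
    using R that unfolding is_resolvent_def bounded_op_on_def S_def by auto
  have RH: "R h \<in> H" if h: "h \<in> H" for h
  proof (rule ccontr)
    define w where "w = R h"
    assume "R h \<notin> H"
    then have w: "w \<notin> H" by (simp add: w_def)
    have wE: "(R ^^ n) w \<in> E" for n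
      using h H(2) by (induction n) (auto simp: w_def intro: RE)
    have Sw: "S w \<in> H"
      using SR[of h] h H(2) by (auto simp: w_def)
    obtain N e where Ne: "\<And>f. f \<in> E \<Longrightarrow> \<exists>u\<in>H. \<exists>c. f = (\<lambda>x. u x + (\<Sum>n<(N::nat). c n *s e n x))"
      using H(4) unfolding fun_finite_codim_def by blast
    then have "\<forall>n. \<exists>u c. u \<in> H \<and> (R ^^ n) w = (\<lambda>x. u x + (\<Sum>k<N. c k *s e k x))"
      using wE by blast
    then obtain u c where uc: "\<And>n. u n \<in> H" "\<And>n. (R ^^ n) w = (\<lambda>x. u n x + (\<Sum>k<N. c n k *s e k x))"
      by metis
    obtain \<alpha> where \<alpha>: "\<exists>n\<in>{..N}. \<alpha> n \<noteq> 0" "\<And>k. k < N \<Longrightarrow> (\<Sum>n\<le>N. \<alpha> n * c n k) = 0"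
      using homogeneous_system_solution[of "{..<N}" "{..N}" c] by auto
    define m where "m = Max {n. n \<le> N \<and> \<alpha> n \<noteq> 0}"
    have m: "m \<le> N" "\<alpha> m \<noteq> 0" "\<And>n. m < n \<Longrightarrow> n \<le> N \<Longrightarrow> \<alpha> n = 0"
    proof -
      have "m \<in> {n. n \<le> N \<and> \<alpha> n \<noteq> 0}"
        unfolding m_def using \<alpha>(1) by (intro Max_in) auto
      then show "m \<le> N" "\<alpha> m \<noteq> 0" by auto
      show "\<alpha> n = 0" if "m < n" "n \<le> N" for n
      proof (rule ccontr)
        assume "\<alpha> n \<noteq> 0"
        then have "n \<le> m" unfolding m_def using that(2) by (intro Max_ge) auto
        then show False using that(1) by simp
      qed
    qed
    define g where "g = (\<lambda>x. \<Sum>n\<le>m. \<alpha> n *s (R ^^ n) w x)"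
    have "g x = (\<Sum>n\<le>N. \<alpha> n *s u n x)" for x
    proof -
      have "g x = (\<Sum>n\<le>N. \<alpha> n *s (R ^^ n) w x)"
        unfolding g_def using m by (intro sum.mono_neutral_left) auto
      also have "\<dots> = (\<Sum>n\<le>N. \<alpha> n *s u n x) + (\<Sum>n\<le>N. \<Sum>k<N. (\<alpha> n * c n k) *s e k x)"
        by (simp add: uc(2) vector_scalar_mult_add vector_scalar_mult_sum sum.distrib vector_smult_assoc)
      also have "(\<Sum>n\<le>N. \<Sum>k<N. (\<alpha> n * c n k) *s e k x) = (\<Sum>k<N. (\<Sum>n\<le>N. \<alpha> n * c n k) *s e k x)"
        by (subst sum.swap) (simp add: vec.scale_sum_left)
      also have "\<dots> = 0"
        using \<alpha>(2) by simp
      finally show ?thesis by simp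
    qed
    then have "g = (\<lambda>x. \<Sum>n\<le>N. \<alpha> n *s u n x)" by blast
    then have gH: "g \<in> H"
      using HS(5)[of "{..N}" "\<lambda>n x. \<alpha> n *s u n x", OF HS(3)[OF uc(1)]] by simp
    have Sm_H: "(S ^^ k) f \<in> H" if "f \<in> H" for k f
      using that by (induction k) (auto intro: SH)
    have Sm_lin: "(S ^^ k) (\<lambda>x. f x + g x) = (\<lambda>x. (S ^^ k) f x + (S ^^ k) g x)"
      "(S ^^ k) (\<lambda>x. c *s f x) = (\<lambda>x. c *s (S ^^ k) f x)" for k f g c
      by (induction k) (auto simp: S_lin)
    have Sm_sum: "(S ^^ k) (\<lambda>x. \<Sum>n\<in>J. f n x) = (\<lambda>x. \<Sum>n\<in>J. (S ^^ k) (f n) x)"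
      if "finite J" for k J and f :: "nat \<Rightarrow> 'x \<Rightarrow> complex^'r"
      using that
    proof (induction J)
      case empty
      then show ?case by (induction k) (auto simp: S0)
    qed (simp add: Sm_lin)
    have SmR: "(S ^^ n) ((R ^^ n) w) = w" for n
    proof (induction n)
      case (Suc n)
      have "(S ^^ Suc n) ((R ^^ Suc n) w) = (S ^^ n) (S (R ((R ^^ n) w)))"
        by (simp only: funpow_Suc_right[of n S] funpow.simps(2)[of n R] o_apply)
      then show ?case using SR[OF wE[of n]] Suc by simp
    qed simp
    have low: "(S ^^ m) ((R ^^ n) w) \<in> H" if "n < m" for n
    proof -
      obtain k where k: "m = k + Suc n"
        using \<open>n < m\<close> by (metis add.commute add_Suc_right less_imp_Suc_add)
      have "(S ^^ m) ((R ^^ n) w) = (S ^^ Suc k) ((S ^^ n) ((R ^^ n) w))"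
        unfolding k by (simp only: funpow_add o_apply add_Suc_right add_Suc[symmetric])
      also have "\<dots> = (S ^^ k) (S w)"
        by (simp add: SmR funpow_swap1)
      finally show ?thesis using Sm_H[OF Sw] by simp
    qed
    have "(S ^^ m) g = (\<lambda>x. (\<Sum>n<m. \<alpha> n *s (S ^^ m) ((R ^^ n) w) x) + \<alpha> m *s w x)"
      unfolding g_def by (simp add: Sm_sum Sm_lin SmR lessThan_Suc_atMost[symmetric])
    then have "(\<lambda>x. (S ^^ m) g x - (\<Sum>n<m. \<alpha> n *s (S ^^ m) ((R ^^ n) w) x)) = (\<lambda>x. \<alpha> m *s w x)"
      by simp
    moreover have "(\<lambda>x. (S ^^ m) g x - (\<Sum>n<m. \<alpha> n *s (S ^^ m) ((R ^^ n) w) x)) \<in> H"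
      by (intro HS Sm_H gH low) auto
    ultimately have "(\<lambda>x. \<alpha> m *s w x) \<in> H" by simp
    then have "(\<lambda>x. (1 / \<alpha> m) *s (\<alpha> m *s w x)) \<in> H"
      by (rule HS(3))
    then show False using m(2) w by (simp add: vector_smult_assoc)
  qed
  have "bounded_op_on H R"
    using R RH H(2) unfolding is_resolvent_def bounded_op_on_def by (meson subsetD)
  then show ?thesis
    using R H(2) unfolding is_resolvent_def by (meson subsetD)
qed

lemma spectrum_finite_codim_bounded:
  fixes T :: "('x \<Rightarrow> complex^'r) \<Rightarrow> ('x \<Rightarrow> complex^'r)"
  assumes "bounded_rows X T" "fun_subspace H" "H \<subseteq> ell2 X" "\<And>f. f \<in> H \<Longrightarrow> T f \<in> H"
    "fun_finite_codim (ell2 X) H"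
  obtains C where "spectrum_on H T \<subseteq> cball 0 C"
proof -
  obtain C where C: "spectrum_on (ell2 X) T \<subseteq> cball 0 C"
    using bounded_rows_spectrum_bounded[OF assms(1)] by blast
  have "spectrum_on H T \<subseteq> spectrum_on (ell2 X) T"
    using resolvent_finite_codim[OF _ bounded_rowsD(1)[OF assms(1)] assms(2-5)]
    by (auto simp: spectrum_on_def)
  then show thesis using C that by blast
qed

section \<open>Tensor products with finite-dimensional spaces\<close>

lemma norm_axis_eq [simp]: "norm (axis k c :: 'a::real_normed_vector^'n) = norm c"
proof -
  have "(\<Sum>i\<in>UNIV. (norm (if i = k then c else 0))\<^sup>2) = (norm c)\<^sup>2"
    by (subst sum.remove[of _ k]) auto
  then show ?thesis
    unfolding norm_vec_def L2_set_def axis_def by simp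
qed

lemma vec_sum_axis: "v = (\<Sum>k\<in>UNIV. axis k (v $ k :: complex))"
  by (simp add: vec_eq_iff axis_def)

lemma ell2_vec_iff:
  fixes f :: "'x \<Rightarrow> complex^'r"
  shows "f \<in> ell2 X \<longleftrightarrow> (\<forall>k. (\<lambda>x. f x $ k) \<in> ell2 X)"
proof
  assume f: "f \<in> ell2 X"
  show "\<forall>k. (\<lambda>x. f x $ k) \<in> ell2 X"
    by (intro allI ell2_dominated(1)[OF f, of 1 _ _ "\<lambda>x. x" UNIV])
      (auto simp: ell2_outside[OF f] Finite_Cartesian_Product.norm_nth_le)
next
  assume *: "\<forall>k. (\<lambda>x. f x $ k) \<in> ell2 X"
  have "(\<lambda>x. axis k (f x $ k) :: complex^'r) \<in> ell2 X" for k
    by (rule ell2_dominated(1)[OF *[THEN spec, of k], of 1 _ _ "\<lambda>x. x" UNIV])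
      (auto simp: ell2_outside[OF *[THEN spec]])
  then have "(\<lambda>x. \<Sum>k\<in>UNIV. axis k (f x $ k)) \<in> ell2 X"
    by (intro ell2_sum) auto
  then show "f \<in> ell2 X"
    by (simp flip: vec_sum_axis)
qed

lemma ell2_slice:
  fixes h :: "'x \<times> 'i \<Rightarrow> complex^'r"
  assumes "h \<in> ell2 (X \<times> I)"
  shows "(\<lambda>x. h (x, i)) \<in> ell2 X" and "ell2_norm (\<lambda>x. h (x, i)) \<le> ell2_norm h"
  using ell2_dominated[OF assms, of 1 X "\<lambda>x. h (x, i)" "\<lambda>x. (x, i)" UNIV]
  by (auto simp: ell2_outside[OF assms] inj_on_def)

lemma ell2_unslice:
  fixes g :: "'i \<Rightarrow> 'x \<Rightarrow> complex^'r"
  assumes "finite I" "\<And>i. i \<in> I \<Longrightarrow> g i \<in> ell2 X"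
  shows "(\<lambda>(x, i). if i \<in> I then g i x else 0) \<in> ell2 (X \<times> I)"
    and "ell2_norm (\<lambda>(x, i). if i \<in> I then g i x else 0) \<le> (\<Sum>i\<in>I. ell2_norm (g i))"
proof -
  define h where "h i = (\<lambda>(x, j). if j = i then g i x else 0)" for i
  have h: "h i \<in> ell2 (X \<times> I)" "ell2_norm (h i) \<le> ell2_norm (g i)" if "i \<in> I" for i
  proof -
    have "h i p = 0" if "p \<notin> X \<times> I" for p
      using that \<open>i \<in> I\<close> ell2_outside[OF assms(2)[OF \<open>i \<in> I\<close>]]
      by (cases p) (auto simp: h_def)
    then show "h i \<in> ell2 (X \<times> I)" "ell2_norm (h i) \<le> ell2_norm (g i)"
      using ell2_dominated[OF assms(2)[OF that], of 1 "X \<times> I" "h i" fst "UNIV \<times> {i}"]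
      by (auto simp: h_def inj_on_def)
  qed
  have eq: "(\<lambda>(x, i). if i \<in> I then g i x else 0) = (\<lambda>p. \<Sum>i\<in>I. h i p)"
    using assms(1) by (auto simp: h_def fun_eq_iff)
  show "(\<lambda>(x, i). if i \<in> I then g i x else 0) \<in> ell2 (X \<times> I)"
    unfolding eq by (intro ell2_sum assms(1) h)
  show "ell2_norm (\<lambda>(x, i). if i \<in> I then g i x else 0) \<le> (\<Sum>i\<in>I. ell2_norm (g i))"
    unfolding eq using ell2_sum(2)[OF assms(1) h(1)] sum_mono[of I, OF h(2)] by fastforce
qed

lemma tensor_H_ell2: "tensor_H (ell2 X) = ell2 X"
  unfolding tensor_H_def by (auto simp: ell2_vec_iff)

lemma tensor_K_alt:
  "h \<in> tensor_K d U \<longleftrightarrow>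
    (\<forall>i\<in>{1..d}. (\<lambda>x. h (x, i)) \<in> tensor_H U) \<and> (\<forall>x i. i \<notin> {1..d} \<longrightarrow> h (x, i) = 0)"
  unfolding tensor_K_def tensor_H_def by auto

lemma tensor_K_subset:
  fixes U :: "('x \<Rightarrow> complex) set"
  assumes "U \<subseteq> ell2 X"
  shows "tensor_H U \<subseteq> ell2 X" "(tensor_K d U :: ('x \<times> nat \<Rightarrow> complex^'r) set) \<subseteq> ell2 (X \<times> {1..d})"
proof -
  show H: "(tensor_H U :: ('x \<Rightarrow> complex^'k) set) \<subseteq> ell2 X"
    using assms unfolding tensor_H_def ell2_vec_iff[abs_def] by (blast intro: ell2_vec_iff[THEN iffD2])
  show "(tensor_K d U :: ('x \<times> nat \<Rightarrow> complex^'r) set) \<subseteq> ell2 (X \<times> {1..d})"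
  proof
    fix h :: "'x \<times> nat \<Rightarrow> complex^'r"
    assume h: "h \<in> tensor_K d U"
    have "(\<lambda>(x, i). if i \<in> {1..d} then h (x, i) else 0) \<in> ell2 (X \<times> {1..d})"
      using h assms by (intro ell2_unslice) (auto simp: tensor_K_alt tensor_H_def ell2_vec_iff)
    moreover have "(\<lambda>(x, i). if i \<in> {1..d} then h (x, i) else 0) = h"
      using h by (auto simp: tensor_K_alt fun_eq_iff)
    ultimately show "h \<in> ell2 (X \<times> {1..d})" by simp
  qed
qed

lemma tensor_K_ell2: "tensor_K d (ell2 X) = (ell2 (X \<times> {1..d}) :: ('x \<times> nat \<Rightarrow> complex^'r) set)"
proof
  show "tensor_K d (ell2 X) \<subseteq> (ell2 (X \<times> {1..d}) :: ('x \<times> nat \<Rightarrow> complex^'r) set)"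
    by (rule tensor_K_subset) simp
  show "(ell2 (X \<times> {1..d}) :: ('x \<times> nat \<Rightarrow> complex^'r) set) \<subseteq> tensor_K d (ell2 X)"
    by (auto simp: tensor_K_alt tensor_H_ell2 ell2_slice(1) ell2_outside)
qed

lemma finite_codim_subspace_ell2: "finite_codim_subspace X (ell2 X)"
proof -
  have "(\<lambda>x. c * f x) \<in> ell2 X" if "f \<in> ell2 X" for c :: complex and f
    using ell2_dominated(1)[OF that, of "norm c" X "\<lambda>x. c * f x" "\<lambda>x. x" UNIV]
    by (auto simp: ell2_outside[OF that] norm_mult)
  then show ?thesis
    unfolding finite_codim_subspace_def
    by (auto intro!: ell2_zero ell2_add exI[of _ "{}"])
qed

lemma tensor_finite_codim:
  fixes U :: "('x \<Rightarrow> complex) set"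
  assumes U: "finite_codim_subspace X U"
  shows "fun_subspace (tensor_H U :: ('x \<Rightarrow> complex^'r) set)"
    and "fun_subspace (tensor_K d U :: ('x \<times> nat \<Rightarrow> complex^'r) set)"
    and "fun_finite_codim (ell2 X) (tensor_H U :: ('x \<Rightarrow> complex^'r) set)"
    and "fun_finite_codim (ell2 (X \<times> {1..d})) (tensor_K d U :: ('x \<times> nat \<Rightarrow> complex^'r) set)"
proof -
  show H: "fun_subspace (tensor_H U :: ('x \<Rightarrow> complex^'r) set)"
    and "fun_subspace (tensor_K d U :: ('x \<times> nat \<Rightarrow> complex^'r) set)"
    using U unfolding finite_codim_subspace_def fun_subspace_def tensor_H_def tensor_K_def by auto
  obtain F where F: "finite F" "\<And>f. f \<in> ell2 X \<Longrightarrow> \<exists>u\<in>U. \<exists>c. f = (\<lambda>x. u x + (\<Sum>v\<in>F. c v * v x))"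
    using U unfolding finite_codim_subspace_def by blast
  have split: "\<exists>u\<in>tensor_H U. \<exists>c. \<forall>x. f x = u x + (\<Sum>k\<in>UNIV. \<Sum>v\<in>F. c k v *s axis k (v x))"
    if "f \<in> ell2 X" for f :: "'x \<Rightarrow> complex^'r"
  proof -
    have "\<forall>k. \<exists>u c. u \<in> U \<and> (\<lambda>x. f x $ k) = (\<lambda>x. u x + (\<Sum>v\<in>F. c v * v x))"
      using that F(2) unfolding ell2_vec_iff by blast
    then obtain u c where uc: "\<And>k. u k \<in> U"
      "\<And>k. (\<lambda>x. f x $ k) = (\<lambda>x. u k x + (\<Sum>v\<in>F. c k v * v x))"
      by metis
    have "f x = (\<chi> k. u k x) + (\<Sum>k\<in>UNIV. \<Sum>v\<in>F. c k v *s axis k (v x))" for x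
    proof -
      have "(\<Sum>k\<in>UNIV. \<Sum>v\<in>F. c k v *s (axis k (v x) :: complex^'r)) $ l = (\<Sum>v\<in>F. c l v * v x)" for l
        by (subst sum_component, subst sum.remove[of _ l]) (auto simp: axis_def)
      then show ?thesis
        using fun_cong[OF uc(2)] by (simp add: vec_eq_iff)
    qed
    moreover have "(\<lambda>x. \<chi> k. u k x) \<in> tensor_H U"
      using uc(1) by (simp add: tensor_H_def)
    ultimately show ?thesis
      by (intro bexI[of _ "\<lambda>x. \<chi> k. u k x"] exI[of _ c]) auto
  qed
  show "fun_finite_codim (ell2 X) (tensor_H U :: ('x \<Rightarrow> complex^'r) set)"
  proof (rule fun_finite_codimI[of "UNIV \<times> F" _ _ "\<lambda>(k, v) x. axis k (v x)"])
    fix f :: "'x \<Rightarrow> complex^'r"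
    assume "f \<in> ell2 X"
    then obtain u c where "u \<in> tensor_H U"
      "\<forall>x. f x = u x + (\<Sum>k\<in>UNIV. \<Sum>v\<in>F. c k v *s axis k (v x))"
      using split by blast
    then show "\<exists>u\<in>tensor_H U. \<exists>c. f = (\<lambda>x. u x +
        (\<Sum>i\<in>UNIV \<times> F. c i *s (case i of (k, v) \<Rightarrow> \<lambda>x. axis k (v x)) x))"
      by (intro bexI[of _ u] exI[of _ "\<lambda>(k, v). c k v"] ext)
        (simp_all add: sum.cartesian_product split_beta)
  qed (use F(1) in auto)
  show "fun_finite_codim (ell2 (X \<times> {1..d})) (tensor_K d U :: ('x \<times> nat \<Rightarrow> complex^'r) set)"
  proof (rule fun_finite_codimI[of "{1..d} \<times> UNIV \<times> F" _ _
        "\<lambda>(i, k, v) (x, j). if j = i then axis k (v x) else 0"])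
    fix h :: "'x \<times> nat \<Rightarrow> complex^'r"
    assume h: "h \<in> ell2 (X \<times> {1..d})"
    have "\<forall>i. \<exists>u c. u \<in> tensor_H U \<and>
        (\<forall>x. h (x, i) = u x + (\<Sum>k\<in>UNIV. \<Sum>v\<in>F. c k v *s axis k (v x)))"
      using split[OF ell2_slice(1)[OF h]] by blast
    then obtain u c where "\<forall>i. u i \<in> tensor_H U \<and>
        (\<forall>x. h (x, i) = u i x + (\<Sum>k\<in>UNIV. \<Sum>v\<in>F. c i k v *s axis k (v x)))"
      unfolding choice_iff by blast
    then have uc: "\<And>i. u i \<in> tensor_H U"
      "\<And>i x. h (x, i) = u i x + (\<Sum>k\<in>UNIV. \<Sum>v\<in>F. c i k v *s axis k (v x))"
      by blast+
    have "h (x, j) = (if j \<in> {1..d} then u j x else 0) +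
        (\<Sum>i\<in>{1..d}. \<Sum>k\<in>UNIV. \<Sum>v\<in>F. c i k v *s (if j = i then axis k (v x) else 0))" for x j
    proof -
      have "(\<Sum>i\<in>{1..d}. \<Sum>k\<in>UNIV. \<Sum>v\<in>F. c i k v *s (if j = i then axis k (v x) else 0)) =
          (\<Sum>i\<in>{1..d}. if j = i then \<Sum>k\<in>UNIV. \<Sum>v\<in>F. c i k v *s (axis k (v x) :: complex^'r) else 0)"
        by (intro sum.cong) auto
      then show ?thesis
        using uc(2)[of x j] ell2_outside[OF h, of "(x, j)"] by auto
    qed
    moreover have "(\<lambda>(x, j). if j \<in> {1..d} then u j x else 0) \<in> tensor_K d U"
      using uc(1) by (simp add: tensor_K_alt)
    ultimately show "\<exists>u\<in>tensor_K d U. \<exists>c. h = (\<lambda>p. u p + (\<Sum>i\<in>{1..d} \<times> UNIV \<times> F.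
        c i *s (case i of (i, k, v) \<Rightarrow> \<lambda>(x, j). if j = i then axis k (v x) else 0) p))"
      by (intro bexI[of _ "\<lambda>(x, j). if j \<in> {1..d} then u j x else 0"] exI[of _ "\<lambda>(i, k, v). c i k v"])
        (simp_all only: sum.cartesian_product case_prod_unfold fun_eq_iff fst_conv snd_conv split_paired_All simp_thms)
  qed (use F(1) in auto)
qed

section \<open>From the non-backtracking resolvent to the resolvent of A\<close>

lemma conj_idx_closed: "2 * q \<le> d \<Longrightarrow> i \<in> {1..d} \<Longrightarrow> conj_idx q i \<in> {1..d}"
  by (auto simp: conj_idx_def)

lemma conj_idx_involution [simp]: "conj_idx q (conj_idx q i) = i"
  by (auto simp: conj_idx_def)

lemma tensor_op_perm_op: "tensor_op m (perm_op s) f x = m *v f (s x)"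
  by (simp add: tensor_op_def perm_op_def)

lemma tensor_op_id: "tensor_op m (\<lambda>g. g) f x = m *v f x"
  by (simp add: tensor_op_def)

lemma A_perm_eq: "A_perm d a s f x = a 0 *v f x + (\<Sum>i\<in>{1..d}. a i *v f (s i x))"
  by (simp add: A_perm_def matrix_op_def tensor_op_perm_op tensor_op_id)

lemma nonbacktracking_op_perm_eq:
  assumes "2 * q \<le> d" "i \<in> {1..d}"
  shows "nonbacktracking_op q d b (\<lambda>i. perm_op (s i)) f (x, i) =
    (\<Sum>j\<in>{1..d}. b j *v f (s i x, j)) - b (conj_idx q i) *v f (s i x, conj_idx q i)"
proof -
  have "{j. j \<in> {1..d} \<and> j \<noteq> conj_idx q i} = {1..d} - {conj_idx q i}" by auto
  then show ?thesis
    using assms conj_idx_closed[OF assms]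
    by (simp add: nonbacktracking_op_def tensor_op_perm_op sum_diff1 del: atLeastAtMost_iff)
qed

lemma nonbacktracking_op_outside:
  "i \<notin> {1..d} \<Longrightarrow> nonbacktracking_op q d b V f (x, i) = 0"
  unfolding nonbacktracking_op_def case_prod_conv by (simp only: if_False)

locale perm_family =
  fixes q d :: nat and X :: "'x set" and s :: "nat \<Rightarrow> 'x \<Rightarrow> 'x"
  assumes two_q: "2 * q \<le> d"
    and s_perm: "i \<in> {1..d} \<Longrightarrow> s i permutes X"
    and s_conj: "i \<in> {1..d} \<Longrightarrow> s (conj_idx q i) = inv_into UNIV (s i)"
begin

lemma s_inverse:
  assumes "i \<in> {1..d}"
  shows "s (conj_idx q i) (s i x) = x" "s i (s (conj_idx q i) x) = x"
  using permutes_inverses[OF s_perm[OF assms]] by (simp_all add: s_conj[OF assms])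

lemma s_inj: "i \<in> {1..d} \<Longrightarrow> inj_on (s i) Y"
  using permutes_inj[OF s_perm] by (auto intro: inj_on_subset)

lemma s_mem_iff: "i \<in> {1..d} \<Longrightarrow> s i x \<in> X \<longleftrightarrow> x \<in> X"
  using permutes_in_image[OF s_perm] .

lemma ell2_perm:
  fixes f :: "'x \<Rightarrow> complex^'r"
  assumes "i \<in> {1..d}" "f \<in> ell2 X"
  shows "(\<lambda>x. f (s i x)) \<in> ell2 X" "ell2_norm (\<lambda>x. f (s i x)) \<le> ell2_norm f"
  using ell2_dominated[OF assms(2), of 1 X "\<lambda>x. f (s i x)" "s i" UNIV] s_inj[OF assms(1)]
  by (auto simp: ell2_outside[OF assms(2)] s_mem_iff[OF assms(1)])

end

lemma bounded_rows_matrix_op: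
  fixes a :: "nat \<Rightarrow> complex^'r^'r"
  assumes V: "\<And>i g. i \<in> {1..d} \<Longrightarrow> V i g = (\<lambda>x. if x \<in> P then g (\<tau> i x) else 0)"
    and \<tau>: "\<And>i. i \<in> {1..d} \<Longrightarrow> inj_on (\<tau> i) P"
      "\<And>i x. i \<in> {1..d} \<Longrightarrow> x \<in> P \<Longrightarrow> x \<notin> X \<Longrightarrow> \<tau> i x \<notin> X"
  shows "bounded_rows X (matrix_op d a V)"
proof -
  have "matrix_op d a V = (\<lambda>f x. transport_op UNIV (a 0) (\<lambda>x. x) f x +
      (\<Sum>i\<in>{1..d}. transport_op P (a i) (\<tau> i) f x))"
  proof (intro ext)
    fix f x
    have "tensor_op (a i) (V i) f x = transport_op P (a i) (\<tau> i) f x" if "i \<in> {1..d}" for i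
      by (auto simp: tensor_op_def transport_op_def V[OF that] zero_vec_def[symmetric] vec_lambda_eta)
    then show "matrix_op d a V f x = transport_op UNIV (a 0) (\<lambda>x. x) f x +
      (\<Sum>i\<in>{1..d}. transport_op P (a i) (\<tau> i) f x)"
      by (simp add: matrix_op_def transport_op_def tensor_op_id)
  qed
  moreover have "bounded_rows X (\<lambda>f x. transport_op UNIV (a 0) (\<lambda>x. x) f x +
      (\<Sum>i\<in>{1..d}. transport_op P (a i) (\<tau> i) f x))"
    by (intro bounded_rows_add bounded_rows_sum bounded_rows_transport \<tau>) auto
  ultimately show ?thesis by simp
qed

lemma bounded_rows_nonbacktracking:
  fixes b :: "nat \<Rightarrow> complex^'r^'r"
  assumes V: "\<And>i g. i \<in> {1..d} \<Longrightarrow> V i g = (\<lambda>x. if x \<in> P then g (\<tau> i x) else 0)"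
    and \<tau>: "\<And>i. i \<in> {1..d} \<Longrightarrow> inj_on (\<tau> i) P"
      "\<And>i x. i \<in> {1..d} \<Longrightarrow> x \<in> P \<Longrightarrow> x \<notin> X \<Longrightarrow> \<tau> i x \<notin> X"
  shows "bounded_rows (X \<times> {1..d}) (nonbacktracking_op q d b V)"
proof -
  define E where "E = {(i, j). i \<in> {1..d} \<and> j \<in> {1..d} \<and> j \<noteq> conj_idx q i}"
  define t where "t = (\<lambda>(i, j). transport_op (P \<times> {i}) (b j) (\<lambda>(x, _). (\<tau> i x, j)))"
  have fin: "finite E"
    unfolding E_def by (rule finite_subset[of _ "{1..d} \<times> {1..d}"]) auto
  have "nonbacktracking_op q d b V = (\<lambda>f p. \<Sum>e\<in>E. t e f p)"
  proof (intro ext)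
    fix f and p :: "'a \<times> nat"
    obtain x i where p: "p = (x, i)" by fastforce
    have t: "t (k, j) f p = (if k = i then tensor_op (b j) (V i) (\<lambda>y. f (y, j)) x else 0)"
      if "k \<in> {1..d}" for k j
      using that by (auto simp: t_def transport_op_def tensor_op_def p V zero_vec_def[symmetric])
    have "(\<Sum>e\<in>E. t e f p) =
        (\<Sum>e\<in>E. if fst e = i then tensor_op (b (snd e)) (V i) (\<lambda>y. f (y, snd e)) x else 0)"
      by (intro sum.cong refl) (auto simp: E_def t)
    also have "\<dots> = (\<Sum>e\<in>{e \<in> E. fst e = i}. tensor_op (b (snd e)) (V i) (\<lambda>y. f (y, snd e)) x)"
      using fin by (simp add: sum.inter_filter)
    also have "\<dots> = nonbacktracking_op q d b V f p"
    proof (cases "i \<in> {1..d}")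
      case True
      have "(\<Sum>e\<in>{e \<in> E. fst e = i}. tensor_op (b (snd e)) (V i) (\<lambda>y. f (y, snd e)) x) =
          (\<Sum>j | j \<in> {1..d} \<and> j \<noteq> conj_idx q i. tensor_op (b j) (V i) (\<lambda>y. f (y, j)) x)"
        by (rule sum.reindex_bij_witness[of _ "\<lambda>j. (i, j)" snd]) (use True in \<open>auto simp: E_def\<close>)
      then show ?thesis using True by (simp add: nonbacktracking_op_def p)
    next
      case False
      then have "{e \<in> E. fst e = i} = {}" by (auto simp: E_def)
      then show ?thesis
        by (simp only: p sum.empty nonbacktracking_op_outside[OF False])
    qed
    finally show "nonbacktracking_op q d b V f p = (\<Sum>e\<in>E. t e f p)" ..
  qed
  moreover have "bounded_rows (X \<times> {1..d}) (\<lambda>f p. \<Sum>e\<in>E. t e f p)"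
  proof (rule bounded_rows_sum[OF fin])
    fix e assume "e \<in> E"
    then obtain i j where e: "e = (i, j)" and ij: "i \<in> {1..d}" "j \<in> {1..d}"
      by (auto simp: E_def)
    show "bounded_rows (X \<times> {1..d}) (t e)"
      unfolding t_def e case_prod_conv
      by (rule bounded_rows_transport) (use \<tau>[OF ij(1)] ij in \<open>auto simp: inj_on_def\<close>)
  qed
  ultimately show ?thesis by simp
qed

context perm_family
begin

lemma bounded_rows_A_perm: "bounded_rows X (A_perm d a s)"
  unfolding A_perm_def
  by (rule bounded_rows_matrix_op[of _ _ UNIV s]) (auto simp: perm_op_def s_inj s_mem_iff)

lemma bounded_rows_B_perm: "bounded_rows (X \<times> {1..d}) (B_perm q d a s \<mu>)"
  unfolding B_perm_def
  by (rule bounded_rows_nonbacktracking[of _ _ UNIV s]) (auto simp: perm_op_def s_inj s_mem_iff)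

lemma perm_op_ell2: "i \<in> {1..d} \<Longrightarrow> perm_op (s i) ` ell2 X = ell2 X"
proof -
  assume i: "i \<in> {1..d}"
  have mem: "perm_op (s j) g \<in> ell2 X" if "j \<in> {1..d}" "g \<in> ell2 X" for j g
    using ell2_dominated(1)[OF that(2), of 1 X "perm_op (s j) g" "s j" UNIV] s_inj[OF that(1)]
    by (auto simp: perm_op_def ell2_outside[OF that(2)] s_mem_iff[OF that(1)])
  show ?thesis
  proof (intro equalityI subsetI)
    fix g :: "'x \<Rightarrow> complex"
    assume "g \<in> ell2 X"
    then have "perm_op (s (conj_idx q i)) g \<in> ell2 X"
      by (intro mem conj_idx_closed[OF two_q i])
    moreover have "g = perm_op (s i) (perm_op (s (conj_idx q i)) g)"
      by (simp add: perm_op_def s_inverse[OF i])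
    ultimately show "g \<in> perm_op (s i) ` ell2 X" by blast
  qed (use mem[OF i] in auto)
qed

lemma tensor_H_matrix_mult:
  fixes m :: "complex^'r^'r"
  assumes "finite_codim_subspace X U" "f \<in> tensor_H U"
  shows "(\<lambda>x. m *v f x) \<in> tensor_H U"
proof -
  have U: "(\<lambda>x. 0) \<in> U" "\<And>f g. f \<in> U \<Longrightarrow> g \<in> U \<Longrightarrow> (\<lambda>x. f x + g x) \<in> U"
    "\<And>f c. f \<in> U \<Longrightarrow> (\<lambda>x. c * f x) \<in> U"
    using assms(1) by (auto simp: finite_codim_subspace_def)
  have "(\<lambda>x. \<Sum>l\<in>L. m $ k $ l * f x $ l) \<in> U" if "finite L" for L k
    using that assms(2) by (induction L) (auto simp: tensor_H_def intro!: U)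
  then show ?thesis by (simp add: tensor_H_def matrix_vector_mult_def)
qed

lemma tensor_H_perm:
  assumes "perm_op (s i) ` U = U" "f \<in> tensor_H U"
  shows "(\<lambda>x. f (s i x)) \<in> tensor_H U"
  using assms unfolding tensor_H_def perm_op_def by auto

lemma A_perm_invariant:
  fixes a :: "nat \<Rightarrow> complex^'r^'r"
  assumes U: "finite_codim_subspace X U" "\<And>i. i \<in> {1..d} \<Longrightarrow> perm_op (s i) ` U = U"
    and f: "f \<in> tensor_H U"
  shows "A_perm d a s f \<in> tensor_H U"
proof -
  note H = fun_subspace_closed[OF tensor_finite_codim(1)[OF U(1)]]
  have "(\<lambda>x. a 0 *v f x + (\<Sum>i\<in>{1..d}. a i *v f (s i x))) \<in> tensor_H U"
    by (intro H tensor_H_matrix_mult[OF U(1)] tensor_H_perm U(2) f)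
  then show ?thesis by (simp add: A_perm_eq[abs_def])
qed

lemma nonbacktracking_invariant:
  fixes b :: "nat \<Rightarrow> complex^'r^'r"
  assumes U: "finite_codim_subspace X U" "\<And>i. i \<in> {1..d} \<Longrightarrow> perm_op (s i) ` U = U"
    and h: "h \<in> tensor_K d U"
  shows "nonbacktracking_op q d b (\<lambda>i. perm_op (s i)) h \<in> tensor_K d U"
proof -
  note H = fun_subspace_closed[OF tensor_finite_codim(1)[OF U(1)]]
  have slice: "(\<lambda>x. h (x, j)) \<in> tensor_H U" if "j \<in> {1..d}" for j
    using h that by (simp add: tensor_K_alt)
  have "(\<lambda>x. nonbacktracking_op q d b (\<lambda>i. perm_op (s i)) h (x, i)) \<in> tensor_H U"
    if i: "i \<in> {1..d}" for i
    unfolding nonbacktracking_op_perm_eq[OF two_q i]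
    by (intro H tensor_H_matrix_mult[OF U(1)] tensor_H_perm[OF U(2)[OF i], of "\<lambda>x. h (x, _)"]
        slice conj_idx_closed[OF two_q i])
  then have "\<forall>i\<in>{1..d}. (\<lambda>x. nonbacktracking_op q d b (\<lambda>i. perm_op (s i)) h (x, i)) \<in> tensor_H U"
    by (rule ballI)
  moreover have "\<forall>x i. i \<notin> {1..d} \<longrightarrow> nonbacktracking_op q d b (\<lambda>i. perm_op (s i)) h (x, i) = 0"
    by (intro allI impI nonbacktracking_op_outside)
  ultimately show ?thesis
    unfolding tensor_K_alt by (rule conjI)
qed

text \<open>
  By the assumptions \<open>(\<mu> - A) g = P\<close> with \<open>P = 1 + \<Sum>\<^sub>i b\<^sub>i c\<^sub>i (b\<^bsub>i*\<^esub> - S\<^sub>i)\<close>.  If \<open>f\<close> solves \<open>(1 - B) f = (S\<^sub>i \<psi>)\<^sub>i\<close>, then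
  eliminating \<open>f\<^bsub>i*\<^esub>\<close> between the equations for \<open>i\<close> and \<open>i*\<close> gives
  \<open>f\<^sub>i = c\<^sub>i (S\<^sub>i - b\<^bsub>i*\<^esub>) \<phi>\<close> for \<open>\<phi> = \<psi> + \<Sum>\<^sub>j b\<^sub>j f\<^sub>j\<close>, and therefore \<open>P \<phi> = \<psi>\<close>.  Conversely,
  for given \<open>\<phi>\<close> this formula defines a solution \<open>f\<close> of the equation with \<open>\<psi> = P \<phi>\<close>.  The argument is
  algebraic, so it takes place in any invariant subspace.
\<close>

lemma resolvent_of_nonbacktracking_resolvent:
  fixes a b c :: "nat \<Rightarrow> complex^'r^'r" and g g' :: "complex^'r^'r" and U :: "('x \<Rightarrow> complex) set"
  assumes c: "\<And>i. i \<in> {1..d} \<Longrightarrow> c i ** (mat 1 - b (conj_idx q i) ** b i) = mat 1"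
      "\<And>i. i \<in> {1..d} \<Longrightarrow> (mat 1 - b (conj_idx q i) ** b i) ** c i = mat 1"
    and ag: "\<And>i. i \<in> {1..d} \<Longrightarrow> a i ** g = b i ** c i"
    and a0g: "\<And>v. \<mu> *s (g *v v) - a 0 *v (g *v v) =
        v + (\<Sum>i\<in>{1..d}. b i *v (c i *v (b (conj_idx q i) *v v)))"
    and gg': "g ** g' = mat 1" "g' ** g = mat 1"
    and U: "finite_codim_subspace X U" "\<And>i. i \<in> {1..d} \<Longrightarrow> perm_op (s i) ` U = U"
    and R: "is_resolvent (tensor_K d U) (nonbacktracking_op q d b (\<lambda>i. perm_op (s i))) 1 R"
  shows "\<exists>R'. is_resolvent (tensor_H U) (A_perm d a s) \<mu> R'"
proof -
  let ?B = "nonbacktracking_op q d b (\<lambda>i. perm_op (s i))"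
  let ?K = "tensor_K d U :: ('x \<times> nat \<Rightarrow> complex^'r) set" and ?H = "tensor_H U :: ('x \<Rightarrow> complex^'r) set"
  let ?st = "conj_idx q"
  note st = conj_idx_closed[OF two_q]
  note H = fun_subspace_closed[OF tensor_finite_codim(1)[OF U(1)]]
  note K = fun_subspace_closed[OF tensor_finite_codim(2)[OF U(1)]]
  have UX: "U \<subseteq> ell2 X"
    using U(1) by (simp add: finite_codim_subspace_def)
  note HX = tensor_K_subset(1)[OF UX] and KX = tensor_K_subset(2)[OF UX]
  note Hm = tensor_H_matrix_mult[OF U(1)]
  have Hs: "(\<lambda>x. f (s i x)) \<in> ?H" if "f \<in> ?H" "i \<in> {1..d}" for f i
    by (rule tensor_H_perm[OF U(2)[OF that(2)] that(1)])
  have Kslice: "(\<lambda>x. h (x, i)) \<in> ?H" if "h \<in> ?K" "i \<in> {1..d}" for h i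
    using that by (simp add: tensor_K_alt)
  define S where "S \<psi> = (\<lambda>(x, i). if i \<in> {1..d} then \<psi> (s i x) else (0 :: complex^'r))" for \<psi>
  define \<Phi> where "\<Phi> h x = (\<Sum>j\<in>{1..d}. b j *v h (x, j))" for h :: "'x \<times> nat \<Rightarrow> complex^'r" and x
  define P where "P \<phi> x = \<phi> x + (\<Sum>i\<in>{1..d}. b i *v (c i *v (b (?st i) *v \<phi> x - \<phi> (s i x))))" for \<phi> x
  define R' where "R' \<psi> = (\<lambda>x. g *v (\<psi> x + \<Phi> (R (S \<psi>)) x))" for \<psi>
  have SK: "S \<psi> \<in> ?K" if "\<psi> \<in> ?H" for \<psi>
    using Hs[OF that] by (simp add: tensor_K_alt S_def)
  have \<Phi>H: "\<Phi> h \<in> ?H" if "h \<in> ?K" for h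
    unfolding \<Phi>_def by (intro H Hm Kslice that)
  have RK: "R h \<in> ?K" if "h \<in> ?K" for h
    using R that by (auto simp: is_resolvent_def bounded_op_on_def)
  have R_add: "R (\<lambda>p. h p + k p) = (\<lambda>p. R h p + R k p)" if "h \<in> ?K" "k \<in> ?K" for h k
    using R that by (auto simp: is_resolvent_def bounded_op_on_def)
  have R_scale: "R (\<lambda>p. z *s h p) = (\<lambda>p. z *s R h p)" if "h \<in> ?K" for h z
    using R that by (auto simp: is_resolvent_def bounded_op_on_def)
  have R_left: "R (\<lambda>p. h p - ?B h p) = h" if "h \<in> ?K" for h
    using R that by (auto simp: is_resolvent_def)
  have R_right: "R h p - ?B (R h) p = h p" if "h \<in> ?K" for h p
  proof -
    have "(\<lambda>p. 1 *s R h p - ?B (R h) p) = h"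
      using R that by (auto simp: is_resolvent_def)
    from fun_cong[OF this, of p] show ?thesis by simp
  qed
  have B_eq: "?B h (x, i) = \<Phi> h (s i x) - b (?st i) *v h (s i x, ?st i)" if "i \<in> {1..d}" for h x i
    unfolding \<Phi>_def by (rule nonbacktracking_op_perm_eq[OF two_q that])
  have P_eq: "\<mu> *s (g *v \<phi> x) - A_perm d a s (\<lambda>x. g *v \<phi> x) x = P \<phi> x" for \<phi> x
  proof -
    have "a i *v (g *v v) = b i *v (c i *v v)" if "i \<in> {1..d}" for i v
      using ag[OF that] by (simp add: matrix_vector_mul_assoc)
    then have "\<mu> *s (g *v \<phi> x) - A_perm d a s (\<lambda>x. g *v \<phi> x) x =
        (\<mu> *s (g *v \<phi> x) - a 0 *v (g *v \<phi> x)) - (\<Sum>i\<in>{1..d}. b i *v (c i *v \<phi> (s i x)))"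
      by (simp add: A_perm_eq)
    then show ?thesis
      unfolding a0g P_def by (simp add: matrix_vector_mult_diff_distrib sum_subtractf)
  qed
  have P_sum: "(\<Sum>i\<in>{1..d}. b i *v (c i *v (\<phi> (s i x) - b (?st i) *v \<phi> x))) = \<phi> x - P \<phi> x" for \<phi> x
    unfolding P_def by (simp add: matrix_vector_mult_diff_distrib sum_subtractf)
  have R'H: "R' \<psi> \<in> ?H" if "\<psi> \<in> ?H" for \<psi>
    unfolding R'_def by (intro Hm H(2) \<Phi>H RK SK that)
  have right: "\<mu> *s R' \<psi> x - A_perm d a s (R' \<psi>) x = \<psi> x" if \<psi>: "\<psi> \<in> ?H" for \<psi> x
  proof -
    define f where "f = R (S \<psi>)"
    define \<phi> where "\<phi> x = \<psi> x + \<Phi> f x" for x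
    have step: "f (x, i) = \<phi> (s i x) - b (?st i) *v f (s i x, ?st i)" if "i \<in> {1..d}" for x i
    proof -
      have "f (x, i) - ?B f (x, i) = \<psi> (s i x)"
        using R_right[OF SK[OF \<psi>], of "(x, i)"] that by (simp only: f_def[symmetric]) (simp add: S_def)
      then show ?thesis
        unfolding B_eq[OF that] \<phi>_def by (simp add: algebra_simps)
    qed
    have f: "f (x, i) = c i *v (\<phi> (s i x) - b (?st i) *v \<phi> x)" if i: "i \<in> {1..d}" for x i
    proof -
      have "f (s i x, ?st i) = \<phi> x - b i *v f (x, i)"
        using step[OF st[OF i], of "s i x"] by (simp add: s_inverse[OF i])
      then have "f (x, i) = \<phi> (s i x) - b (?st i) *v (\<phi> x - b i *v f (x, i))"
        using step[OF i, of x] by metis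
      also have "\<dots> = \<phi> (s i x) - b (?st i) *v \<phi> x + b (?st i) *v (b i *v f (x, i))"
        by (simp only: matrix_vector_mult_diff_distrib) simp
      finally have "f (x, i) - b (?st i) *v (b i *v f (x, i)) = \<phi> (s i x) - b (?st i) *v \<phi> x"
        by (simp only: diff_eq_eq)
      then have "(mat 1 - b (?st i) ** b i) *v f (x, i) = \<phi> (s i x) - b (?st i) *v \<phi> x"
        by (simp only: matrix_vector_mult_diff_rdistrib matrix_vector_mul_lid
            matrix_vector_mul_assoc[symmetric])
      then have "c i *v ((mat 1 - b (?st i) ** b i) *v f (x, i)) =
          c i *v (\<phi> (s i x) - b (?st i) *v \<phi> x)" by simp
      then show ?thesis by (simp add: matrix_vector_mul_assoc c[OF i])
    qed
    have "\<Phi> f x = (\<Sum>i\<in>{1..d}. b i *v (c i *v (\<phi> (s i x) - b (?st i) *v \<phi> x)))" for x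
      unfolding \<Phi>_def by (intro sum.cong refl) (simp add: f)
    then have "\<Phi> f x = \<phi> x - P \<phi> x"
      by (simp only: P_sum)
    then have "P \<phi> x = \<psi> x"
      by (simp add: \<phi>_def)
    moreover have "R' \<psi> = (\<lambda>x. g *v \<phi> x)"
      by (simp add: R'_def \<phi>_def f_def)
    ultimately show ?thesis
      using P_eq[of \<phi> x] by simp
  qed
  have left: "R' (\<lambda>x. \<mu> *s \<phi> x - A_perm d a s \<phi> x) = \<phi>" if \<phi>: "\<phi> \<in> ?H" for \<phi>
  proof -
    define \<zeta> where "\<zeta> x = g' *v \<phi> x" for x
    have \<zeta>H: "\<zeta> \<in> ?H"
      unfolding \<zeta>_def by (intro Hm \<phi>)
    have g\<zeta>: "(\<lambda>x. g *v \<zeta> x) = \<phi>"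
      by (simp add: \<zeta>_def matrix_vector_mul_assoc gg')
    have P\<zeta>: "(\<lambda>x. \<mu> *s \<phi> x - A_perm d a s \<phi> x) = P \<zeta>"
      using P_eq[of \<zeta>] unfolding g\<zeta> by (simp add: fun_eq_iff flip: g\<zeta>)
    define f where "f = (\<lambda>(x, i). if i \<in> {1..d} then c i *v (\<zeta> (s i x) - b (?st i) *v \<zeta> x) else 0)"
    have fK: "f \<in> ?K"
      unfolding tensor_K_alt f_def by (auto intro!: Hm H(4) Hs \<zeta>H)
    have f\<Phi>: "\<Phi> f x = \<zeta> x - P \<zeta> x" for x
      unfolding P_sum[symmetric] \<Phi>_def by (intro sum.cong refl) (simp add: f_def)
    have cb: "c i *v (b (?st i) *v v) = b (?st i) *v (c (?st i) *v v)" if i: "i \<in> {1..d}" for i v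
    proof -
      have "b (?st i) ** (mat 1 - b i ** b (?st i)) = (mat 1 - b (?st i) ** b i) ** b (?st i)"
        by (simp add: matrix_diff_ldistrib matrix_diff_rdistrib matrix_mul_assoc)
      then have "c i ** (b (?st i) ** (mat 1 - b i ** b (?st i))) ** c (?st i) =
          c i ** ((mat 1 - b (?st i) ** b i) ** b (?st i)) ** c (?st i)" by simp
      then have "c i ** b (?st i) ** ((mat 1 - b i ** b (?st i)) ** c (?st i)) =
          (c i ** (mat 1 - b (?st i) ** b i)) ** b (?st i) ** c (?st i)"
        by (simp add: matrix_mul_assoc)
      then have "c i ** b (?st i) = b (?st i) ** c (?st i)"
        using c(1)[OF i] c(2)[OF st[OF i]] by simp
      then show ?thesis by (simp add: matrix_vector_mul_assoc)
    qed
    have "f p - ?B f p = S (P \<zeta>) p" for p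
    proof -
      obtain x i where p: "p = (x, i)" by fastforce
      show ?thesis
      proof (cases "i \<in> {1..d}")
        case True
        note i = True st[OF True]
        have fi: "f (x, i) = c i *v (\<zeta> (s i x) - b (?st i) *v \<zeta> x)"
          "f (s i x, ?st i) = c (?st i) *v (\<zeta> x - b i *v \<zeta> (s i x))"
          using i by (simp_all add: f_def s_inverse del: atLeastAtMost_iff)
        have "f (x, i) + b (?st i) *v f (s i x, ?st i) = c i *v (\<zeta> (s i x) - b (?st i) *v \<zeta> x +
            b (?st i) *v (\<zeta> x - b i *v \<zeta> (s i x)))"
          unfolding fi cb[OF i(1), symmetric] by (simp add: matrix_vector_right_distrib)
        also have "\<dots> = c i *v ((mat 1 - b (?st i) ** b i) *v \<zeta> (s i x))"
          by (simp add: matrix_vector_mult_diff_distrib matrix_vector_mult_diff_rdistrib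
              matrix_vector_mul_assoc)
        also have "\<dots> = \<zeta> (s i x)"
          by (simp add: matrix_vector_mul_assoc c[OF i(1)])
        finally have "f (x, i) - (\<Phi> f (s i x) - b (?st i) *v f (s i x, ?st i)) = P \<zeta> (s i x)"
          unfolding f\<Phi> by (simp add: algebra_simps)
        then show ?thesis
          using i(1) B_eq[OF i(1)] by (simp add: p S_def)
      next
        case False
        then have "f p = 0" "S (P \<zeta>) p = 0"
          by (simp_all only: p f_def S_def case_prod_conv if_False)
        moreover have "?B f p = 0"
          unfolding p by (rule nonbacktracking_op_outside[OF False])
        ultimately show ?thesis by simp
      qed
    qed
    then have "R (S (P \<zeta>)) = f"
      using R_left[OF fK] by simp
    then show ?thesis
      unfolding P\<zeta> R'_def by (simp add: f\<Phi> g\<zeta>)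
  qed
  obtain C where C: "0 \<le> C" "\<And>h. h \<in> ?K \<Longrightarrow> ell2_norm (R h) \<le> C * ell2_norm h"
    using R bounded_op_on_nonneg_bound unfolding is_resolvent_def by blast
  have bound: "ell2_norm (R' \<psi>) \<le> norm g * (1 + (\<Sum>j\<in>{1..d}. norm (b j) * (C * real d))) * ell2_norm \<psi>"
    if \<psi>: "\<psi> \<in> ?H" for \<psi>
  proof -
    have \<psi>X: "\<psi> \<in> ell2 X" using HX \<psi> by blast
    have RX: "R (S \<psi>) \<in> ell2 (X \<times> {1..d})" using RK[OF SK[OF \<psi>]] KX by blast
    have "ell2_norm (S \<psi>) \<le> (\<Sum>i\<in>{1..d}. ell2_norm (\<lambda>x. \<psi> (s i x)))"
      unfolding S_def by (rule ell2_unslice(2)) (auto intro: ell2_perm(1)[OF _ \<psi>X])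
    also have "\<dots> \<le> (\<Sum>i\<in>{1..d}. ell2_norm \<psi>)"
      by (intro sum_mono ell2_perm(2)[OF _ \<psi>X])
    finally have S_bound: "ell2_norm (S \<psi>) \<le> real d * ell2_norm \<psi>" by simp
    have "ell2_norm (R (S \<psi>)) \<le> C * (real d * ell2_norm \<psi>)"
      using order_trans[OF C(2)[OF SK[OF \<psi>]] mult_left_mono[OF S_bound C(1)]] .
    then have slice: "ell2_norm (\<lambda>x. R (S \<psi>) (x, j)) \<le> C * real d * ell2_norm \<psi>" for j
      using ell2_slice(2)[OF RX, of j] by simp
    have summand: "ell2_norm (\<lambda>x. b j *v R (S \<psi>) (x, j)) \<le> norm (b j) * (C * real d) * ell2_norm \<psi>" for j
      using order_trans[OF ell2_matrix_mult(2)[OF ell2_slice(1)[OF RX]] mult_left_mono[OF slice]]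
      by (simp add: mult.assoc)
    have "ell2_norm (\<Phi> (R (S \<psi>))) \<le> (\<Sum>j\<in>{1..d}. ell2_norm (\<lambda>x. b j *v R (S \<psi>) (x, j)))"
      unfolding \<Phi>_def by (intro ell2_sum(2)[where X = X] ell2_matrix_mult(1) ell2_slice(1)[OF RX]) auto
    also have "\<dots> \<le> (\<Sum>j\<in>{1..d}. norm (b j) * (C * real d) * ell2_norm \<psi>)"
      by (intro sum_mono summand)
    finally have "ell2_norm (\<Phi> (R (S \<psi>))) \<le> (\<Sum>j\<in>{1..d}. norm (b j) * (C * real d)) * ell2_norm \<psi>"
      by (simp add: sum_distrib_right)
    moreover have \<Phi>X: "\<Phi> (R (S \<psi>)) \<in> ell2 X"
      using \<Phi>H[OF RK[OF SK[OF \<psi>]]] HX by blast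
    ultimately have "ell2_norm (\<lambda>x. \<psi> x + \<Phi> (R (S \<psi>)) x) \<le>
        (1 + (\<Sum>j\<in>{1..d}. norm (b j) * (C * real d))) * ell2_norm \<psi>"
      using ell2_add(2)[OF \<psi>X \<Phi>X] by (simp add: algebra_simps)
    then show ?thesis
      unfolding R'_def
      using order_trans[OF ell2_matrix_mult(2)[OF ell2_add(1)[OF \<psi>X \<Phi>X], of g] mult_left_mono]
      by (simp add: mult.assoc)
  qed
  have R'_add: "R' (\<lambda>x. \<phi> x + \<psi> x) = (\<lambda>x. R' \<phi> x + R' \<psi> x)" if "\<phi> \<in> ?H" "\<psi> \<in> ?H" for \<phi> \<psi>
  proof -
    have "S (\<lambda>x. \<phi> x + \<psi> x) = (\<lambda>p. S \<phi> p + S \<psi> p)"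
      by (auto simp: S_def fun_eq_iff)
    then have "R (S (\<lambda>x. \<phi> x + \<psi> x)) = (\<lambda>p. R (S \<phi>) p + R (S \<psi>) p)"
      using R_add[OF SK[OF that(1)] SK[OF that(2)]] by simp
    then show ?thesis
      by (simp add: R'_def \<Phi>_def matrix_vector_right_distrib sum.distrib fun_eq_iff algebra_simps)
  qed
  have R'_scale: "R' (\<lambda>x. z *s \<phi> x) = (\<lambda>x. z *s R' \<phi> x)" if "\<phi> \<in> ?H" for \<phi> z
  proof -
    have "S (\<lambda>x. z *s \<phi> x) = (\<lambda>p. z *s S \<phi> p)"
      by (auto simp: S_def fun_eq_iff)
    then have "R (S (\<lambda>x. z *s \<phi> x)) = (\<lambda>p. z *s R (S \<phi>) p)"
      using R_scale[OF SK[OF that]] by simp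
    then show ?thesis
      by (simp add: R'_def \<Phi>_def matrix_vector_mult_scalar vector_scalar_mult_sum
          vector_scalar_mult_add matrix_vector_right_distrib matrix_vector_mult_sum)
  qed
  have "bounded_op_on ?H R'"
    unfolding bounded_op_on_def using R'H R'_add R'_scale bound by blast
  then have "is_resolvent ?H (A_perm d a s) \<mu> R'"
    unfolding is_resolvent_def using left right by (auto simp: fun_eq_iff)
  then show ?thesis by blast
qed

end

section \<open>Reduced words in the free product\<close>

text \<open>Non-backtracking walks move by one generator at a time, whereas elements of the free product
  are words in syllables \<open>(i, k)\<close>, that is, powers of a generator.  The elements are therefore
  recoded as reduced words in the letters \<open>1..d\<close>, in which \<open>i\<close> and \<open>i*\<close> are never neighbours.\<close>

definition reduced :: "nat \<Rightarrow> nat \<Rightarrow> nat list set"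
  where "reduced q d = {w. set w \<subseteq> {1..d} \<and> successively (\<lambda>i j. j \<noteq> conj_idx q i) w}"

text \<open>Left multiplication by \<open>g\<^sub>i\<close>, as it acts on reduced words.\<close>

definition push :: "nat \<Rightarrow> nat \<Rightarrow> nat list \<Rightarrow> nat list"
  where "push q i w = (if w \<noteq> [] \<and> hd w = conj_idx q i then tl w else i # w)"

definition syllable_letters :: "nat \<Rightarrow> nat \<times> int \<Rightarrow> nat list"
  where "syllable_letters q = (\<lambda>(i, k). if i \<le> q
    then (if 0 \<le> k then replicate (nat k) i else replicate (nat (- k)) (i + q)) else [i])"

definition letters :: "nat \<Rightarrow> (nat \<times> int) list \<Rightarrow> nat list"
  where "letters q x = concat (map (syllable_letters q) x)"

definition word_elt :: "nat \<Rightarrow> nat \<Rightarrow> nat list \<Rightarrow> (nat \<times> int) list"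
  where "word_elt q d w = foldr (\<lambda>i x. Xgen q d i \<otimes>\<^bsub>Xstar q d\<^esub> x) w []"

lemma word_elt_simps [simp]:
  "word_elt q d [] = []"
  "word_elt q d (i # w) = Xgen q d i \<otimes>\<^bsub>Xstar q d\<^esub> word_elt q d w"
  by (simp_all add: word_elt_def)

lemma letters_simps [simp]:
  "letters q [] = []" "letters q (p # x) = syllable_letters q p @ letters q x"
  by (simp_all add: letters_def)

lemma reduced_Nil [simp]: "[] \<in> reduced q d"
  by (simp add: reduced_def)

lemma reduced_Cons:
  "i # w \<in> reduced q d \<longleftrightarrow> i \<in> {1..d} \<and> w \<in> reduced q d \<and> (w = [] \<or> hd w \<noteq> conj_idx q i)"
  by (cases w) (auto simp: reduced_def)

lemma push_reduced:
  assumes "w \<in> reduced q d" "i \<in> {1..d}"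
  shows "push q i w \<in> reduced q d"
  using assms by (cases w) (auto simp: push_def reduced_Cons)

lemma push_Cons_reduced: "i # w \<in> reduced q d \<Longrightarrow> push q i w = i # w"
  by (auto simp: push_def reduced_Cons)

lemma push_conj: "w \<in> reduced q d \<Longrightarrow> push q (conj_idx q i) (push q i w) = w"
  by (cases w) (auto simp: push_def reduced_Cons)

locale free_prod =
  fixes q d :: nat
  assumes two_q: "2 * q \<le> d"
begin

abbreviation "G \<equiv> Xstar q d"
abbreviation "C \<equiv> carrier (Xstar q d)"
abbreviation "gen \<equiv> Xgen q d"
abbreviation "st \<equiv> conj_idx q"
abbreviation "ev \<equiv> word_elt q d"
abbreviation "Red \<equiv> reduced q d"

sublocale group "Xstar q d"
  by (rule group_Xstar)

lemma gen_closed [simp]: "i \<in> {1..d} \<Longrightarrow> gen i \<in> C"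
  by (rule Xgen_closed[OF two_q])

lemma st_closed: "i \<in> {1..d} \<Longrightarrow> st i \<in> {1..d}"
  by (rule conj_idx_closed[OF two_q])

lemma one_eq: "\<one>\<^bsub>G\<^esub> = []"
  by (simp add: Xstar_def)

lemma Nil_closed [simp]: "[] \<in> C"
  using one_closed by (simp add: one_eq)

lemma mult_Nil [simp]: "x \<in> C \<Longrightarrow> x \<otimes>\<^bsub>G\<^esub> [] = x" "x \<in> C \<Longrightarrow> [] \<otimes>\<^bsub>G\<^esub> x = x"
  using r_one[of x] l_one[of x] by (simp_all add: one_eq)

lemma gen_cases:
  assumes "i \<in> {1..d}"
  obtains "i \<in> {1..q}" "gen i = [(i, 1)]" "st i = i + q"
    | j where "j \<in> {1..q}" "i = j + q" "gen i = [(j, - 1)]" "st i = j"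
    | "2 * q < i" "gen i = [(i, 1)]" "st i = i"
proof (cases "q + 1 \<le> i \<and> i \<le> 2 * q")
  case True
  then show thesis
    using that(2)[of "i - q"] Xgen_eq[of q i d] by (auto simp: conj_idx_def)
next
  case False
  then show thesis
    using that(1,3) assms by (cases "i \<le> q") (auto simp: Xgen_def conj_idx_def)
qed

lemma C_Cons:
  "(i, k) # x \<in> C \<longleftrightarrow> (i \<in> {1..q} \<and> k \<noteq> 0 \<or> i \<in> {2 * q + 1..d} \<and> k = 1) \<and> x \<in> C \<and>
    (x = [] \<or> fst (hd x) \<noteq> i)"
  unfolding Xstar_def Cons_in_free_product
  by (auto simp: Xstar_factor_def carrier_integer_mod_group)

lemma syllable_mult: "[(j, k)] \<otimes>\<^bsub>G\<^esub> x = fp_lmult (Xstar_factor q) (j, k) x"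
  by (simp add: Xstar_def mult_free_product)

lemma letters_hd:
  assumes "(j, k) # x \<in> C"
  shows "letters q ((j, k) # x) \<noteq> []"
    "hd (letters q ((j, k) # x)) = (if j \<le> q \<and> k < 0 then j + q else j)"
  using assms unfolding C_Cons by (auto simp: syllable_letters_def)

text \<open>If \<open>g\<^sub>i\<close> belongs to the factor of the first syllable, its exponent changes by one, so a letter is
  added or removed; otherwise \<open>g\<^sub>i\<close> becomes a syllable of its own, and there is no cancellation
  because the first letter of \<open>x\<close> belongs to another factor.\<close>

lemma letters_gen_mult:
  assumes i: "i \<in> {1..d}" and x: "x \<in> C"
  shows "letters q (gen i \<otimes>\<^bsub>G\<^esub> x) = push q i (letters q x)"
proof (cases x)
  case Nil
  show ?thesis
    using i Nil by (cases rule: gen_cases)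
      (auto simp: syllable_mult fp_cons_def Xstar_factor_def push_def syllable_letters_def)
next
  case (Cons p y)
  obtain j k where p: "p = (j, k)" by fastforce
  have C: "(j, k) # y \<in> C" using x Cons p by simp
  note hd = letters_hd[OF C]
  show ?thesis
    using i
  proof (cases rule: gen_cases)
    case 1
    show ?thesis
    proof (cases "j = i")
      case True
      have "k \<noteq> 0" using C True 1 by (auto simp: C_Cons)
      then have "k = -1 \<or> k < -1 \<or> 0 < k" by presburger
      then consider "k = -1" | "k < -1" | "0 < k" by blast
      then show ?thesis
      proof cases
        case 2
        then have "nat (- k) = Suc (nat (- k - 1))" by simp
        then show ?thesis using 1 2 True
          by (simp add: Cons p syllable_mult fp_cons_def Xstar_factor_def push_def syllable_letters_def)
      next
        case 3
        then have "nat (1 + k) = Suc (nat k)" by simp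
        then show ?thesis using 1 3 True hd
          by (simp add: Cons p syllable_mult fp_cons_def Xstar_factor_def push_def syllable_letters_def)
      qed (use 1 True in \<open>simp add: Cons p syllable_mult fp_cons_def Xstar_factor_def push_def
          syllable_letters_def\<close>)
    next
      case False
      then have "hd (letters q x) \<noteq> st i"
        using hd C 1 by (auto simp: Cons p C_Cons)
      then show ?thesis using 1 False
        by (simp add: Cons p syllable_mult fp_cons_def Xstar_factor_def push_def)
          (simp add: syllable_letters_def)
    qed
  next
    case (2 l)
    show ?thesis
    proof (cases "j = l")
      case True
      have "k \<noteq> 0" using C True 2 by (auto simp: C_Cons)
      then have "k = 1 \<or> k > 1 \<or> k < 0" by presburger
      then consider "k = 1" | "k > 1" | "k < 0" by blast
      then show ?thesis
      proof cases
        case 2: 2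
        then have "nat k = Suc (nat (k - 1))" by simp
        then show ?thesis using \<open>l \<in> {1..q}\<close> \<open>i = l + q\<close> \<open>gen i = _\<close> \<open>st i = l\<close> 2 True
          by (simp add: Cons p syllable_mult fp_cons_def Xstar_factor_def push_def syllable_letters_def)
      next
        case 3
        then have "nat (1 - k) = Suc (nat (- k))" by simp
        then show ?thesis using 2 3 True hd
          by (simp add: Cons p syllable_mult fp_cons_def Xstar_factor_def push_def syllable_letters_def)
      qed (use 2 True in \<open>simp add: Cons p syllable_mult fp_cons_def Xstar_factor_def push_def
          syllable_letters_def\<close>)
    next
      case False
      then have "hd (letters q x) \<noteq> st i"
        using hd C 2 by (auto simp: Cons p C_Cons)
      then show ?thesis using 2 False
        by (simp add: Cons p syllable_mult fp_cons_def Xstar_factor_def push_def)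
          (simp add: syllable_letters_def)
    qed
  next
    case 3
    show ?thesis
    proof (cases "j = i")
      case True
      then have "k = 1" using C 3 by (auto simp: C_Cons)
      then show ?thesis using 3 True
        by (simp add: Cons p syllable_mult fp_cons_def Xstar_factor_def push_def
          syllable_letters_def)
    next
      case False
      then have "hd (letters q x) \<noteq> st i"
        using hd C 3 by (auto simp: Cons p C_Cons split: if_splits)
      then show ?thesis using 3 False
        by (simp add: Cons p syllable_mult fp_cons_def Xstar_factor_def push_def)
          (simp add: syllable_letters_def)
    qed
  qed
qed

lemma ev_closed: "set w \<subseteq> {1..d} \<Longrightarrow> ev w \<in> C"
  by (induction w) auto

lemma reduced_letters_set: "w \<in> Red \<Longrightarrow> set w \<subseteq> {1..d}"
  by (simp add: reduced_def)

lemma ev_Red_closed: "w \<in> Red \<Longrightarrow> ev w \<in> C"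
  by (intro ev_closed reduced_letters_set)

lemma letters_ev_foldr: "set w \<subseteq> {1..d} \<Longrightarrow> letters q (ev w) = foldr (push q) w []"
  by (induction w) (auto simp: letters_gen_mult ev_closed)

lemma letters_ev_Red: "w \<in> Red \<Longrightarrow> letters q (ev w) = w"
proof (induction w)
  case (Cons i w)
  then show ?case
    using push_Cons_reduced[OF Cons.prems]
    by (auto simp: reduced_Cons letters_gen_mult ev_Red_closed)
qed simp

lemma letters_ev_reduced: "set w \<subseteq> {1..d} \<Longrightarrow> letters q (ev w) \<in> Red"
  unfolding letters_ev_foldr by (induction w) (auto intro: push_reduced)

lemma ev_append: "set v \<subseteq> {1..d} \<Longrightarrow> set w \<subseteq> {1..d} \<Longrightarrow> ev (v @ w) = ev v \<otimes>\<^bsub>G\<^esub> ev w"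
  by (induction v) (auto simp: m_assoc ev_closed)

lemma syllable_letters_set:
  "(j, k) # x \<in> C \<Longrightarrow> set (syllable_letters q (j, k)) \<subseteq> {1..d}"
  unfolding C_Cons using two_q by (auto simp: syllable_letters_def)

lemma letters_set: "x \<in> C \<Longrightarrow> set (letters q x) \<subseteq> {1..d}"
proof (induction x)
  case (Cons p x)
  then show ?case
    using syllable_letters_set[of "fst p" "snd p" x] C_Cons[of "fst p" "snd p" x] by auto
qed simp

lemma ev_power:
  assumes "i \<in> {1..q}" "k \<noteq> 0"
  shows "ev (syllable_letters q (i, k)) = [(i, k)]"
proof -
  have i: "i \<in> {1..d}" "i + q \<in> {1..d}" using assms two_q by auto
  have gens: "gen i = [(i, 1)]" "gen (i + q) = [(i, - 1)]"
    using assms Xgen_eq[of q "i + q" d] by (auto simp: Xgen_def)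
  have pos: "ev (replicate (Suc n) i) = [(i, int (Suc n))]" for n
  proof (induction n)
    case 0
    show ?case using gens gen_closed[OF i(1)] by simp
  next
    case (Suc n)
    then show ?case
      using assms by (simp add: syllable_mult gens Xstar_factor_def fp_cons_def)
  qed
  have neg: "ev (replicate (Suc n) (i + q)) = [(i, - int (Suc n))]" for n
  proof (induction n)
    case 0
    show ?case using gens gen_closed[OF i(2)] by simp
  next
    case (Suc n)
    then show ?case
      using assms by (simp add: syllable_mult gens Xstar_factor_def fp_cons_def)
  qed
  show ?thesis
  proof (cases "0 \<le> k")
    case True
    then have "nat k = Suc (nat (k - 1))" "k = int (Suc (nat (k - 1)))" using assms(2) by auto
    then show ?thesis using pos[of "nat (k - 1)"] True assms(1) by (simp add: syllable_letters_def)
  next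
    case False
    then have "nat (- k) = Suc (nat (- k - 1))" "k = - int (Suc (nat (- k - 1)))" by auto
    then show ?thesis using neg[of "nat (- k - 1)"] False assms(1) by (simp add: syllable_letters_def)
  qed
qed

lemma ev_letters: "x \<in> C \<Longrightarrow> ev (letters q x) = x"
proof (induction x)
  case (Cons p x)
  obtain j k where p: "p = (j, k)" by fastforce
  have C: "(j, k) # x \<in> C" using Cons.prems p by simp
  then have x: "x \<in> C" by (simp add: C_Cons)
  have "ev (syllable_letters q (j, k)) = [(j, k)]"
  proof (cases "j \<in> {1..q}")
    case True
    then show ?thesis using C by (intro ev_power) (auto simp: C_Cons)
  next
    case False
    then have j: "2 * q < j" "j \<in> {1..d}" "k = 1" using C by (auto simp: C_Cons)
    then have "ev [j] = gen j" by simp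
    then show ?thesis using j False by (auto simp: syllable_letters_def Xgen_def)
  qed
  then have "ev (letters q (p # x)) = [(j, k)] \<otimes>\<^bsub>G\<^esub> x"
    using ev_append[OF syllable_letters_set[OF C] letters_set[OF x]] Cons.IH[OF x] by (simp add: p)
  also have "\<dots> = fp_lmult (Xstar_factor q) (j, k) x"
    by (rule syllable_mult)
  also have "\<dots> = p # x"
    using C by (cases x) (auto simp: C_Cons p fp_cons_def Xstar_factor_def)
  finally show ?case .
qed simp

lemma letters_Red: "x \<in> C \<Longrightarrow> letters q x \<in> Red"
  using letters_ev_reduced[OF letters_set] by (simp add: ev_letters)

text \<open>Building up a reduced word letter by letter never cancels, so \<open>letters\<close> recovers it; conversely the
  letters of a syllable multiply to that syllable.\<close>

lemma ev_bij: "bij_betw ev Red C"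
  by (rule bij_betw_byWitness[of _ "letters q"])
    (auto simp: letters_ev_Red ev_letters ev_Red_closed letters_Red)

lemma ev_push:
  assumes "w \<in> Red" "i \<in> {1..d}"
  shows "ev (push q i w) = gen i \<otimes>\<^bsub>G\<^esub> ev w"
proof -
  have "letters q (gen i \<otimes>\<^bsub>G\<^esub> ev w) = push q i w"
    using assms by (simp add: letters_gen_mult ev_Red_closed letters_ev_Red)
  then show ?thesis
    using ev_letters[of "gen i \<otimes>\<^bsub>G\<^esub> ev w"] assms by (simp add: ev_Red_closed)
qed

lemma gen_st: "i \<in> {1..d} \<Longrightarrow> inv\<^bsub>G\<^esub> (gen i) = gen (st i)"
proof -
  assume i: "i \<in> {1..d}"
  have "ev (push q (st i) [i]) = gen (st i) \<otimes>\<^bsub>G\<^esub> ev [i]"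
    by (rule ev_push) (use i st_closed in \<open>auto simp: reduced_Cons\<close>)
  then have "gen (st i) \<otimes>\<^bsub>G\<^esub> gen i = \<one>\<^bsub>G\<^esub>"
    using i by (simp add: push_def one_eq)
  then show ?thesis
    using i st_closed by (intro inv_equality) auto
qed

lemma lambda_gen_eq:
  assumes "i \<in> {1..d}"
  shows "lambda_gen q d i f = (\<lambda>x. if x \<in> C then f (gen (st i) \<otimes>\<^bsub>G\<^esub> x) else 0)"
  unfolding lambda_gen_def left_regular_def gen_st[OF assms] ..

text \<open>The index \<open>i*\<close> appears because the left regular representation acts on functions by the inverse
  translation.\<close>

lemma lambda_gen_ev:
  assumes "i \<in> {1..d}" "w \<in> Red"
  shows "lambda_gen q d i f (ev w) = f (ev (push q (st i) w))"
  unfolding lambda_gen_eq[OF assms(1)] ev_push[OF assms(2) st_closed[OF assms(1)]]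
  by (simp add: ev_Red_closed[OF assms(2)])

end

section \<open>The Green function of the free operator\<close>

text \<open>The block \<open>M\<^sub>x\<^sub>y\<close> is the coefficient of \<open>f y\<close> in the finite sum for \<open>M f x\<close>, so a block can be removed
  by deleting a value of the argument instead.\<close>

lemma zero_blocks_eq:
  assumes "finite_rows M" "finite E"
  shows "zero_blocks E M f x = M (\<lambda>z. if (x, z) \<in> E then 0 else f z) x"
proof -
  obtain N K where M: "\<And>x. finite (N x)" "\<And>f x. M f x = (\<Sum>y\<in>N x. K x y *v f y)"
    using finite_rowsE[OF assms(1)] by blast
  define Y where "Y = {y. (x, y) \<in> E}"
  have Y: "finite Y"
    unfolding Y_def by (rule finite_subset[of _ "snd ` E"]) (use assms(2) in force)+
  have "block M x y = (if y \<in> N x then K x y else 0)" for y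
  proof -
    have "(\<Sum>z\<in>N x. K x z *v (if z = y then axis l 1 else 0)) =
        (\<Sum>z\<in>N x. if z = y then K x y *v axis l 1 else 0)" for l
      by (intro sum.cong) auto
    then have "(\<Sum>z\<in>N x. K x z *v (if z = y then axis l 1 else 0)) =
        (if y \<in> N x then K x y *v axis l 1 else 0)" for l
      using M(1)[of x] by simp
    then show ?thesis
      unfolding block_def M(2) by (simp only:) (simp add: vec_eq_iff matrix_vector_mult_axis)
  qed
  then have "(\<Sum>y\<in>Y. block M x y *v f y) = (\<Sum>y\<in>Y. if y \<in> N x then K x y *v f y else 0)"
    by (intro sum.cong) auto
  also have "\<dots> = (\<Sum>y\<in>Y \<inter> N x. K x y *v f y)"
    using Y by (rule sum.inter_restrict[symmetric])
  also have "\<dots> = (\<Sum>y\<in>N x. if y \<in> Y then K x y *v f y else 0)"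
    using M(1) by (subst Int_commute) (rule sum.inter_restrict)
  finally have "zero_blocks E M f x = (\<Sum>y\<in>N x. K x y *v f y - (if y \<in> Y then K x y *v f y else 0))"
    unfolding zero_blocks_def Y_def[symmetric] M(2)[of f x] sum_subtractf by simp
  also have "\<dots> = M (\<lambda>z. if (x, z) \<in> E then 0 else f z) x"
    unfolding M(2) by (intro sum.cong) (auto simp: Y_def)
  finally show ?thesis .
qed

lemma bounded_rows_zero_blocks:
  assumes "bounded_rows X M" "finite E" "E \<subseteq> X \<times> X"
  shows "bounded_rows X (zero_blocks E M)"
proof -
  have eq: "zero_blocks E M = (\<lambda>f x. M f x +
      (\<Sum>e\<in>E. transport_op {fst e} (- block M (fst e) (snd e)) (\<lambda>_. snd e) f x))"
  proof (intro ext)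
    fix f x
    have "(\<Sum>e\<in>E. transport_op {fst e} (- block M (fst e) (snd e)) (\<lambda>_. snd e) f x) =
        (\<Sum>e\<in>E. if fst e = x then - (block M x (snd e) *v f (snd e)) else 0)"
      by (intro sum.cong refl) (simp add: transport_op_def minus_matrix_vector_mult)
    also have "\<dots> = (\<Sum>e\<in>{e \<in> E. fst e = x}. - (block M x (snd e) *v f (snd e)))"
      using assms(2) by (simp add: sum.inter_filter)
    also have "\<dots> = - (\<Sum>y | (x, y) \<in> E. block M x y *v f y)"
      unfolding sum_negf
      by (rule arg_cong[of _ _ uminus], rule sum.reindex_bij_witness[of _ "\<lambda>y. (x, y)" snd]) auto
    finally show "zero_blocks E M f x = M f x +
        (\<Sum>e\<in>E. transport_op {fst e} (- block M (fst e) (snd e)) (\<lambda>_. snd e) f x)"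
      by (simp add: zero_blocks_def)
  qed
  show ?thesis
    unfolding eq using assms(3)
    by (intro bounded_rows_add assms(1) bounded_rows_sum assms(2) bounded_rows_transport) auto
qed

lemma reduced_append:
  "v @ w \<in> reduced q d \<longleftrightarrow> v \<in> reduced q d \<and> w \<in> reduced q d \<and>
    (v = [] \<or> w = [] \<or> hd w \<noteq> conj_idx q (last v))"
  unfolding reduced_def mem_Collect_eq successively_append_iff set_append Un_subset_iff by blast

context free_prod
begin

lemma A_star_ev:
  assumes "w \<in> Red"
  shows "A_star q d a f (ev w) = a 0 *v f (ev w) + (\<Sum>i\<in>{1..d}. a i *v f (ev (push q (st i) w)))"
proof -
  have "tensor_op (a i) (lambda_gen q d i) f (ev w) = a i *v f (ev (push q (st i) w))"
    if "i \<in> {1..d}" for i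
    using lambda_gen_ev[OF that assms] by (simp add: tensor_op_def)
  then show ?thesis
    by (simp add: A_star_def matrix_op_def tensor_op_id)
qed

lemma left_mult_inj:
  assumes "i \<in> {1..d}"
  shows "inj_on (\<lambda>x. gen (st i) \<otimes>\<^bsub>G\<^esub> x) C"
proof (rule inj_onI)
  fix x y
  assume "x \<in> C" "y \<in> C" "gen (st i) \<otimes>\<^bsub>G\<^esub> x = gen (st i) \<otimes>\<^bsub>G\<^esub> y"
  then show "x = y"
    using gen_closed[OF st_closed[OF assms]] by simp
qed

lemma bounded_rows_A_star: "bounded_rows C (A_star q d a)"
  unfolding A_star_def
  by (rule bounded_rows_matrix_op[of _ _ C "\<lambda>i x. gen (st i) \<otimes>\<^bsub>G\<^esub> x"])
    (auto simp: lambda_gen_eq left_mult_inj simp del: atLeastAtMost_iff)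

lemma bounded_rows_B_star: "bounded_rows (C \<times> {1..d}) (B_star q d a \<mu>)"
  unfolding B_star_def
  by (rule bounded_rows_nonbacktracking[of _ _ C "\<lambda>i x. gen (st i) \<otimes>\<^bsub>G\<^esub> x"])
    (auto simp: lambda_gen_eq left_mult_inj simp del: atLeastAtMost_iff)

definition "unit_blocks = (\<lambda>j. (gen j, \<one>\<^bsub>G\<^esub>)) ` {1..d} \<union> (\<lambda>j. (\<one>\<^bsub>G\<^esub>, gen j)) ` {1..d}"

lemma A_star_o_eq: "A_star_o q d a = zero_blocks unit_blocks (A_star q d a)"
  by (simp add: A_star_o_def unit_blocks_def)

lemma bounded_rows_A_star_o: "bounded_rows C (A_star_o q d a)"
  unfolding A_star_o_eq
  by (rule bounded_rows_zero_blocks[OF bounded_rows_A_star]) (auto simp: unit_blocks_def)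

lemma A_star_outside: "x \<notin> C \<Longrightarrow> A_star q d a f x = a 0 *v f x"
  by (simp add: A_star_def matrix_op_def tensor_op_id tensor_op_def lambda_gen_eq
      zero_vec_def[symmetric] del: atLeastAtMost_iff)

lemma ev_Nil_iff: "w \<in> Red \<Longrightarrow> ev w = [] \<longleftrightarrow> w = []"
  using letters_ev_Red[of w] by auto

text \<open>The blocks that distinguish \<open>A\<^sub>\<star>\<close> from its isolated version either read the value at the unit,
  which is \<open>0\<close> here, or write to the unit, where nothing is assumed.  So \<open>\<eta>\<close> is in the kernel of \<open>\<mu>\<close>
  minus the isolated operator.  All uniqueness statements about the Green function come from here.\<close>

lemma isolated_kernel_trivial:
  assumes \<mu>: "\<mu> \<notin> spectrum_on (ell2 C) (A_star_o q d a)"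
    and \<eta>: "\<eta> \<in> ell2 C" "\<eta> [] = 0"
    and eq: "\<And>w. w \<in> Red \<Longrightarrow> w \<noteq> [] \<Longrightarrow> \<mu> *s \<eta> (ev w) - A_star q d a \<eta> (ev w) = 0"
  shows "\<eta> x = 0"
proof -
  obtain R where R: "is_resolvent (ell2 C) (A_star_o q d a) \<mu> R"
    using \<mu> by (auto simp: spectrum_on_def)
  have fin: "finite unit_blocks"
    by (simp add: unit_blocks_def)
  note zb = zero_blocks_eq[OF bounded_rowsD(1)[OF bounded_rows_A_star] fin]
  have "\<mu> *s \<eta> x - A_star_o q d a \<eta> x = 0" for x
  proof -
    consider "x \<notin> C" | "x = []" | w where "w \<in> Red" "w \<noteq> []" "x = ev w"
    proof (cases "x \<in> C \<and> letters q x \<noteq> []")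
      case True
      then show thesis
        using that(3)[of "letters q x"] ev_letters[of x] letters_Red[of x] by simp
    next
      case False
      then show thesis
        using that(1,2) ev_letters[of x] by (cases "x \<in> C") auto
    qed
    then show ?thesis
    proof cases
      case 1
      then show ?thesis
        by (simp add: A_star_o_eq zb A_star_outside ell2_outside[OF \<eta>(1)])
    next
      case 2
      have "([], gen (st i)) \<in> unit_blocks" if "i \<in> {1..d}" for i
        using st_closed[OF that] by (auto simp: unit_blocks_def one_eq)
      then have "A_star_o q d a \<eta> [] = 0"
        using A_star_ev[of "[]" a] \<eta>(2) st_closed
        by (simp add: A_star_o_eq zb push_def del: atLeastAtMost_iff)
      then show ?thesis using 2 \<eta>(2) by simp
    next
      case 3
      have "x \<noteq> []"
        using 3 ev_Nil_iff[OF 3(1)] by simp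
      then have "z = []" if "(x, z) \<in> unit_blocks" for z
        using that by (auto simp: unit_blocks_def one_eq)
      then have "(\<lambda>z. if (x, z) \<in> unit_blocks then 0 else \<eta> z) = \<eta>"
        using \<eta>(2) by (intro ext) (metis (full_types))
      then show ?thesis
        using eq[OF 3(1,2)] 3(3) by (simp add: A_star_o_eq zb)
    qed
  qed
  then have "\<eta> = (\<lambda>x. 0)"
    by (rule resolvent_kernel_trivial[OF R \<eta>(1)])
  then show ?thesis by simp
qed

end

locale green = free_prod q d for q d :: nat +
  fixes a :: "nat \<Rightarrow> complex^'r^'r" and \<mu> :: complex
  assumes \<mu>: "\<mu> \<notin> hat_spectrum q d a"
begin

definition green :: "(nat \<times> int) list \<Rightarrow> complex^'r^'r"
  where "green x = block (resolvent_on (ell2 C) (A_star q d a) \<mu>) x []"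

abbreviation "g \<equiv> green []"
abbreviation "g' \<equiv> matrix_inv g"
abbreviation "b \<equiv> a_hat q d a \<mu>"

lemma b_eq: "b i = g' ** green (gen i)"
  by (simp add: a_hat_def green_def one_eq Let_def)

lemma green_column:
  shows green_ell2: "(\<lambda>x. green x *v v) \<in> ell2 C"
    and green_eq: "\<mu> *s (green x *v v) - A_star q d a (\<lambda>x. green x *v v) x = (if x = [] then v else 0)"
proof -
  define R where "R = resolvent_on (ell2 C) (A_star q d a) \<mu>"
  have "\<exists>R. is_resolvent (ell2 C) (A_star q d a) \<mu> R"
    using \<mu> by (auto simp: hat_spectrum_def spectrum_on_def)
  then have R: "is_resolvent (ell2 C) (A_star q d a) \<mu> R"
    unfolding R_def resolvent_on_def by (rule someI_ex)
  define \<delta> :: "'r \<Rightarrow> (nat \<times> int) list \<Rightarrow> complex^'r"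
    where "\<delta> l = (\<lambda>z. if z = [] then axis l 1 else 0)" for l
  have \<delta>: "\<delta> l \<in> ell2 C" for l
    by (rule ell2I(1)[of _ _ 1])
      (auto simp: \<delta>_def L2_set_def if_distrib[of norm] if_distrib[of "\<lambda>x. x ^ 2"] sum.If_cases
        Int_def cong: if_cong conj_cong)
  have col: "green x *v v = (\<Sum>l\<in>UNIV. v $ l *s R (\<delta> l) x)" for x v
    unfolding green_def R_def[symmetric] block_def \<delta>_def[symmetric]
    by (simp add: vec_eq_iff matrix_vector_mult_def mult.commute)
  have R\<delta>: "R (\<delta> l) \<in> ell2 C" for l
    using R \<delta> by (auto simp: is_resolvent_def bounded_op_on_def)
  show "(\<lambda>x. green x *v v) \<in> ell2 C"
    unfolding col by (intro ell2_sum(1) ell2_smult(1) R\<delta>) auto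
  have R_right: "\<mu> *s R (\<delta> l) x - A_star q d a (R (\<delta> l)) x = \<delta> l x" for l x
  proof -
    have "(\<lambda>x. \<mu> *s R (\<delta> l) x - A_star q d a (R (\<delta> l)) x) = \<delta> l"
      using R \<delta> by (auto simp: is_resolvent_def)
    from fun_cong[OF this, of x] show ?thesis .
  qed
  have fr: "finite_rows (A_star q d a)"
    by (rule bounded_rowsD(1)[OF bounded_rows_A_star])
  have "(\<Sum>l\<in>UNIV. v $ l *s \<delta> l x) =
      (\<Sum>l\<in>UNIV. v $ l *s (\<mu> *s R (\<delta> l) x - A_star q d a (R (\<delta> l)) x))"
    by (simp only: R_right)
  then have "\<mu> *s (green x *v v) - A_star q d a (\<lambda>x. green x *v v) x = (\<Sum>l\<in>UNIV. v $ l *s \<delta> l x)"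
    unfolding col finite_rows_sum[OF fr finite] finite_rows_homogeneous[OF fr]
    by (simp add: vector_scalar_mult_sum vector_scalar_mult_diff sum_subtractf vector_smult_assoc
        mult.commute)
  also have "\<dots> = (if x = [] then v else 0)"
    by (auto simp: \<delta>_def vec_eq_iff axis_def if_distrib[of "\<lambda>x. _ * x"] cong: if_cong)
  finally show "\<mu> *s (green x *v v) - A_star q d a (\<lambda>x. green x *v v) x = (if x = [] then v else 0)" .
qed

lemma green_eq_ev:
  assumes "w \<in> Red"
  shows "\<mu> *s (green (ev w) *v v) - (a 0 *v (green (ev w) *v v) +
      (\<Sum>i\<in>{1..d}. a i *v (green (ev (push q (st i) w)) *v v))) = (if w = [] then v else 0)"
  using green_eq[of "ev w" v] unfolding A_star_ev[OF assms] ev_Nil_iff[OF assms] .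

text \<open>A vector in the kernel of \<open>g\<close> gives a column of the Green function that vanishes at the unit.\<close>

lemma g_injective:
  assumes "g *v v = 0"
  shows "v = 0"
proof -
  have \<mu>o: "\<mu> \<notin> spectrum_on (ell2 C) (A_star_o q d a)"
    using \<mu> by (simp add: hat_spectrum_def)
  have "green x *v v = 0" for x
  proof (rule isolated_kernel_trivial[OF \<mu>o green_ell2])
    show "\<mu> *s (green (ev w) *v v) - A_star q d a (\<lambda>x. green x *v v) (ev w) = 0"
      if "w \<in> Red" "w \<noteq> []" for w
      using green_eq[of "ev w" v] ev_Nil_iff[OF that(1)] that(2) by simp
  qed (rule assms)
  then show ?thesis
    using green_eq_ev[of "[]" v] by simp
qed

lemma g_inverse: "g ** g' = mat 1" "g' ** g = mat 1"
  by (rule injective_matrix_inverse, erule g_injective)+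

lemma push_append: "w \<noteq> [] \<Longrightarrow> push q k w @ [i] = push q k (w @ [i])"
  by (cases w) (auto simp: push_def)

text \<open>
  The vertex \<open>g\<^sub>i\<close> separates the vertices \<open>w g\<^sub>i\<close> from the unit, so the Green function factorises through it.  As
  functions of \<open>w\<close>, both sides of the identity satisfy the same equation away from the unit on the
  words \<open>w\<close> that do not end in \<open>i*\<close>, and they agree at the unit; there is no interaction with the
  remaining words except through the unit.
\<close>

lemma green_append:
  assumes i: "i \<in> {1..d}" and wi: "w @ [i] \<in> Red"
  shows "green (ev (w @ [i])) *v v = green (ev w) *v (b i *v v)"
proof -
  define P where "P = {x \<in> C. letters q x @ [i] \<in> Red}"
  \<comment> \<open>the difference of the two sides, cut off to the words that do not end in \<open>i*\<close>\<close>
  define \<eta> where "\<eta> x = (if x \<in> P then green x *v (b i *v v) else 0) -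
      (if x \<in> P then green (ev (letters q x @ [i])) *v v else 0)" for x
  have red_prefix: "u \<in> Red" if "u @ [i] \<in> Red" for u
    using that by (simp add: reduced_append)
  have \<eta>_ev: "\<eta> (ev u) = (if u @ [i] \<in> Red
      then green (ev u) *v (b i *v v) - green (ev (u @ [i])) *v v else 0)" if "u \<in> Red" for u
    using that by (simp add: \<eta>_def P_def letters_ev_Red ev_Red_closed)
  have \<mu>o: "\<mu> \<notin> spectrum_on (ell2 C) (A_star_o q d a)"
    using \<mu> by (simp add: hat_spectrum_def)
  have i_red: "[i] \<in> Red"
    using i by (simp add: reduced_Cons)
  have \<eta>0: "\<eta> [] = 0"
    using \<eta>_ev[of "[]"] i i_red
    by (simp add: b_eq matrix_vector_mul_assoc matrix_mul_assoc g_inverse(1) del: atLeastAtMost_iff)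
  have "\<eta> x = 0" for x
  proof (rule isolated_kernel_trivial[where \<eta> = \<eta>, OF \<mu>o _ \<eta>0])
    have "inj_on (\<lambda>x. ev (letters q x @ [i])) P"
    proof (rule inj_onI)
      fix x y assume xy: "x \<in> P" "y \<in> P" "ev (letters q x @ [i]) = ev (letters q y @ [i])"
      have "letters q (ev (letters q x @ [i])) = letters q (ev (letters q y @ [i]))"
        by (simp only: xy(3))
      then have "letters q x = letters q y"
        using xy(1,2) unfolding P_def mem_Collect_eq by (simp only: letters_ev_Red append1_eq_conv)
      then have "ev (letters q x) = ev (letters q y)"
        by (rule arg_cong)
      then show "x = y"
        using xy(1,2) unfolding P_def mem_Collect_eq by (simp only: ev_letters)
    qed
    then show "\<eta> \<in> ell2 C"
      unfolding \<eta>_def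
      by (intro ell2_diff
          ell2_dominated(1)[OF green_ell2[of "b i *v v"], of 1 _ _ "\<lambda>x. x" P]
          ell2_dominated(1)[OF green_ell2[of v], of 1 _ _ "\<lambda>x. ev (letters q x @ [i])" P])
        (auto simp: P_def)
  next
    fix u assume u: "u \<in> Red" "u \<noteq> []"
    have push_red: "push q (st j) u \<in> Red" if "j \<in> {1..d}" for j
      using u st_closed[OF that] by (intro push_reduced)
    show "\<mu> *s \<eta> (ev u) - A_star q d a \<eta> (ev u) = 0"
    proof (cases "u @ [i] \<in> Red")
      case True
      have "\<eta> (ev (push q (st j) u)) = green (ev (push q (st j) u)) *v (b i *v v) -
          green (ev (push q (st j) (u @ [i]))) *v v" if "j \<in> {1..d}" for j
      proof -
        have "push q (st j) u @ [i] \<in> Red"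
          unfolding push_append[OF u(2)] using True st_closed[OF that] by (intro push_reduced)
        then show ?thesis
          using push_append[OF u(2)] by (simp add: \<eta>_ev push_red[OF that])
      qed
      then have "\<mu> *s \<eta> (ev u) - A_star q d a \<eta> (ev u) =
          (\<mu> *s (green (ev u) *v (b i *v v)) - (a 0 *v (green (ev u) *v (b i *v v)) +
            (\<Sum>j\<in>{1..d}. a j *v (green (ev (push q (st j) u)) *v (b i *v v))))) -
          (\<mu> *s (green (ev (u @ [i])) *v v) - (a 0 *v (green (ev (u @ [i])) *v v) +
            (\<Sum>j\<in>{1..d}. a j *v (green (ev (push q (st j) (u @ [i]))) *v v))))"
        using True
        by (simp add: A_star_ev[OF u(1)] \<eta>_ev u(1) vector_scalar_mult_diff
            matrix_vector_mult_diff_distrib sum_subtractf)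
      also have "\<dots> = 0"
        unfolding green_eq_ev[OF u(1)] green_eq_ev[OF True] using u(2) by simp
      finally show ?thesis .
    next
      case False
      have "\<eta> (ev (push q (st j) u)) = 0" if j: "j \<in> {1..d}" for j
      proof (cases "push q (st j) u = []")
        case True
        then show ?thesis using \<eta>0 by simp
      next
        case ne: False
        have "push q (st j) u @ [i] \<notin> Red"
        proof
          assume "push q (st j) u @ [i] \<in> Red"
          then have "push q j (push q (st j) u @ [i]) \<in> Red"
            using j by (rule push_reduced)
          moreover have "push q j (push q (st j) u) = u"
            using push_conj[OF u(1), of "st j"] by simp
          ultimately show False
            using False push_append[OF ne, of j i] by simp
        qed
        then show ?thesis by (simp add: \<eta>_ev[OF push_red[OF j]])
      qed
      then show ?thesis
        using False by (simp add: A_star_ev[OF u(1)] \<eta>_ev[OF u(1)])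
    qed
  qed
  from this[of "ev w"] show ?thesis
    using wi by (simp add: \<eta>_ev[OF red_prefix[OF wi]])
qed

definition path_weight :: "nat list \<Rightarrow> complex^'r^'r"
  where "path_weight w = foldr (\<lambda>i m. b i ** m) w (mat 1)"

lemma path_weight_simps [simp]:
  "path_weight [] = mat 1" "path_weight (i # w) = b i ** path_weight w"
  by (simp_all add: path_weight_def)

lemma path_weight_append: "path_weight (v @ w) = path_weight v ** path_weight w"
  by (induction v) (auto simp: matrix_mul_assoc)

lemma green_path_weight: "w \<in> Red \<Longrightarrow> green (ev w) *v v = g *v (path_weight w *v v)"
proof (induction w arbitrary: v rule: rev_induct)
  case (snoc i w)
  have "w \<in> Red" "i \<in> {1..d}"
    using snoc.prems by (simp_all add: reduced_append reduced_Cons)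
  then show ?case
    using green_append[OF _ snoc.prems, of v] snoc.IH[of "b i *v v"]
    by (simp add: path_weight_append matrix_vector_mul_assoc del: atLeastAtMost_iff)
qed simp

text \<open>Up to the invertible factor \<open>g\<close> the path weights are the blocks of one column of the Green function.\<close>

lemma path_weight_square_summable:
  obtains D where "\<And>F. finite F \<Longrightarrow> F \<subseteq> Red \<Longrightarrow> (\<Sum>w\<in>F. (norm (path_weight w))\<^sup>2) \<le> D"
proof -
  define D where "D = (norm g')\<^sup>2 * (\<Sum>l\<in>UNIV. (ell2_norm (\<lambda>x. green x *v axis l 1))\<^sup>2)"
  have "(\<Sum>w\<in>F. (norm (path_weight w))\<^sup>2) \<le> D" if F: "finite F" "F \<subseteq> Red" for F
  proof -
    have "(norm (path_weight w))\<^sup>2 \<le> (norm g')\<^sup>2 * (\<Sum>l\<in>UNIV. (norm (green (ev w) *v axis l 1))\<^sup>2)"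
      if "w \<in> F" for w
    proof -
      have "path_weight w *v v = g' *v (green (ev w) *v v)" for v
      proof -
        have "w \<in> Red" using F(2) that by blast
        then have "g' *v (green (ev w) *v v) = g' *v (g *v (path_weight w *v v))"
          by (simp only: green_path_weight)
        also have "\<dots> = path_weight w *v v"
          by (simp only: matrix_vector_mul_assoc[of g' g] g_inverse(2) matrix_vector_mul_lid)
        finally show ?thesis ..
      qed
      then have "path_weight w = g' ** green (ev w)"
        by (simp add: matrix_eq matrix_vector_mul_assoc)
      then have "norm (path_weight w) \<le> norm g' * norm (green (ev w))"
        by (simp add: norm_matrix_matrix_mult_le)
      then have "(norm (path_weight w))\<^sup>2 \<le> (norm g' * norm (green (ev w)))\<^sup>2"
        by (intro power_mono) auto
      then show ?thesis
        by (simp add: power_mult_distrib norm_matrix_sq_columns)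
    qed
    then have "(\<Sum>w\<in>F. (norm (path_weight w))\<^sup>2) \<le>
        (\<Sum>w\<in>F. (norm g')\<^sup>2 * (\<Sum>l\<in>UNIV. (norm (green (ev w) *v axis l 1))\<^sup>2))"
      by (rule sum_mono)
    also have "\<dots> = (norm g')\<^sup>2 * (\<Sum>l\<in>UNIV. \<Sum>w\<in>F. (norm (green (ev w) *v axis l 1))\<^sup>2)"
      by (simp add: sum_distrib_left[symmetric] sum.swap[of _ UNIV])
    also have "\<dots> \<le> D"
      unfolding D_def
    proof (intro mult_left_mono sum_mono)
      fix l
      have "inj_on ev F"
        using ev_bij F(2) by (auto simp: bij_betw_def intro: inj_on_subset)
      then have "(\<Sum>w\<in>F. (norm (green (ev w) *v axis l 1))\<^sup>2) =
          (\<Sum>x\<in>ev ` F. (norm (green x *v axis l 1))\<^sup>2)"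
        by (simp add: sum.reindex)
      also have "\<dots> \<le> (ell2_norm (\<lambda>x. green x *v axis l 1))\<^sup>2"
        using F(1) by (intro sum_norm_sq_le_ell2_norm[OF green_ell2]) auto
      finally show "(\<Sum>w\<in>F. (norm (green (ev w) *v axis l 1))\<^sup>2)
          \<le> (ell2_norm (\<lambda>x. green x *v axis l 1))\<^sup>2" .
    qed auto
    finally show ?thesis .
  qed
  then show thesis using that by blast
qed

definition backtrack_inv :: "nat \<Rightarrow> complex^'r^'r"
  where "backtrack_inv i = matrix_inv (mat 1 - b (st i) ** b i)"

lemma unit_equation:
  "\<mu> *s (g *v v) - a 0 *v (g *v v) = v + (\<Sum>i\<in>{1..d}. a i *v (g *v (b (st i) *v v)))"
proof -
  have "green (ev (push q (st i) [])) *v v = g *v (b (st i) *v v)" if "i \<in> {1..d}" for i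
    using green_path_weight[of "[st i]" v] st_closed[OF that]
    by (simp add: push_def reduced_Cons)
  then show ?thesis
    using green_eq_ev[of "[]" v] by (simp add: algebra_simps)
qed

text \<open>By the factorisation, the equation of the Green function at \<open>g\<^sub>j\<close> agrees with the one at the unit,
  applied to \<open>b j *v v\<close>, except for the terms along the edge between the two vertices and the
  inhomogeneity.\<close>

lemma edge_equation:
  assumes j: "j \<in> {1..d}"
  shows "a j *v (g *v v) = b j *v v + a j *v (g *v (b (st j) *v (b j *v v)))"
proof -
  have j_red: "[j] \<in> Red" using j by (simp add: reduced_Cons)
  have "green (ev (push q (st i) [j])) *v v =
      (if i = j then g *v v else g *v (b (st i) *v (b j *v v)))" if "i \<in> {1..d}" for i
  proof (cases "i = j")
    case True
    then show ?thesis by (simp add: push_def)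
  next
    case False
    then have "push q (st i) [j] = [st i, j]" "[st i, j] \<in> Red"
      using j st_closed[OF that] by (auto simp: push_def reduced_Cons)
    then show ?thesis
      using green_path_weight[of "[st i, j]" v] False by (simp add: matrix_vector_mul_assoc)
  qed
  then have "(\<Sum>i\<in>{1..d}. a i *v (green (ev (push q (st i) [j])) *v v)) =
      (\<Sum>i\<in>{1..d}. a i *v (if i = j then g *v v else g *v (b (st i) *v (b j *v v))))"
    by (intro sum.cong) auto
  also have "\<dots> = a j *v (g *v v) + (\<Sum>i\<in>{1..d} - {j}. a i *v (g *v (b (st i) *v (b j *v v))))"
    using j by (subst sum.remove[of _ j]) auto
  finally have sum1: "(\<Sum>i\<in>{1..d}. a i *v (green (ev (push q (st i) [j])) *v v)) = \<dots>" .
  have sum2: "(\<Sum>i\<in>{1..d}. a i *v (g *v (b (st i) *v (b j *v v)))) =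
      a j *v (g *v (b (st j) *v (b j *v v))) + (\<Sum>i\<in>{1..d} - {j}. a i *v (g *v (b (st i) *v (b j *v v))))"
    using j by (subst sum.remove[of _ j]) auto
  have gj: "green (ev [j]) *v v = g *v (b j *v v)"
    using green_path_weight[OF j_red, of v] by simp
  have "\<mu> *s (g *v (b j *v v)) - a 0 *v (g *v (b j *v v)) =
      a j *v (g *v v) + (\<Sum>i\<in>{1..d} - {j}. a i *v (g *v (b (st i) *v (b j *v v))))"
    using green_eq_ev[OF j_red, of v] unfolding sum1 gj by (simp add: algebra_simps)
  then show ?thesis
    unfolding unit_equation[of "b j *v v"] sum2 by (simp add: algebra_simps)
qed

text \<open>If \<open>b\<^bsub>j*\<^esub> b\<^sub>j v = v\<close>, the edge equation gives \<open>b\<^sub>j v = 0\<close> and hence \<open>v = 0\<close>.\<close>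

lemma backtrack_inv:
  assumes j: "j \<in> {1..d}"
  shows "backtrack_inv j ** (mat 1 - b (st j) ** b j) = mat 1"
    and "(mat 1 - b (st j) ** b j) ** backtrack_inv j = mat 1"
proof -
  have "v = 0" if v: "(mat 1 - b (st j) ** b j) *v v = 0" for v
  proof -
    have bb: "b (st j) *v (b j *v v) = v"
      using v by (simp add: matrix_vector_mult_diff_rdistrib matrix_vector_mul_assoc)
    then have "b j *v v = 0"
      using edge_equation[OF j, of v] by simp
    then show "v = 0" using bb by simp
  qed
  then show "backtrack_inv j ** (mat 1 - b (st j) ** b j) = mat 1"
    "(mat 1 - b (st j) ** b j) ** backtrack_inv j = mat 1"
    unfolding backtrack_inv_def
    using injective_matrix_inverse[of "mat 1 - b (st j) ** b j"] by simp_all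
qed

lemma a_g_eq:
  assumes j: "j \<in> {1..d}"
  shows "a j ** g = b j ** backtrack_inv j"
proof -
  have "(a j ** g) *v u = (b j ** backtrack_inv j) *v u" for u
  proof -
    define v where "v = backtrack_inv j *v u"
    have "u = (mat 1 - b (st j) ** b j) *v v"
      unfolding v_def using backtrack_inv(2)[OF j] by (simp add: matrix_vector_mul_assoc)
    also have "\<dots> = v - b (st j) *v (b j *v v)"
      by (simp add: matrix_vector_mult_diff_rdistrib matrix_vector_mul_assoc)
    finally have "a j *v (g *v u) = b j *v v"
      using edge_equation[OF j, of v] by (simp add: matrix_vector_mult_diff_distrib)
    then show ?thesis by (simp add: v_def matrix_vector_mul_assoc)
  qed
  then show ?thesis by (simp add: matrix_eq)
qed

lemma a0_g_eq:
  "\<mu> *s (g *v v) - a 0 *v (g *v v) = v + (\<Sum>i\<in>{1..d}. b i *v (backtrack_inv i *v (b (st i) *v v)))"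
proof -
  have "a i *v (g *v u) = b i *v (backtrack_inv i *v u)" if "i \<in> {1..d}" for i u
    using a_g_eq[OF that] by (simp add: matrix_vector_mul_assoc)
  then show ?thesis
    unfolding unit_equation by simp
qed

end

section \<open>Exponential decay of path weights\<close>

lemma submultiplicative_exponential_bound:
  fixes f :: "nat \<Rightarrow> real"
  assumes nonneg: "\<And>n. 0 \<le> f n" and sub: "\<And>m n. f (m + n) \<le> f m * f n"
    and N: "0 < N" "f N < 1"
  obtains C \<kappa> where "1 \<le> C" "0 < \<kappa>" "\<kappa> < 1" "\<And>n. f n \<le> C * \<kappa> ^ n"
proof -
  \<comment> \<open>\<open>f N\<close> may vanish, but \<open>\<kappa>\<close> has to be positive\<close>
  define \<theta> where "\<theta> = max (f N) (1 / 2)"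
  have \<theta>: "0 < \<theta>" "\<theta> < 1" "f N \<le> \<theta>"
    using N(2) by (auto simp: \<theta>_def)
  define \<kappa> where "\<kappa> = root N \<theta>"
  have \<kappa>: "0 < \<kappa>" "\<kappa> < 1" "\<kappa> ^ N = \<theta>"
    using \<theta> N(1) by (simp_all add: \<kappa>_def)
  define S where "S = (\<Sum>r<N. f r)"
  have power: "f (N * k + r) \<le> \<theta> ^ k * f r" for k r
  proof (induction k)
    case (Suc k)
    have "f (N * Suc k + r) \<le> f N * f (N * k + r)"
      using sub[of N "N * k + r"] by (simp add: algebra_simps)
    also have "\<dots> \<le> \<theta> * (\<theta> ^ k * f r)"
      using Suc \<theta> nonneg by (intro mult_mono) auto
    finally show ?case by simp
  qed simp
  have bound: "f n \<le> (1 + S) / \<theta> * \<kappa> ^ n" for n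
  proof -
    have "f n \<le> \<theta> ^ (n div N) * f (n mod N)"
      using power[of "n div N" "n mod N"] by simp
    also have "\<dots> \<le> \<kappa> ^ n / \<theta> * (1 + S)"
    proof (rule mult_mono)
      have "f (n mod N) \<le> S"
        unfolding S_def using N(1) nonneg by (intro member_le_sum) auto
      then show "f (n mod N) \<le> 1 + S" by simp
      have "n \<le> N * (n div N) + N"
        using mod_less_divisor[OF N(1), of n] mult_div_mod_eq[of N n] by linarith
      then have "\<kappa> ^ (N * (n div N) + N) \<le> \<kappa> ^ n"
        using \<kappa> by (intro power_decreasing) auto
      then show "\<theta> ^ (n div N) \<le> \<kappa> ^ n / \<theta>"
        using \<theta> by (simp add: power_add power_mult \<kappa>(3) field_simps)
    qed (use \<theta> \<kappa> nonneg in auto)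
    finally show ?thesis by (simp add: mult.commute)
  qed
  have "1 \<le> (1 + S) / \<theta>"
    using \<theta> nonneg by (simp add: S_def sum_nonneg add_increasing2 less_imp_le)
  then show thesis
    using that[OF _ \<kappa>(1,2) bound] by blast
qed

context green
begin

definition paths :: "nat \<Rightarrow> nat list set"
  where "paths n = {p \<in> Red. length p = n}"

definition weight_sq :: "nat \<Rightarrow> real"
  where "weight_sq n = (\<Sum>p\<in>paths n. (norm (path_weight p))\<^sup>2)"

lemma finite_paths [simp]: "finite (paths n)"
  by (rule finite_subset[OF _ finite_lists_length_eq[of "{1..d}" n]])
    (auto simp: paths_def reduced_def)

lemma weight_sq_nonneg [simp]: "0 \<le> weight_sq n"
  by (simp add: weight_sq_def sum_nonneg)

lemma weight_sq_submultiplicative: "weight_sq (m + n) \<le> weight_sq m * weight_sq n"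
proof -
  have split: "take m p \<in> paths m" "drop m p \<in> paths n" if "p \<in> paths (m + n)" for p
  proof -
    have "take m p @ drop m p \<in> Red"
      using that by (simp add: paths_def)
    then show "take m p \<in> paths m" "drop m p \<in> paths n"
      using that unfolding reduced_append by (simp_all add: paths_def)
  qed
  have "weight_sq (m + n) \<le>
      (\<Sum>p\<in>paths (m + n). (norm (path_weight (take m p)))\<^sup>2 * (norm (path_weight (drop m p)))\<^sup>2)"
    unfolding weight_sq_def
  proof (rule sum_mono)
    fix p
    have "norm (path_weight p) \<le> norm (path_weight (take m p)) * norm (path_weight (drop m p))"
      using norm_matrix_matrix_mult_le[of "path_weight (take m p)" "path_weight (drop m p)"]
      by (simp flip: path_weight_append)
    then have "(norm (path_weight p))\<^sup>2 \<le> (norm (path_weight (take m p)) * norm (path_weight (drop m p)))\<^sup>2"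
      by (intro power_mono) auto
    then show "(norm (path_weight p))\<^sup>2 \<le> (norm (path_weight (take m p)))\<^sup>2 * (norm (path_weight (drop m p)))\<^sup>2"
      by (simp add: power_mult_distrib)
  qed
  also have "\<dots> = (\<Sum>(u, v)\<in>(\<lambda>p. (take m p, drop m p)) ` paths (m + n).
      (norm (path_weight u))\<^sup>2 * (norm (path_weight v))\<^sup>2)"
  proof (subst sum.reindex)
    show "inj_on (\<lambda>p. (take m p, drop m p)) (paths (m + n))"
    proof (rule inj_onI)
      fix p p' :: "nat list"
      assume "(take m p, drop m p) = (take m p', drop m p')"
      then have "take m p @ drop m p = take m p' @ drop m p'" by simp
      then show "p = p'" by (simp only: append_take_drop_id)
    qed
  qed simp
  also have "\<dots> \<le> (\<Sum>(u, v)\<in>paths m \<times> paths n. (norm (path_weight u))\<^sup>2 * (norm (path_weight v))\<^sup>2)"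
    using split by (intro sum_mono2) auto
  also have "\<dots> = weight_sq m * weight_sq n"
    unfolding weight_sq_def by (simp add: sum_product sum.cartesian_product)
  finally show ?thesis .
qed

text \<open>The weights \<open>weight_sq n\<close> are summable, because the columns of the Green function are square
  summable; being submultiplicative, they therefore decay exponentially.\<close>

lemma weight_sq_exponential:
  obtains C \<kappa> where "1 \<le> C" "0 < \<kappa>" "\<kappa> < 1" "\<And>n. weight_sq n \<le> C * \<kappa> ^ n"
proof -
  obtain D where D: "\<And>F. finite F \<Longrightarrow> F \<subseteq> Red \<Longrightarrow> (\<Sum>w\<in>F. (norm (path_weight w))\<^sup>2) \<le> D"
    using path_weight_square_summable by blast
  have partial: "(\<Sum>n<K. weight_sq (Suc n)) \<le> D" for K
  proof -
    have "(\<Sum>n<K. weight_sq (Suc n)) = (\<Sum>w\<in>(\<Union>n<K. paths (Suc n)). (norm (path_weight w))\<^sup>2)"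
      unfolding weight_sq_def by (rule sum.UNION_disjoint[symmetric])
        (use finite_paths in \<open>auto simp: paths_def\<close>)
    also have "\<dots> \<le> D"
    proof (rule D)
      show "finite (\<Union>n<K. paths (Suc n))" by simp
    qed (auto simp: paths_def)
    finally show ?thesis .
  qed
  have "\<exists>n. weight_sq (Suc n) < 1"
  proof (rule ccontr)
    assume "\<nexists>n. weight_sq (Suc n) < 1"
    then have ge: "1 \<le> weight_sq (Suc n)" for n by (simp add: not_less)
    have "real K \<le> D" for K
    proof -
      have "real K = (\<Sum>n<K. 1)" by simp
      also have "\<dots> \<le> (\<Sum>n<K. weight_sq (Suc n))"
        by (intro sum_mono ge)
      finally show ?thesis
        using partial[of K] by linarith
    qed
    moreover obtain K where "D < real K" using reals_Archimedean2 by blast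
    ultimately show False by (meson not_less)
  qed
  then obtain n where "weight_sq (Suc n) < 1" by blast
  then show thesis
    using submultiplicative_exponential_bound[of weight_sq "Suc n"] weight_sq_submultiplicative that
    by auto
qed

end

section \<open>Block triangular operators\<close>

definition cutoff :: "('x \<Rightarrow> bool) \<Rightarrow> ('x \<Rightarrow> complex^'r) \<Rightarrow> ('x \<Rightarrow> complex^'r)"
  where "cutoff Q f = (\<lambda>x. if Q x then f x else 0)"

lemma cutoff_idem: "cutoff Q (cutoff Q f) = cutoff Q f"
  by (auto simp: cutoff_def)

lemma ell2_cutoff:
  assumes "f \<in> ell2 X"
  shows "cutoff Q f \<in> ell2 X" "ell2_norm (cutoff Q f) \<le> ell2_norm f"
  using ell2_dominated[OF assms, of 1 X "cutoff Q f" "\<lambda>x. x" UNIV]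
  by (auto simp: cutoff_def ell2_outside[OF assms])

lemma bounded_rows_cutoff:
  assumes "bounded_rows X T"
  shows "bounded_rows X (\<lambda>f. cutoff Q (T (cutoff Q' f)))"
proof -
  obtain C where C: "\<And>f. f \<in> ell2 X \<Longrightarrow> ell2_norm (T f) \<le> C * ell2_norm f" "0 \<le> C"
    using bounded_op_on_nonneg_bound assms unfolding bounded_rows_def by metis
  note TX = bounded_rowsD(2)[OF assms]
  show ?thesis
  proof (rule bounded_rowsI)
    obtain N K where T: "\<And>x. finite (N x)" "\<And>f x. T f x = (\<Sum>y\<in>N x. K x y *v f y)"
      using finite_rowsE[OF bounded_rowsD(1)[OF assms]] by blast
    show "finite_rows (\<lambda>f. cutoff Q (T (cutoff Q' f)))"
    proof (rule finite_rowsI[OF T(1)])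
      show "cutoff Q (T (cutoff Q' f)) x = (\<Sum>y\<in>N x. (if Q x \<and> Q' y then K x y else 0) *v f y)" for f x
        unfolding cutoff_def T(2) by (auto intro!: sum.cong)
    qed
    fix f :: "'a \<Rightarrow> complex^'b"
    assume f: "f \<in> ell2 X"
    show "cutoff Q (T (cutoff Q' f)) \<in> ell2 X"
      by (intro ell2_cutoff(1) TX f)
    have "ell2_norm (cutoff Q (T (cutoff Q' f))) \<le> ell2_norm (T (cutoff Q' f))"
      by (rule ell2_cutoff(2)[OF TX[OF ell2_cutoff(1)[OF f]]])
    also have "\<dots> \<le> C * ell2_norm (cutoff Q' f)"
      by (rule C(1)[OF ell2_cutoff(1)[OF f]])
    also have "\<dots> \<le> C * ell2_norm f"
      by (intro mult_left_mono ell2_cutoff(2)[OF f] C)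
    finally show "ell2_norm (cutoff Q (T (cutoff Q' f))) \<le> C * ell2_norm f" .
  qed
qed

lemma bounded_op_on_cutoff: "bounded_op_on (ell2 X) (cutoff Q)"
  unfolding bounded_op_on_def
  using ell2_cutoff(2)[of _ X Q] ell2_cutoff(1)[of _ X Q]
  by (auto simp: cutoff_def fun_eq_iff intro!: exI[of _ 1])

lemma bounded_op_on_comp:
  assumes "bounded_op_on H S" "bounded_op_on H T"
  shows "bounded_op_on H (\<lambda>f. S (T f))"
proof -
  obtain C where C: "0 \<le> C" "\<And>f. f \<in> H \<Longrightarrow> ell2_norm (S f) \<le> C * ell2_norm f"
    using bounded_op_on_nonneg_bound[OF assms(1)] by blast
  obtain D where D: "\<And>f. f \<in> H \<Longrightarrow> ell2_norm (T f) \<le> D * ell2_norm f"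
    using bounded_op_on_nonneg_bound[OF assms(2)] by blast
  have TH: "T f \<in> H" if "f \<in> H" for f
    using assms(2) that by (auto simp: bounded_op_on_def)
  have "ell2_norm (S (T f)) \<le> (C * D) * ell2_norm f" if "f \<in> H" for f
    using order_trans[OF C(2)[OF TH[OF that]] mult_left_mono[OF D[OF that] C(1)]]
    by (simp add: mult.assoc)
  moreover have "S (T f) \<in> H" if "f \<in> H" for f
    using assms(1) TH[OF that] by (auto simp: bounded_op_on_def)
  moreover have "S (T (\<lambda>x. f x + g x)) = (\<lambda>x. S (T f) x + S (T g) x)" if "f \<in> H" "g \<in> H" for f g
    using assms that TH[OF that(1)] TH[OF that(2)] by (simp add: bounded_op_on_def)
  moreover have "S (T (\<lambda>x. c *s f x)) = (\<lambda>x. c *s S (T f) x)" if "f \<in> H" for f c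
    using assms that TH[OF that] by (simp add: bounded_op_on_def)
  ultimately show ?thesis
    unfolding bounded_op_on_def by blast
qed

lemma bounded_op_on_add:
  assumes "bounded_op_on (ell2 X) S" "bounded_op_on (ell2 X) T"
  shows "bounded_op_on (ell2 X) (\<lambda>f x. S f x + T f x)"
proof -
  obtain C where C: "\<And>f. f \<in> ell2 X \<Longrightarrow> ell2_norm (S f) \<le> C * ell2_norm f"
    using bounded_op_on_nonneg_bound[OF assms(1)] by blast
  obtain D where D: "\<And>f. f \<in> ell2 X \<Longrightarrow> ell2_norm (T f) \<le> D * ell2_norm f"
    using bounded_op_on_nonneg_bound[OF assms(2)] by blast
  have mem: "S f \<in> ell2 X" "T f \<in> ell2 X" if "f \<in> ell2 X" for f
    using assms that by (auto simp: bounded_op_on_def)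
  have "ell2_norm (\<lambda>x. S f x + T f x) \<le> (C + D) * ell2_norm f" if "f \<in> ell2 X" for f
    using ell2_add(2)[OF mem[OF that]] C[OF that] D[OF that] by (simp add: algebra_simps)
  moreover have "(\<lambda>x. S f x + T f x) \<in> ell2 X" if "f \<in> ell2 X" for f
    by (rule ell2_add(1)[OF mem[OF that]])
  moreover have "(\<lambda>x. S (\<lambda>x. f x + g x) x + T (\<lambda>x. f x + g x) x) =
      (\<lambda>x. (S f x + T f x) + (S g x + T g x))" if "f \<in> ell2 X" "g \<in> ell2 X" for f g
  proof -
    have "S (\<lambda>x. f x + g x) = (\<lambda>x. S f x + S g x)" "T (\<lambda>x. f x + g x) = (\<lambda>x. T f x + T g x)"
      using assms that unfolding bounded_op_on_def by blast+
    then show ?thesis by (simp add: add_ac)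
  qed
  moreover have "(\<lambda>x. S (\<lambda>x. c *s f x) x + T (\<lambda>x. c *s f x) x) =
      (\<lambda>x. c *s (S f x + T f x))" if "f \<in> ell2 X" for f c
  proof -
    have "S (\<lambda>x. c *s f x) = (\<lambda>x. c *s S f x)" "T (\<lambda>x. c *s f x) = (\<lambda>x. c *s T f x)"
      using assms that unfolding bounded_op_on_def by blast+
    then show ?thesis by (simp add: vector_scalar_mult_add)
  qed
  ultimately show ?thesis
    unfolding bounded_op_on_def by blast
qed

text \<open>The solution of \<open>(z - B) f = h\<close> by back substitution: first on the complement of \<open>Q\<close>, where
  \<open>B\<close> does not see the values on \<open>Q\<close>, then on \<open>Q\<close>.\<close>

lemma block_triangular_resolvent:
  fixes B :: "('x \<Rightarrow> complex^'r) \<Rightarrow> ('x \<Rightarrow> complex^'r)"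
  assumes B: "bounded_rows X B" and z: "z \<noteq> 0"
    and tri: "\<And>f x. \<not> Q x \<Longrightarrow> B (cutoff Q f) x = 0"
    and R1: "is_resolvent (ell2 X) (\<lambda>f. cutoff Q (B (cutoff Q f))) z R1"
    and R2: "is_resolvent (ell2 X) (\<lambda>f. cutoff (\<lambda>x. \<not> Q x) (B (cutoff (\<lambda>x. \<not> Q x) f))) z R2"
  shows "\<exists>R. is_resolvent (ell2 X) B z R"
proof -
  let ?N = "\<lambda>x. \<not> Q x"
  define u where "u h = R2 (cutoff ?N h)" for h
  define w where "w h = (\<lambda>x. cutoff Q h x + cutoff Q (B (u h)) x)" for h
  define R where "R h = (\<lambda>x. u h x + R1 (w h) x)" for h
  note fr = bounded_rowsD(1)[OF B]
  have Bb: "bounded_op_on (ell2 X) B" "bounded_op_on (ell2 X) R1" "bounded_op_on (ell2 X) R2"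
    using B R1 R2 by (auto simp: bounded_rows_def is_resolvent_def)
  have u: "bounded_op_on (ell2 X) u"
    unfolding u_def by (rule bounded_op_on_comp[OF Bb(3) bounded_op_on_cutoff])
  have w: "bounded_op_on (ell2 X) w"
    unfolding w_def
    by (rule bounded_op_on_add[OF bounded_op_on_cutoff
          bounded_op_on_comp[OF bounded_op_on_cutoff bounded_op_on_comp[OF Bb(1) u]]])
  have R: "bounded_op_on (ell2 X) R"
    unfolding R_def by (rule bounded_op_on_add[OF u bounded_op_on_comp[OF Bb(2) w]])
  have cutoff_split: "f = (\<lambda>x. cutoff Q f x + cutoff ?N f x)" for f :: "'x \<Rightarrow> complex^'r"
    by (auto simp: cutoff_def)
  have "is_resolvent (ell2 X) B z R"
  proof (rule resolventI[OF R fr bounded_rowsD(2)[OF B]])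
    fix h :: "'x \<Rightarrow> complex^'r"
    assume h: "h \<in> ell2 X"
    define v where "v = R1 (w h)"
    have wX: "w h \<in> ell2 X" using w h by (auto simp: bounded_op_on_def)
    have u_eq: "z *s u h x - cutoff ?N (B (cutoff ?N (u h))) x = cutoff ?N h x" for x
    proof -
      have "(\<lambda>x. z *s R2 k x - cutoff ?N (B (cutoff ?N (R2 k))) x) = k" if "k \<in> ell2 X" for k
        using R2 that by (auto simp: is_resolvent_def)
      from fun_cong[OF this[OF ell2_cutoff(1)[OF h]], of ?N x] show ?thesis
        by (simp add: u_def)
    qed
    have v_eq: "z *s v x - cutoff Q (B (cutoff Q v)) x = w h x" for x
    proof -
      have "(\<lambda>x. z *s R1 k x - cutoff Q (B (cutoff Q (R1 k))) x) = k" if "k \<in> ell2 X" for k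
        using R1 that by (auto simp: is_resolvent_def)
      from fun_cong[OF this[OF wX], of x] show ?thesis
        by (simp add: v_def)
    qed
    have u0: "u h x = 0" if "Q x" for x
      using u_eq[of x] that z by (simp add: cutoff_def)
    have v0: "v x = 0" if "\<not> Q x" for x
      using v_eq[of x] that z by (simp add: cutoff_def w_def)
    have u_cutoff: "cutoff ?N (u h) = u h" and v_cutoff: "cutoff Q v = v"
      using u0 v0 by (auto simp: cutoff_def)
    have "z *s R h x - B (R h) x = h x" for x
    proof (cases "Q x")
      case True
      then have "z *s v x - B v x = h x + B (u h) x"
        using v_eq[of x] by (simp add: v_cutoff) (simp add: cutoff_def w_def)
      then show ?thesis
        using True by (simp add: R_def v_def[symmetric] finite_rows_additive[OF fr]
            vector_scalar_mult_add u0 algebra_simps)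
    next
      case False
      then have "z *s u h x - B (u h) x = h x"
        using u_eq[of x] by (simp add: u_cutoff) (simp add: cutoff_def)
      moreover have "B v x = 0"
        using tri[OF False, of v] by (simp add: v_cutoff)
      ultimately show ?thesis
        using False by (simp add: R_def v_def[symmetric] finite_rows_additive[OF fr]
            vector_scalar_mult_add v0 algebra_simps)
    qed
    then show "(\<lambda>x. z *s R h x - B (R h) x) = h" by blast
  next
    fix f :: "'x \<Rightarrow> complex^'r"
    assume f: "f \<in> ell2 X" and eq: "\<And>x. z *s f x - B f x = 0"
    have Bf: "B f x = B (cutoff Q f) x + B (cutoff ?N f) x" for x
      using fun_cong[OF finite_rows_additive[OF fr, of "cutoff Q f" "cutoff ?N f"], of x]
      by (simp flip: cutoff_split)
    have "cutoff ?N f = (\<lambda>x. 0)"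
    proof (rule resolvent_kernel_trivial[OF R2 ell2_cutoff(1)[OF f]])
      show "z *s cutoff ?N f x - cutoff ?N (B (cutoff ?N (cutoff ?N f))) x = 0" for x
      proof (cases "Q x")
        case False
        then show ?thesis
          using eq[of x] tri[OF False, of f] Bf[of x]
          by (simp add: cutoff_idem) (simp add: cutoff_def)
      qed (simp add: cutoff_def)
    qed
    then have mf: "cutoff Q f = f"
      using cutoff_split[of f] by simp
    show "f = (\<lambda>x. 0)"
    proof (rule resolvent_kernel_trivial[OF R1 f])
      show "z *s f x - cutoff Q (B (cutoff Q f)) x = 0" for x
        unfolding mf using eq[of x] fun_cong[OF mf, of x] by (auto simp: cutoff_def split: if_splits)
    qed
  qed
  then show ?thesis by blast
qed

section \<open>Spectral radius of the non-backtracking operator on the free product\<close>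

context green
begin

text \<open>The edge \<open>(x, i)\<close> from \<open>g\<^sub>i\<inverse> x\<close> to \<open>x\<close> leads away from the unit iff \<open>x\<close> begins with \<open>i\<close>.\<close>

definition outward :: "(nat \<times> int) list \<times> nat \<Rightarrow> bool"
  where "outward = (\<lambda>(x, i). letters q x \<noteq> [] \<and> hd (letters q x) = i)"

abbreviation "B \<equiv> B_star q d a \<mu>"
abbreviation "B_out f \<equiv> cutoff outward (B (cutoff outward f))"
abbreviation "B_in f \<equiv> cutoff (\<lambda>p. \<not> outward p) (B (cutoff (\<lambda>p. \<not> outward p) f))"

lemma outward_ev: "w \<in> Red \<Longrightarrow> outward (ev w, i) \<longleftrightarrow> w \<noteq> [] \<and> hd w = i"
  by (simp add: outward_def letters_ev_Red)

lemma B_ev: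
  assumes "w \<in> Red" "i \<in> {1..d}"
  shows "B f (ev w, i) = (\<Sum>j | j \<in> {1..d} \<and> j \<noteq> st i. b j *v f (ev (push q (st i) w), j))"
proof -
  have "tensor_op (b j) (lambda_gen q d i) (\<lambda>y. f (y, j)) (ev w) =
      b j *v f (ev (push q (st i) w), j)" for j
    using lambda_gen_ev[OF assms(2,1)] by (simp add: tensor_op_def)
  then show ?thesis
    unfolding B_star_def nonbacktracking_op_def using assms(2) by simp
qed

lemma B_outside:
  assumes "x \<notin> C \<or> i \<notin> {1..d}"
  shows "B f (x, i) = 0"
proof (cases "i \<in> {1..d}")
  case True
  then have "tensor_op (b j) (lambda_gen q d i) (\<lambda>y. f (y, j)) x = 0" for j
    using assms by (simp add: tensor_op_def lambda_gen_eq zero_vec_def[symmetric] del: atLeastAtMost_iff)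
  then show ?thesis
    by (simp add: B_star_def nonbacktracking_op_def)
next
  case False
  then show ?thesis
    unfolding B_star_def by (rule nonbacktracking_op_outside)
qed

lemma push_inward: "w \<in> Red \<Longrightarrow> \<not> (w \<noteq> [] \<and> hd w = i) \<Longrightarrow> push q (st i) w = st i # w"
  by (auto simp: push_def)

text \<open>If \<open>(x, i)\<close> leads towards the unit, then \<open>g\<^sub>i\<inverse> x\<close> begins with \<open>i*\<close>, and the values of the argument that
  enter are those at \<open>(g\<^sub>i\<inverse> x, j)\<close> with \<open>j \<noteq> i*\<close>.\<close>

lemma B_triangular:
  assumes "\<not> outward p"
  shows "B (cutoff outward f) p = 0"
proof -
  obtain x i where p: "p = (x, i)" by fastforce
  show ?thesis
  proof (cases "x \<in> C \<and> i \<in> {1..d}")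
    case True
    define w where "w = letters q x"
    have w: "w \<in> Red" "x = ev w"
      using True by (simp_all add: w_def letters_Red ev_letters)
    have "\<not> (w \<noteq> [] \<and> hd w = i)"
      using assms outward_ev[OF w(1)] by (simp add: p w(2))
    then have push: "push q (st i) w = st i # w" "st i # w \<in> Red"
      using push_inward[OF w(1)] w(1) True st_closed[of i] by (auto simp: reduced_Cons)
    have "cutoff outward f (ev (st i # w), j) = 0" if "j \<noteq> st i" for j
      using outward_ev[OF push(2)] that by (auto simp: cutoff_def)
    then show ?thesis
      using B_ev[OF w(1), of i] True unfolding p w(2) push(1) by simp
  next
    case False
    then show ?thesis
      using B_outside by (simp add: p)
  qed
qed

definition steps :: "nat \<Rightarrow> nat \<Rightarrow> nat list set"
  where "steps n i = {p. length p = n \<and> i # p \<in> Red}"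

lemma steps_subset: "steps n i \<subseteq> paths n"
  by (auto simp: steps_def paths_def reduced_Cons)

lemma finite_steps [simp]: "finite (steps n i)"
  using finite_subset[OF steps_subset finite_paths] .

lemma sum_steps_Suc:
  assumes "i \<in> {1..d}"
  shows "(\<Sum>p\<in>steps (Suc n) i. F p) = (\<Sum>j | j \<in> {1..d} \<and> j \<noteq> st i. \<Sum>p\<in>steps n j. F (j # p))"
proof -
  have "steps (Suc n) i = (\<lambda>(j, p). j # p) ` (SIGMA j:{j. j \<in> {1..d} \<and> j \<noteq> st i}. steps n j)"
  proof (intro equalityI subsetI)
    fix p assume "p \<in> steps (Suc n) i"
    then obtain j u where "p = j # u" "length u = n" "i # j # u \<in> Red"
      unfolding steps_def by (cases p) auto
    then show "p \<in> (\<lambda>(j, p). j # p) ` (SIGMA j:{j. j \<in> {1..d} \<and> j \<noteq> st i}. steps n j)"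
      by (intro image_eqI[of _ _ "(j, u)"]) (auto simp: steps_def reduced_Cons)
  qed (use assms in \<open>auto simp: steps_def reduced_Cons\<close>)
  moreover have "inj_on (\<lambda>(j, p). j # p) (SIGMA j:{j. j \<in> {1..d} \<and> j \<noteq> st i}. steps n j)"
    by (auto simp: inj_on_def)
  ultimately have "(\<Sum>p\<in>steps (Suc n) i. F p) =
      (\<Sum>(j, p)\<in>(SIGMA j:{j. j \<in> {1..d} \<and> j \<noteq> st i}. steps n j). F (j # p))"
    by (simp add: sum.reindex case_prod_unfold)
  then show ?thesis
    by (simp add: sum.Sigma)
qed

text \<open>For an edge \<open>(w, i)\<close> towards the unit, \<open>B\<close> reads the values at \<open>(i* w, j)\<close>.  Iterating along \<open>p\<close>, each
  label is inverted and put in front of the word when the next one is chosen; the last letter of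
  \<open>i # p\<close> remains as the label of the edge that is read.\<close>

definition walk_word :: "nat \<Rightarrow> nat list \<Rightarrow> nat list \<Rightarrow> nat list"
  where "walk_word i p w = rev (map st (butlast (i # p))) @ w"

lemma walk_word_Cons: "walk_word i (j # p) w = walk_word j p (st i # w)"
  by (simp add: walk_word_def)

lemma walk_word_reduced:
  assumes "i # p \<in> Red" "w \<in> Red" "w = [] \<or> hd w \<noteq> i"
  shows "walk_word i p w \<in> Red"
  using assms
proof (induction p arbitrary: i w)
  case Nil
  then show ?case by (simp add: walk_word_def)
next
  case (Cons j p)
  have "st i # w \<in> Red"
    using Cons.prems st_closed[of i] by (simp add: reduced_Cons del: atLeastAtMost_iff)
  moreover have "j # p \<in> Red" "st i \<noteq> j"
    using Cons.prems by (auto simp: reduced_Cons)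
  ultimately show ?case
    unfolding walk_word_Cons by (intro Cons.IH) auto
qed

lemma st_eq_iff: "st i = st j \<longleftrightarrow> i = j"
  by (metis conj_idx_involution)

lemma walk_word_inj:
  assumes "length p = length p'" "walk_word i p w = walk_word i' p' w'" "last (i # p) = last (i' # p')"
  shows "w = w'" "i = i'" "p = p'"
proof -
  have "length (butlast (i # p)) = length (butlast (i' # p'))"
    by (simp only: length_butlast length_Cons assms(1))
  then have "w = w'" and eq: "map st (butlast (i # p)) = map st (butlast (i' # p'))"
    using assms(2) unfolding walk_word_def by (simp_all add: append_eq_append_conv del: butlast.simps)
  then show "w = w'" by simp
  have "inj st" by (rule injI) (simp add: st_eq_iff)
  then have "butlast (i # p) = butlast (i' # p')"
    using eq by (simp add: inj_map_eq_map del: butlast.simps)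
  then have "i # p = i' # p'"
    using assms(3) by (metis append_butlast_last_id list.distinct(1))
  then show "i = i'" "p = p'" by simp_all
qed

lemma B_in_power:
  assumes "w \<in> Red" "i \<in> {1..d}" "w = [] \<or> hd w \<noteq> i"
  shows "(B_in ^^ n) f (ev w, i) =
    (\<Sum>p\<in>steps n i. path_weight p *v f (ev (walk_word i p w), last (i # p)))"
  using assms
proof (induction n arbitrary: w i)
  case 0
  have "steps 0 i = {[]}" using 0 by (auto simp: steps_def reduced_Cons)
  then show ?case by (simp add: walk_word_def)
next
  case (Suc n)
  note w = Suc.prems
  have iw: "st i # w \<in> Red"
    using w st_closed[of i] by (simp add: reduced_Cons del: atLeastAtMost_iff)
  have inward: "\<not> outward (ev w, i)"
    using w outward_ev[OF w(1)] by auto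
  have inward': "\<not> outward (ev (st i # w), j)" if "j \<noteq> st i" for j
    using outward_ev[OF iw] that by auto
  have "(B_in ^^ Suc n) f (ev w, i) = B (cutoff (\<lambda>p. \<not> outward p) ((B_in ^^ n) f)) (ev w, i)"
    using inward by (simp add: cutoff_def[of _ "B _"])
  also have "\<dots> = (\<Sum>j | j \<in> {1..d} \<and> j \<noteq> st i.
      b j *v cutoff (\<lambda>p. \<not> outward p) ((B_in ^^ n) f) (ev (st i # w), j))"
    using w push_inward[OF w(1), of i] by (subst B_ev) auto
  also have "\<dots> = (\<Sum>j | j \<in> {1..d} \<and> j \<noteq> st i. b j *v (B_in ^^ n) f (ev (st i # w), j))"
    by (intro sum.cong refl) (simp add: cutoff_def[of _ "(_ ^^ _) _"] inward' del: word_elt_simps)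
  also have "\<dots> = (\<Sum>j | j \<in> {1..d} \<and> j \<noteq> st i. \<Sum>p\<in>steps n j.
      path_weight (j # p) *v f (ev (walk_word i (j # p) w), last (i # j # p)))"
  proof (intro sum.cong refl)
    fix j assume "j \<in> {j. j \<in> {1..d} \<and> j \<noteq> st i}"
    then have j: "j \<in> {1..d}" "st i \<noteq> j" by auto
    have "(B_in ^^ n) f (ev (st i # w), j) =
        (\<Sum>p\<in>steps n j. path_weight p *v f (ev (walk_word j p (st i # w)), last (j # p)))"
      using j by (intro Suc.IH iw) auto
    then show "b j *v (B_in ^^ n) f (ev (st i # w), j) = (\<Sum>p\<in>steps n j.
        path_weight (j # p) *v f (ev (walk_word i (j # p) w), last (i # j # p)))"
      by (simp add: matrix_vector_mult_sum matrix_vector_mul_assoc walk_word_Cons del: word_elt_simps)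
  qed
  also have "\<dots> = (\<Sum>p\<in>steps (Suc n) i. path_weight p *v f (ev (walk_word i p w), last (i # p)))"
    by (rule sum_steps_Suc[OF w(2), symmetric])
  finally show ?case .
qed

lemma cutoff_B_zero:
  assumes "x \<notin> C \<or> i \<notin> {1..d}"
  shows "cutoff Q (B f) (x, i) = 0"
  using B_outside[OF assms] by (simp add: cutoff_def)

text \<open>An edge is read by only one edge \<open>(w, i)\<close> and along only one path of length \<open>n\<close>.  So after the
  Cauchy-Schwarz inequality over the paths, no value of \<open>f\<close> is counted twice.\<close>

lemma B_in_power_bound:
  assumes f: "f \<in> ell2 (C \<times> {1..d})" and n: "0 < n"
  shows "ell2_norm ((B_in ^^ n) f) \<le> sqrt (weight_sq n) * ell2_norm f"
proof -
  let ?T = "(B_in ^^ n) f"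
  define D where "D = {(x, i). x \<in> C \<and> i \<in> {1..d} \<and> \<not> outward (x, i)}"
  define \<phi> where "\<phi> = (\<lambda>((x, i), p). (ev (walk_word i p (letters q x)), last (i # p)))"
  obtain m where m: "n = Suc m" using n by (cases n) auto
  have zero: "?T p = 0" if "p \<notin> D" for p
  proof -
    obtain x i where p: "p = (x, i)" by fastforce
    have "cutoff (\<lambda>p. \<not> outward p) (B h) (x, i) = 0" for h
    proof (cases "x \<in> C \<and> i \<in> {1..d}")
      case True
      then have "outward (x, i)" using that by (simp add: D_def p)
      then show ?thesis by (simp add: cutoff_def)
    next
      case False
      then show ?thesis by (intro cutoff_B_zero) blast
    qed
    then show ?thesis by (simp add: m p)
  qed
  have pt: "(norm (?T (x, i)))\<^sup>2 \<le> weight_sq n * (\<Sum>p\<in>steps n i. (norm (f (\<phi> ((x, i), p))))\<^sup>2)"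
    if "(x, i) \<in> D" for x i
  proof -
    define w where "w = letters q x"
    have w: "w \<in> Red" "x = ev w" "i \<in> {1..d}" "w = [] \<or> hd w \<noteq> i"
      using that by (auto simp: D_def w_def letters_Red ev_letters outward_def)
    have "norm (?T (x, i)) \<le> (\<Sum>p\<in>steps n i. norm (path_weight p) * norm (f (\<phi> ((x, i), p))))"
      unfolding w(2) B_in_power[OF w(1,3,4)]
      by (rule sum_norm_le) (simp add: \<phi>_def letters_ev_Red[OF w(1)] norm_matrix_vector_mult_le)
    also have "\<dots> \<le> L2_set (\<lambda>p. norm (path_weight p)) (steps n i) *
        L2_set (\<lambda>p. norm (f (\<phi> ((x, i), p)))) (steps n i)"
      using L2_set_mult_ineq[of "\<lambda>p. norm (path_weight p)" "\<lambda>p. norm (f (\<phi> ((x, i), p)))" "steps n i"]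
      by simp
    finally have "(norm (?T (x, i)))\<^sup>2 \<le> (L2_set (\<lambda>p. norm (path_weight p)) (steps n i) *
        L2_set (\<lambda>p. norm (f (\<phi> ((x, i), p)))) (steps n i))\<^sup>2"
      by (intro power_mono) auto
    also have "\<dots> = (\<Sum>p\<in>steps n i. (norm (path_weight p))\<^sup>2) *
        (\<Sum>p\<in>steps n i. (norm (f (\<phi> ((x, i), p))))\<^sup>2)"
      by (simp add: power_mult_distrib L2_set_def sum_nonneg)
    also have "\<dots> \<le> weight_sq n * (\<Sum>p\<in>steps n i. (norm (f (\<phi> ((x, i), p))))\<^sup>2)"
      unfolding weight_sq_def
      by (intro mult_right_mono sum_mono2 steps_subset) (auto simp: sum_nonneg)
    finally show ?thesis .
  qed
  have inj: "inj_on \<phi> (SIGMA p:D. steps n (snd p))"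
  proof (rule inj_onI)
    fix s t assume s: "s \<in> (SIGMA p:D. steps n (snd p))" and t: "t \<in> (SIGMA p:D. steps n (snd p))"
      and eq: "\<phi> s = \<phi> t"
    obtain x i p where s': "s = ((x, i), p)" by (metis prod.collapse)
    obtain y j r where t': "t = ((y, j), r)" by (metis prod.collapse)
    have red: "walk_word i p (letters q x) \<in> Red" "walk_word j r (letters q y) \<in> Red"
      using s t by (auto simp: s' t' D_def steps_def outward_def letters_Red intro!: walk_word_reduced)
    have "ev (walk_word i p (letters q x)) = ev (walk_word j r (letters q y))"
      and last: "last (i # p) = last (j # r)"
      using eq by (simp_all only: \<phi>_def s' t' case_prod_conv prod.inject)
    then have "letters q (ev (walk_word i p (letters q x))) = letters q (ev (walk_word j r (letters q y)))"
      by simp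
    then have words: "walk_word i p (letters q x) = walk_word j r (letters q y)"
      by (simp only: letters_ev_Red red)
    have "length p = length r" "x \<in> C" "y \<in> C"
      using s t by (auto simp: s' t' steps_def D_def)
    then have eqs: "letters q x = letters q y" "i = j" "p = r"
      using walk_word_inj[OF _ words last] by blast+
    have "ev (letters q x) = ev (letters q y)"
      by (simp only: eqs(1))
    then have "x = y"
      by (simp only: ev_letters \<open>x \<in> C\<close> \<open>y \<in> C\<close>)
    then show "s = t"
      using eqs(2,3) by (simp only: s' t')
  qed
  have "(\<Sum>p\<in>F. (norm (?T p))\<^sup>2) \<le> (sqrt (weight_sq n) * ell2_norm f)\<^sup>2" if F: "finite F" for F
  proof -
    have "(\<Sum>p\<in>F. (norm (?T p))\<^sup>2) = (\<Sum>p\<in>F \<inter> D. (norm (?T p))\<^sup>2)"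
      using F zero by (intro sum.mono_neutral_right) auto
    also have "\<dots> \<le> (\<Sum>p\<in>F \<inter> D. weight_sq n * (\<Sum>u\<in>steps n (snd p). (norm (f (\<phi> (p, u))))\<^sup>2))"
      by (rule sum_mono) (use pt in force)
    also have "\<dots> = weight_sq n * (\<Sum>s\<in>(SIGMA p:F \<inter> D. steps n (snd p)). (norm (f (\<phi> s)))\<^sup>2)"
      using F by (simp add: sum_distrib_left[symmetric] sum.Sigma case_prod_unfold)
    also have "(\<Sum>s\<in>(SIGMA p:F \<inter> D. steps n (snd p)). (norm (f (\<phi> s)))\<^sup>2) =
        (\<Sum>y\<in>\<phi> ` (SIGMA p:F \<inter> D. steps n (snd p)). (norm (f y))\<^sup>2)"
      by (subst sum.reindex[OF inj_on_subset[OF inj]]) auto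
    also have "\<dots> \<le> (ell2_norm f)\<^sup>2"
      using F by (intro sum_norm_sq_le_ell2_norm[OF f]) auto
    finally show ?thesis
      by (simp add: power_mult_distrib mult_left_mono)
  qed
  moreover have "?T p = 0" if "p \<notin> C \<times> {1..d}" for p
    using that by (intro zero) (auto simp: D_def)
  ultimately show ?thesis
    by (intro ell2I_sq(2)[of "C \<times> {1..d}"]) auto
qed

lemma B_out_power:
  assumes "w \<in> Red" "w \<noteq> []"
  shows "(B_out ^^ n) f (ev w, hd w) = (if n < length w
    then path_weight (take n (tl w)) *v f (ev (drop n w), w ! n) else 0)"
  using assms
proof (induction n arbitrary: w)
  case 0
  then show ?case by (simp add: hd_conv_nth)
next
  case (Suc n)
  obtain i v where w: "w = i # v" using Suc.prems(2) by (cases w) auto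
  have v: "v \<in> Red" "i \<in> {1..d}" "v = [] \<or> hd v \<noteq> st i"
    using Suc.prems(1) by (auto simp: w reduced_Cons)
  have out: "outward (ev w, i)"
    using outward_ev[OF Suc.prems(1)] by (simp add: w)
  have push: "push q (st i) w = v"
    by (simp add: w push_def)
  have "(B_out ^^ Suc n) f (ev w, i) = B (cutoff outward ((B_out ^^ n) f)) (ev w, i)"
    using out by (simp add: cutoff_def[of _ "B _"] del: word_elt_simps)
  also have "\<dots> = (\<Sum>j | j \<in> {1..d} \<and> j \<noteq> st i. b j *v cutoff outward ((B_out ^^ n) f) (ev v, j))"
    unfolding B_ev[OF Suc.prems(1) v(2)] push ..
  also have "\<dots> = (\<Sum>j | j \<in> {1..d} \<and> j \<noteq> st i.
      if v \<noteq> [] \<and> hd v = j then b j *v (B_out ^^ n) f (ev v, j) else 0)"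
    by (intro sum.cong refl) (simp add: cutoff_def[of _ "(_ ^^ _) _"] outward_ev[OF v(1)])
  also have "\<dots> = (if v \<noteq> [] then b (hd v) *v (B_out ^^ n) f (ev v, hd v) else 0)"
  proof (cases "v = []")
    case False
    then have "hd v \<in> {j. j \<in> {1..d} \<and> j \<noteq> st i}"
      using v by (cases v) (auto simp: reduced_Cons)
    then show ?thesis
      using False by (simp add: sum.delta' cong: conj_cong)
  qed simp
  also have "\<dots> = (if Suc n < length w
      then path_weight (take (Suc n) (tl w)) *v f (ev (drop (Suc n) w), w ! Suc n) else 0)"
    using Suc.IH[OF v(1)] by (cases v) (auto simp: w matrix_vector_mul_assoc simp del: word_elt_simps)
  finally show ?case by (simp add: w)
qed

text \<open>Here each value of the power has a single term.  The words \<open>w\<close> that read the same \<open>t = drop n w\<close>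
  differ by their first letter and by the path \<open>take n (tl w)\<close>; summing the squares of the weights
  over both gives the factor \<open>d * weight_sq n\<close>.\<close>

lemma B_out_power_bound:
  assumes f: "f \<in> ell2 (C \<times> {1..d})" and n: "0 < n"
  shows "ell2_norm ((B_out ^^ n) f) \<le> sqrt (real d * weight_sq n) * ell2_norm f"
proof -
  let ?T = "(B_out ^^ n) f"
  define W where "W = {w \<in> Red. n < length w}"
  define \<phi> where "\<phi> w = (ev w, hd w)" for w
  define \<psi> where "\<psi> w = (hd w, take n (tl w), drop n w)" for w :: "nat list"
  obtain m where m: "n = Suc m" using n by (cases n) auto
  have zero: "?T p = 0" if "p \<notin> \<phi> ` W" for p
  proof -
    obtain x i where p: "p = (x, i)" by fastforce
    show ?thesis
    proof (cases "x \<in> C \<and> i \<in> {1..d} \<and> outward (x, i)")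
      case True
      define w where "w = letters q x"
      have w: "w \<in> Red" "x = ev w" "w \<noteq> []" "hd w = i"
        using True by (auto simp: w_def letters_Red ev_letters outward_def)
      have "\<not> n < length w"
        using that w by (auto simp: p \<phi>_def W_def)
      then show ?thesis
        using B_out_power[OF w(1,3), of n f] by (simp add: p w(2,4))
    next
      case False
      then have "cutoff outward (B h) (x, i) = 0" for h
      proof (cases "outward (x, i)")
        case True
        then show ?thesis using False by (intro cutoff_B_zero) blast
      qed (simp add: cutoff_def)
      then show ?thesis by (simp add: m p)
    qed
  qed
  have \<phi>_inj: "inj_on \<phi> Red"
    using ev_bij by (auto simp: \<phi>_def inj_on_def bij_betw_def)
  have \<psi>_inj: "inj_on \<psi> W"
  proof (rule inj_onI)
    fix w w' assume *: "w \<in> W" "w' \<in> W" "\<psi> w = \<psi> w'"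
    obtain i v where w: "w = i # v" using *(1) by (cases w) (auto simp: W_def)
    obtain i' v' where w': "w' = i' # v'" using *(2) by (cases w') (auto simp: W_def)
    have eqs: "i = i'" "take n v = take n v'" "drop m v = drop m v'"
      using *(3) by (simp_all add: \<psi>_def w w' m)
    have "take m (take n v) @ drop m v = take m (take n v') @ drop m v'"
      by (simp only: eqs)
    then have "v = v'" by (simp add: m)
    then show "w = w'"
      by (simp add: w w' eqs(1))
  qed
  have \<psi>_mem: "\<psi> w \<in> {1..d} \<times> paths n \<times> (Red - {[]})" if wW: "w \<in> W" for w
  proof -
    obtain i v where w: "w = i # v" using wW by (cases w) (auto simp: W_def)
    have red: "i # v \<in> Red" "n \<le> length v" using wW by (auto simp: W_def w)
    then have "take n v @ drop n v \<in> Red" "take n w @ drop n w \<in> Red" "i \<in> {1..d}"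
      by (simp_all add: reduced_Cons w)
    then show ?thesis
      using red unfolding reduced_append by (auto simp: \<psi>_def w paths_def)
  qed
  have val: "(norm (?T (\<phi> w)))\<^sup>2 \<le>
      (case \<psi> w of (i, p, t) \<Rightarrow> (norm (path_weight p))\<^sup>2 * (norm (f (\<phi> t)))\<^sup>2)" if "w \<in> W" for w
  proof -
    have w: "w \<in> Red" "w \<noteq> []" "n < length w" using that by (auto simp: W_def)
    then have "norm (?T (\<phi> w)) \<le> norm (path_weight (take n (tl w))) * norm (f (\<phi> (drop n w)))"
      by (simp add: \<phi>_def B_out_power hd_drop_conv_nth norm_matrix_vector_mult_le)
    then have "(norm (?T (\<phi> w)))\<^sup>2 \<le> (norm (path_weight (take n (tl w))) * norm (f (\<phi> (drop n w))))\<^sup>2"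
      by (intro power_mono) auto
    then show ?thesis by (simp add: \<psi>_def power_mult_distrib)
  qed
  have "(\<Sum>p\<in>F. (norm (?T p))\<^sup>2) \<le> (sqrt (real d * weight_sq n) * ell2_norm f)\<^sup>2" if F: "finite F" for F
  proof -
    define V where "V = {w \<in> W. \<phi> w \<in> F}"
    have V: "inj_on \<phi> V" "V \<subseteq> W" "\<phi> ` V = F \<inter> \<phi> ` W"
      using inj_on_subset[OF \<phi>_inj, of V] by (auto simp: V_def W_def)
    then have Vfin: "finite V"
      using F finite_imageD[of \<phi> V] by auto
    define E where "E = drop n ` V"
    have E: "finite E" "E \<subseteq> Red"
      using Vfin \<psi>_mem V(2) by (auto simp: E_def \<psi>_def)
    have "(\<Sum>p\<in>F. (norm (?T p))\<^sup>2) = (\<Sum>p\<in>F \<inter> \<phi> ` W. (norm (?T p))\<^sup>2)"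
      using F zero by (intro sum.mono_neutral_right) auto
    also have "\<dots> = (\<Sum>w\<in>V. (norm (?T (\<phi> w)))\<^sup>2)"
      unfolding V(3)[symmetric] by (simp add: sum.reindex[OF V(1)])
    also have "\<dots> \<le> (\<Sum>w\<in>V. case \<psi> w of (i, p, t) \<Rightarrow> (norm (path_weight p))\<^sup>2 * (norm (f (\<phi> t)))\<^sup>2)"
      using V(2) by (intro sum_mono val) auto
    also have "\<dots> = (\<Sum>(i, p, t)\<in>\<psi> ` V. (norm (path_weight p))\<^sup>2 * (norm (f (\<phi> t)))\<^sup>2)"
      by (simp add: sum.reindex[OF inj_on_subset[OF \<psi>_inj V(2)]])
    also have "\<dots> \<le> (\<Sum>(i, p, t)\<in>{1..d} \<times> paths n \<times> E. (norm (path_weight p))\<^sup>2 * (norm (f (\<phi> t)))\<^sup>2)"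
      using \<psi>_mem V(2) E(1) by (intro sum_mono2) (auto simp: E_def \<psi>_def)
    also have "\<dots> = real d * (weight_sq n * (\<Sum>t\<in>E. (norm (f (\<phi> t)))\<^sup>2))"
      unfolding weight_sq_def
      by (simp add: sum.cartesian_product[symmetric] sum_product)
    also have "(\<Sum>t\<in>E. (norm (f (\<phi> t)))\<^sup>2) = (\<Sum>y\<in>\<phi> ` E. (norm (f y))\<^sup>2)"
      by (simp add: sum.reindex[OF inj_on_subset[OF \<phi>_inj E(2)]])
    also have "\<dots> \<le> (ell2_norm f)\<^sup>2"
      using E(1) by (intro sum_norm_sq_le_ell2_norm[OF f]) auto
    finally show ?thesis
      by (simp add: power_mult_distrib mult_left_mono)
  qed
  moreover have "?T p = 0" if "p \<notin> C \<times> {1..d}" for p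
  proof (rule zero)
    have "\<phi> w \<in> C \<times> {1..d}" if "w \<in> W" for w
      using that by (cases w) (auto simp: W_def \<phi>_def reduced_Cons ev_Red_closed simp del: word_elt_simps)
    then show "p \<notin> \<phi> ` W" using that by auto
  qed
  ultimately show ?thesis
    by (intro ell2I_sq(2)[of "C \<times> {1..d}"]) auto
qed

lemma geometric_resolvent:
  fixes T :: "('x \<Rightarrow> complex^'k) \<Rightarrow> ('x \<Rightarrow> complex^'k)"
  assumes T: "bounded_rows X T" and \<kappa>: "0 < \<kappa>" "\<kappa> < norm z" and c: "1 \<le> c"
    and bound: "\<And>n f. f \<in> ell2 X \<Longrightarrow> 0 < n \<Longrightarrow> ell2_norm ((T ^^ n) f) \<le> c * \<kappa> ^ n * ell2_norm f"
  obtains R where "is_resolvent (ell2 X) T z R"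
proof -
  have "ell2_norm ((T ^^ n) f) \<le> c * \<kappa> ^ n * ell2_norm f" if "f \<in> ell2 X" for n f
  proof (cases "n = 0")
    case True
    then show ?thesis using mult_right_mono[OF c, of "ell2_norm f"] by simp
  qed (use bound[OF that] in simp)
  moreover have "summable (\<lambda>n. c * \<kappa> ^ n / norm z ^ Suc n)"
  proof -
    have "summable (\<lambda>n. (\<kappa> / norm z) ^ n * (c / norm z))"
      using \<kappa> by (intro summable_mult2 summable_geometric) (auto simp: divide_less_eq)
    then show ?thesis by (simp add: power_divide mult_ac)
  qed
  moreover have "z \<noteq> 0" using \<kappa> by auto
  ultimately show thesis
    using neumann_resolvent[OF T, of z "\<lambda>n. c * \<kappa> ^ n"] that by blast
qed

lemma spec_radius_B_star_less_1: "spec_radius_on (ell2 (C \<times> {1..d})) B < 1"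
proof -
  obtain c \<kappa> where c: "1 \<le> c" "0 < \<kappa>" "\<kappa> < 1" "\<And>n. weight_sq n \<le> c * \<kappa> ^ n"
    using weight_sq_exponential by blast
  \<comment> \<open>one constant for both diagonal blocks: the factors are \<open>d\<close> for the outward and \<open>1\<close> for the inward block\<close>
  define c' where "c' = sqrt ((1 + real d) * c)"
  have c': "1 \<le> c'"
    unfolding c'_def using c(1) mult_mono[of 1 "1 + real d" 1 c] by (intro real_le_rsqrt) simp
  have root: "sqrt (e * weight_sq n) \<le> c' * sqrt \<kappa> ^ n" if "0 \<le> e" "e \<le> 1 + real d" for e n
  proof -
    have "e * weight_sq n \<le> (1 + real d) * (c * \<kappa> ^ n)"
      using that c(4)[of n] by (intro mult_mono) auto
    then have "sqrt (e * weight_sq n) \<le> sqrt ((1 + real d) * (c * \<kappa> ^ n))"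
      by (rule real_sqrt_le_mono)
    then show ?thesis
      by (simp add: c'_def real_sqrt_mult real_sqrt_power mult.assoc)
  qed
  have out: "ell2_norm ((B_out ^^ n) f) \<le> c' * sqrt \<kappa> ^ n * ell2_norm f"
    if "f \<in> ell2 (C \<times> {1..d})" "0 < n" for f n
    using order_trans[OF B_out_power_bound[OF that] mult_right_mono[OF root[of "real d" n]]] by simp
  have inw: "ell2_norm ((B_in ^^ n) f) \<le> c' * sqrt \<kappa> ^ n * ell2_norm f"
    if "f \<in> ell2 (C \<times> {1..d})" "0 < n" for f n
    using order_trans[OF B_in_power_bound[OF that], of "c' * sqrt \<kappa> ^ n * ell2_norm f"]
      mult_right_mono[OF root[of 1 n], of "ell2_norm f"] by simp
  have "norm z \<le> sqrt \<kappa>" if z: "z \<in> spectrum_on (ell2 (C \<times> {1..d})) B" for z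
  proof (rule ccontr)
    assume "\<not> norm z \<le> sqrt \<kappa>"
    then have lt: "sqrt \<kappa> < norm z" and pos: "0 < sqrt \<kappa>" using c(2) by auto
    obtain R1 where R1: "is_resolvent (ell2 (C \<times> {1..d})) (\<lambda>f. B_out f) z R1"
      using geometric_resolvent[OF bounded_rows_cutoff[OF bounded_rows_B_star] pos lt c' out] by blast
    obtain R2 where R2: "is_resolvent (ell2 (C \<times> {1..d})) (\<lambda>f. B_in f) z R2"
      using geometric_resolvent[OF bounded_rows_cutoff[OF bounded_rows_B_star] pos lt c' inw] by blast
    have "z \<noteq> 0" using lt pos by auto
    then have "\<exists>R. is_resolvent (ell2 (C \<times> {1..d})) B z R"
      using block_triangular_resolvent[OF bounded_rows_B_star _ B_triangular R1 R2] by blast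
    then show False using z by (simp add: spectrum_on_def)
  qed
  then have "spec_radius_on (ell2 (C \<times> {1..d})) B \<le> sqrt \<kappa>"
    unfolding spec_radius_on_def using c(2) by (intro cSup_least) auto
  also have "sqrt \<kappa> < 1" using c(3) by simp
  finally show ?thesis .
qed

end

section \<open>Filled sets\<close>

lemma full_eq_unbounded_component:
  assumes "bounded D"
  shows "\<exists>W. W \<in> components (- D) \<and> \<not> bounded W \<and> full D = - W \<and>
    (\<forall>V. V \<in> components (- D) \<longrightarrow> \<not> bounded V \<longrightarrow> V = W)"
proof -
  have cob: "bounded (- (- D))" using assms by simp
  obtain W where W: "W \<in> components (- D)" "\<not> bounded W"
    using cobounded_unbounded_components[OF cob] by blast
  have unique: "V = W" if "V \<in> components (- D)" "\<not> bounded V" for V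
    by (rule cobounded_unique_unbounded_components[OF cob W that]) simp
  then have "(THE V. V \<in> components (- D) \<and> \<not> bounded V) = W"
    using W by (intro the_equality) blast+
  then have "full D = - W" by (simp only: full_def)
  then show ?thesis
    using W unique by blast
qed

lemma subset_full:
  assumes "bounded D"
  shows "D \<subseteq> full D"
proof -
  obtain W where "W \<in> components (- D)" "full D = - W"
    using full_eq_unbounded_component[OF assms] by blast
  then show ?thesis
    using in_components_subset[of W "- D"] by blast
qed

text \<open>The unbounded component of the complement of \<open>D\<close> is connected, unbounded and avoids \<open>S\<close>, so it lies in
  the unbounded component of the complement of \<open>S\<close>.\<close>

lemma full_subset_full:
  assumes "bounded D" "bounded S" "S \<subseteq> full D"
  shows "full S \<subseteq> full D"
proof -
  obtain W where W: "W \<in> components (- D)" "\<not> bounded W" "full D = - W"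
    using full_eq_unbounded_component[OF assms(1)] by blast
  obtain V where V: "V \<in> components (- S)" "full S = - V"
    "\<forall>V'. V' \<in> components (- S) \<longrightarrow> \<not> bounded V' \<longrightarrow> V' = V"
    using full_eq_unbounded_component[OF assms(2)] by blast
  have sub: "W \<subseteq> - S"
    using W(3) assms(3) by blast
  then have "- S \<noteq> {}"
    using in_components_nonempty[OF W(1)] by blast
  then obtain V' where V': "V' \<in> components (- S)" "W \<subseteq> V'"
    using exists_component_superset[OF sub _ in_components_connected[OF W(1)]] by blast
  then have "\<not> bounded V'"
    using W(2) bounded_subset[OF _ V'(2)] by blast
  then have "V' = V"
    using V(3) V'(1) by blast
  then show ?thesis
    using V(2) V'(2) W(3) by blast
qed

section \<open>Comparison of the spectra\<close>

lemma hat_spectrum_bounded: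
  assumes "2 * q \<le> d"
  shows "bounded (hat_spectrum q d a)"
proof -
  interpret free_prod q d by unfold_locales (rule assms)
  obtain c1 where "spectrum_on (ell2 C) (A_star q d a) \<subseteq> cball 0 c1"
    using bounded_rows_spectrum_bounded[OF bounded_rows_A_star] by blast
  moreover obtain c2 where "spectrum_on (ell2 C) (A_star_o q d a) \<subseteq> cball 0 c2"
    using bounded_rows_spectrum_bounded[OF bounded_rows_A_star_o] by blast
  ultimately show ?thesis
    unfolding hat_spectrum_def using bounded_subset[OF bounded_cball] by auto
qed

text \<open>A supremum of reals is an upper bound only for bounded sets, so boundedness of the spectrum matters.\<close>

lemma spec_radius_ge:
  assumes "spectrum_on H T \<subseteq> cball 0 c" "z \<in> spectrum_on H T"
  shows "norm z \<le> spec_radius_on H T"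
  unfolding spec_radius_on_def
proof (rule cSup_upper)
  show "bdd_above (insert 0 (norm ` spectrum_on H T))"
    using assms(1) by (intro bdd_aboveI[of _ "max 0 c"]) (auto simp: subset_iff)
qed (use assms(2) in auto)

context perm_family
begin

lemma spectrum_A_perm_imp_spectrum_B_perm:
  fixes a :: "nat \<Rightarrow> complex^'r^'r"
  assumes U: "finite_codim_subspace X U" "\<And>i. i \<in> {1..d} \<Longrightarrow> perm_op (s i) ` U = U"
    and spec: "\<mu> \<notin> hat_spectrum q d a" "\<mu> \<in> spectrum_on (tensor_H U) (A_perm d a s)"
  shows "1 \<in> spectrum_on (tensor_K d U) (B_perm q d a s \<mu>)"
proof (rule ccontr)
  assume "1 \<notin> spectrum_on (tensor_K d U) (B_perm q d a s \<mu>)"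
  then obtain R where R: "is_resolvent (tensor_K d U)
      (nonbacktracking_op q d (a_hat q d a \<mu>) (\<lambda>i. perm_op (s i))) 1 R"
    by (auto simp: spectrum_on_def B_perm_def)
  interpret green q d a \<mu>
    by unfold_locales (rule two_q spec(1))+
  show False
    using resolvent_of_nonbacktracking_resolvent[OF backtrack_inv a_g_eq a0_g_eq g_inverse U R] spec(2)
    unfolding spectrum_on_def by blast
qed

text \<open>If a point \<open>\<mu>\<close> of the spectrum of \<open>A\<close> lies outside the filled set, then \<open>\<rho>(B\<^sub>\<mu>) \<ge> 1\<close>, and the hypothesis fails
  at \<open>\<mu>\<close> for \<open>\<delta> = 1 - \<rho>((B\<^sub>\<star>)\<^sub>\<mu>)\<close>.  Otherwise the inclusion holds for every \<open>\<epsilon>\<close>.\<close>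

lemma spectral_inclusion:
  fixes a :: "nat \<Rightarrow> complex^'r^'r"
  assumes U: "finite_codim_subspace X U" "\<And>i. i \<in> {1..d} \<Longrightarrow> perm_op (s i) ` U = U"
    and \<epsilon>: "0 < \<epsilon>"
    and radius: "\<And>\<mu>. \<mu> \<notin> hat_spectrum q d a \<Longrightarrow>
      spec_radius_on (ell2 (carrier (Xstar q d) \<times> {1..d})) (B_star q d a \<mu>) < 1"
  shows "\<exists>\<delta>>0. (\<forall>\<mu>. \<mu> \<notin> hat_spectrum q d a \<longrightarrow>
        spec_radius_on (tensor_K d U) (B_perm q d a s \<mu>) <
        spec_radius_on (ell2 (carrier (Xstar q d) \<times> {1..d})) (B_star q d a \<mu>) + \<delta>) \<longrightarrow>
      full (spectrum_on (tensor_H U) (A_perm d a s)) \<subseteq> nbhd \<epsilon> (full (hat_spectrum q d a))"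
proof -
  let ?\<sigma> = "spectrum_on (tensor_H U) (A_perm d a s)" and ?hat = "hat_spectrum q d a"
  have UX: "U \<subseteq> ell2 X"
    using U(1) by (simp add: finite_codim_subspace_def)
  obtain c where c: "?\<sigma> \<subseteq> cball 0 c"
    using spectrum_finite_codim_bounded[OF bounded_rows_A_perm tensor_finite_codim(1)[OF U(1)]
        tensor_K_subset(1)[OF UX] A_perm_invariant[OF U] tensor_finite_codim(3)[OF U(1)]] by blast
  show ?thesis
  proof (cases "?\<sigma> \<subseteq> full ?hat")
    case True
    have "full ?\<sigma> \<subseteq> full ?hat"
      using full_subset_full[OF hat_spectrum_bounded[OF two_q] bounded_subset[OF bounded_cball c] True] .
    also have "\<dots> \<subseteq> nbhd \<epsilon> (full ?hat)"
      using \<epsilon> by (auto simp: nbhd_def)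
    finally show ?thesis by (intro exI[of _ 1]) simp
  next
    case False
    then obtain \<mu> where \<mu>: "\<mu> \<in> ?\<sigma>" "\<mu> \<notin> full ?hat" by blast
    then have out: "\<mu> \<notin> ?hat"
      using subset_full[OF hat_spectrum_bounded[OF two_q, of a]] by blast
    obtain c' where c': "spectrum_on (tensor_K d U) (B_perm q d a s \<mu>) \<subseteq> cball 0 c'"
      using spectrum_finite_codim_bounded[OF bounded_rows_B_perm tensor_finite_codim(2)[OF U(1)]
          tensor_K_subset(2)[OF UX] _ tensor_finite_codim(4)[OF U(1)]]
        nonbacktracking_invariant[OF U] unfolding B_perm_def by blast
    have "1 \<le> spec_radius_on (tensor_K d U) (B_perm q d a s \<mu>)"
      using spec_radius_ge[OF c' spectrum_A_perm_imp_spectrum_B_perm[OF U out \<mu>(1)]] by simp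
    then have "\<not> (\<forall>\<mu>. \<mu> \<notin> ?hat \<longrightarrow> spec_radius_on (tensor_K d U) (B_perm q d a s \<mu>) <
        spec_radius_on (ell2 (carrier (Xstar q d) \<times> {1..d})) (B_star q d a \<mu>) + \<delta>)"
      if "\<delta> = 1 - spec_radius_on (ell2 (carrier (Xstar q d) \<times> {1..d})) (B_star q d a \<mu>)" for \<delta>
      using out that by (simp add: not_less) (rule exI[of _ \<mu>], simp)
    then show ?thesis
      using radius[OF out] by (meson diff_gt_0_iff_gt)
  qed
qed

end

theorem theorem12:
  fixes X :: "'x set" and q d :: nat
    and a :: "nat \<Rightarrow> complex^'r^'r"
    and s :: "nat \<Rightarrow> 'x \<Rightarrow> 'x"
  assumes "countable X"
    and "1 \<le> d" and "2 * q \<le> d"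
    and "\<forall>i\<in>{1..d}. s i permutes X"
    and "\<forall>i\<in>{1..d}. s (conj_idx q i) = inv_into UNIV (s i)"
  shows
    "(\<forall>\<mu>. \<mu> \<notin> full (hat_spectrum q d a) \<longrightarrow>
        spec_radius_on (ell2 (carrier (Xstar q d) \<times> {1..d})) (B_star q d a \<mu>) < 1) \<and>
     (\<forall>\<epsilon>>0. \<exists>\<delta>>0.
        (\<forall>\<mu>. \<mu> \<notin> hat_spectrum q d a \<longrightarrow>
           spec_radius_on (ell2 (X \<times> {1..d})) (B_perm q d a s \<mu>) <
           spec_radius_on (ell2 (carrier (Xstar q d) \<times> {1..d})) (B_star q d a \<mu>) + \<delta>) \<longrightarrow>
        full (spectrum_on (ell2 X) (A_perm d a s)) \<subseteq> nbhd \<epsilon> (full (hat_spectrum q d a))) \<and>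
     (\<forall>U. finite_codim_subspace X U \<and> (\<forall>i\<in>{1..d}. perm_op (s i) ` U = U) \<longrightarrow>
        (\<forall>\<epsilon>>0. \<exists>\<delta>>0.
           (\<forall>\<mu>. \<mu> \<notin> hat_spectrum q d a \<longrightarrow>
              spec_radius_on (tensor_K d U) (B_perm q d a s \<mu>) <
              spec_radius_on (ell2 (carrier (Xstar q d) \<times> {1..d})) (B_star q d a \<mu>) + \<delta>) \<longrightarrow>
           full (spectrum_on (tensor_H U) (A_perm d a s)) \<subseteq> nbhd \<epsilon> (full (hat_spectrum q d a))))"
proof (intro conjI)
  interpret perm_family q d X s
  proof
    show "2 * q \<le> d" by (rule assms(3))
    show "s i permutes X" if "i \<in> {1..d}" for i
      using assms(4) that by (rule bspec)
    show "s (conj_idx q i) = inv_into UNIV (s i)" if "i \<in> {1..d}" for i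
      using assms(5) that by (rule bspec)
  qed
  have radius: "spec_radius_on (ell2 (carrier (Xstar q d) \<times> {1..d})) (B_star q d a \<mu>) < 1"
    if "\<mu> \<notin> hat_spectrum q d a" for \<mu>
  proof -
    interpret green q d a \<mu>
      by unfold_locales (rule assms(3) that)+
    show ?thesis by (rule spec_radius_B_star_less_1)
  qed
  show "\<forall>\<mu>. \<mu> \<notin> full (hat_spectrum q d a) \<longrightarrow>
      spec_radius_on (ell2 (carrier (Xstar q d) \<times> {1..d})) (B_star q d a \<mu>) < 1"
    using radius subset_full[OF hat_spectrum_bounded[OF assms(3), of a]] by blast
  have inclusion: "\<forall>\<epsilon>>0. \<exists>\<delta>>0. (\<forall>\<mu>. \<mu> \<notin> hat_spectrum q d a \<longrightarrow>
        spec_radius_on (tensor_K d U) (B_perm q d a s \<mu>) <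
        spec_radius_on (ell2 (carrier (Xstar q d) \<times> {1..d})) (B_star q d a \<mu>) + \<delta>) \<longrightarrow>
      full (spectrum_on (tensor_H U) (A_perm d a s)) \<subseteq> nbhd \<epsilon> (full (hat_spectrum q d a))"
    if "finite_codim_subspace X U" "\<forall>i\<in>{1..d}. perm_op (s i) ` U = U" for U
    by (intro allI impI spectral_inclusion[OF that(1) bspec[OF that(2)] _ radius])
  show "\<forall>U. finite_codim_subspace X U \<and> (\<forall>i\<in>{1..d}. perm_op (s i) ` U = U) \<longrightarrow>
      (\<forall>\<epsilon>>0. \<exists>\<delta>>0.
        (\<forall>\<mu>. \<mu> \<notin> hat_spectrum q d a \<longrightarrow>
          spec_radius_on (tensor_K d U) (B_perm q d a s \<mu>) <
          spec_radius_on (ell2 (carrier (Xstar q d) \<times> {1..d})) (B_star q d a \<mu>) + \<delta>) \<longrightarrow>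
        full (spectrum_on (tensor_H U) (A_perm d a s)) \<subseteq> nbhd \<epsilon> (full (hat_spectrum q d a)))"
  proof (rule allI, rule impI)
    fix U
    assume U: "finite_codim_subspace X U \<and> (\<forall>i\<in>{1..d}. perm_op (s i) ` U = U)"
    show "\<forall>\<epsilon>>0. \<exists>\<delta>>0. (\<forall>\<mu>. \<mu> \<notin> hat_spectrum q d a \<longrightarrow>
          spec_radius_on (tensor_K d U) (B_perm q d a s \<mu>) <
          spec_radius_on (ell2 (carrier (Xstar q d) \<times> {1..d})) (B_star q d a \<mu>) + \<delta>) \<longrightarrow>
        full (spectrum_on (tensor_H U) (A_perm d a s)) \<subseteq> nbhd \<epsilon> (full (hat_spectrum q d a))"
      by (rule inclusion[OF U[THEN conjunct1] U[THEN conjunct2]])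
  qed
  have perm: "\<forall>i\<in>{1..d}. perm_op (s i) ` ell2 X = ell2 X"
    by (rule ballI) (rule perm_op_ell2)
  show "\<forall>\<epsilon>>0. \<exists>\<delta>>0.
      (\<forall>\<mu>. \<mu> \<notin> hat_spectrum q d a \<longrightarrow>
        spec_radius_on (ell2 (X \<times> {1..d})) (B_perm q d a s \<mu>) <
        spec_radius_on (ell2 (carrier (Xstar q d) \<times> {1..d})) (B_star q d a \<mu>) + \<delta>) \<longrightarrow>
      full (spectrum_on (ell2 X) (A_perm d a s)) \<subseteq> nbhd \<epsilon> (full (hat_spectrum q d a))"
    using inclusion[OF finite_codim_subspace_ell2 perm] unfolding tensor_H_ell2 tensor_K_ell2 .
qed

end
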